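(* In the setting of the context (boundary maximum), write $X(N)=(X_1(N),Y(N))$ and $x^*=(x_1^*,y^* )$ with $x_1^*=0$, and let $$Z(N)=\big(N(x_1^*-X_1(N)),\ \sqrt N(y^*-Y(N))\big).$$ Then, as $N\to\infty$, $Z(N)$ converges weakly: $-Z_1(N)=N(X_1(N)-x_1^* )$ converges to the exponential distribution with rate $\big|\frac{\partial f(x^* )}{\partial x_1}\big|$, and $(Z_2(N),\dots,Z_m(N))$ converges to the normal distribution $\mathcal{N}\big(0,-D_y^2f(x^* )^{-1}\big)$. Furthermore, there is $h>0$ such that for each fixed $\xi\in\mathbb{R}^m$ with $|\xi|<h$ the moment generating function $M_{Z(N)}(\xi)=\mathbb{E}\,e^{\xi^TZ(N)}$ satisfies $$M_{Z(N)}(\xi)=\frac{\big|\frac{\partial f(x^* )}{\partial x_1}\big|}{\big|\frac{\partial f(x^* )}{\partial x_1}-\xi_1\big|}\,e^{-\frac12\hat\xi^TD_y^2f(x^* )^{-1}\hat\xi}\bigg(1+\frac{O(1)}{\sqrt N}+\epsilon(N)\sqrt N\,O(1)\bigg),\qquad N\to\infty,$$ where $\hat\xi=(\xi_2,\dots,\xi_m)$.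
   Context: $\mathbb{Z}_+$ is the set of positive integers and $m\ge2$. Points are written $x=(x_1,y)$ with $y=(x_2,\dots,x_m)$; $D_y$ denotes differentiation in $y$ only, and $D_y^2f(x^* )^{-1}$ is the inverse of the matrix $D_y^2f(x^* )$. $\Omega\subset\mathbb{R}^m$ is open and bounded, and $\Omega'\subset\Omega$ is the closed ball centered at the origin with radius $\varepsilon>0$. $f:\Omega\times\mathbb{Z}_+\to\mathbb{R}$ is such that $f(\cdot,N)$ and its $x$-derivatives up to third order exist on $\Omega'$ and are bounded there uniformly in $x$ and $N$, and the Hessian $D^2f(x,N)$ is nonsingular there. There is $N_0\in\mathbb{Z}_+$ such that for all $N\ge N_0$ the function $f(\cdot,N)$ has a unique maximum on $\Omega\cap\{x:x_1\ge0\}$, attained at $x^*(N)\in\Omega'\cap\{x:x_1=0\}$, with $$\Delta:=\inf_{N\ge N_0,\ x\in\Omega\setminus\Omega'}\{f(x^*(N),N)-f(x,N)\}>0 .$$ The origin of coordinates is $x^*=\lim_{N\to\infty}x^*(N)$. Moreover $\inf_{x\in\Omega',N\ge N_0}|\partial f(x,N)/\partial x_1|>0$, $\inf_{x\in\Omega',N\ge N_0}\|D_y^2f(x,N)^{-1/2}\|^{-2}>0$ (the quantity being the smallest absolute value of an eigenvalue of $D_y^2f(x,N)$), $\inf_{x\in\Omega',N\ge N_0}\sqrt{|\det D_y^2f(x,N)|}>0$, $\sup_{x\in\Omega',N\ge N_0}\|D^2f(x,N)\|<\infty$, $\sup_{x\in\Omega',N\ge N_0}\|D^3f(x,N)\|<\infty$.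 For every $x_1\in(0,\varepsilon)$ the set $\arg\max_{y\in\Omega'(x_1)}f(x_1,y,N)$ is a single point, where $\Omega'(x_1)=\{y:(x_1,y)\in\Omega'\}$. The integrals $\int_{\Omega\cap\{x_1\ge0\}}e^{Nf(x,N)}dx$ exist and are finite, and there is a constant $C>0$ with $C\ge\int_\Omega e^{N_0f(x,N)}dx$ for all $N\ge N_0$. In addition $f(x,N)=f(x)+\epsilon(N)\sigma(x)$, where $f,\sigma$ are functions of $x$ with derivatives up to second order at $x^*$, the Hessian $D^2f(x^* )$ is nonsingular, $\epsilon(N)>0$ and $\epsilon(N)=o(1/\sqrt N)$ as $N\to\infty$. For $N\ge N_0$, $X(N)$ is the random vector with values in $\Omega\cap\{x:x_1\ge0\}$ and distribution $$P_N(X(N)\in B)=\frac{\int_Be^{Nf(x,N)}dx}{\int_{\Omega\cap\{x:x_1\ge0\}}e^{Nf(x,N)}dx},\qquad B\in\mathcal{B}(\Omega\cap\{x:x_1\ge0\})\ \text{(Borel sets)}.$$ *)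

theory Defs
  imports "HOL-Probability.Probability"
begin

text \<open>
  Points \<open>(x\<^sub>1, y)\<close> of \<open>m\<close>-dimensional space are elements of \<open>'n point\<close>, where \<open>CARD('n) = m - 1\<close>
  ranges over all positive integers. First, second and third derivatives are bounded linear,
  bilinear and trilinear forms, carrying the operator norm.
\<close>

type_synonym 'n point = "real \<times> (real ^ 'n)"

definition std_basis :: "'n::finite option \<Rightarrow> 'n point" where
  "std_basis k = (case k of None \<Rightarrow> (1, 0) | Some i \<Rightarrow> (0, axis i 1))"

text \<open>The derivative in \<open>x\<^sub>1\<close>, read off from the total derivative.\<close>

definition d1 :: "('n::finite point \<Rightarrow>\<^sub>L real) \<Rightarrow> real" where
  "d1 D = blinfun_apply D (1, 0)"

definition hessian ::
  "('n::finite point \<Rightarrow>\<^sub>L 'n point \<Rightarrow>\<^sub>L real) \<Rightarrow> (real ^ ('n option)) ^ ('n option)" where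
  "hessian D2 = (\<chi> i j. blinfun_apply (blinfun_apply D2 (std_basis i)) (std_basis j))"

definition hessian_y ::
  "('n::finite point \<Rightarrow>\<^sub>L 'n point \<Rightarrow>\<^sub>L real) \<Rightarrow> real ^ 'n ^ 'n" where
  "hessian_y D2 = (\<chi> i j. blinfun_apply (blinfun_apply D2 (0, axis i 1)) (0, axis j 1))"

text \<open>For a nonsingular symmetric matrix \<open>A\<close> this is the inverse square of the operator norm of
  \<open>A\<close> to the power \<open>-1/2\<close>.\<close>

definition min_abs_eigenvalue :: "real ^ 'n ^ 'n \<Rightarrow> real" where
  "min_abs_eigenvalue A = Min {\<bar>c\<bar> | c. \<exists>v. v \<noteq> 0 \<and> A *v v = c *\<^sub>R v}"

definition has_two_derivatives_at ::
  "('a::real_normed_vector \<Rightarrow> real) \<Rightarrow> ('a \<Rightarrow> 'a \<Rightarrow>\<^sub>L real) \<Rightarrow> ('a \<Rightarrow>\<^sub>L 'a \<Rightarrow>\<^sub>L real) \<Rightarrow> 'a \<Rightarrow> bool" where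
  "has_two_derivatives_at g D D2 a \<longleftrightarrow>
     (\<forall>\<^sub>F x in nhds a. (g has_derivative blinfun_apply (D x)) (at x)) \<and>
     (D has_derivative blinfun_apply D2) (at a)"

text \<open>Weak convergence of laws on a topological space; the library's \<open>weak_conv_m\<close> covers only
  laws on the real line.\<close>

definition weakly_converges :: "(nat \<Rightarrow> 'a::topological_space measure) \<Rightarrow> 'a measure \<Rightarrow> bool" where
  "weakly_converges \<mu> \<nu> \<longleftrightarrow>
     (\<forall>g :: 'a \<Rightarrow> real. continuous_on UNIV g \<and> bounded (range g) \<longrightarrow>
        (\<lambda>n. integral\<^sup>L (\<mu> n) g) \<longlonglongrightarrow> integral\<^sup>L \<nu> g)"

definition exponential_law :: "real \<Rightarrow> real measure" where
  "exponential_law l = density lborel (\<lambda>x. ennreal (exponential_density l x))"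

text \<open>The normal law with mean \<open>a\<close> and positive definite covariance matrix \<open>S\<close>.\<close>

definition normal_law :: "real ^ 'n \<Rightarrow> real ^ 'n ^ 'n \<Rightarrow> (real ^ 'n) measure" where
  "normal_law a S = density lborel (\<lambda>y. ennreal
     (exp (- ((y - a) \<bullet> (matrix_inv S *v (y - a))) / 2) / sqrt ((2 * pi) ^ CARD('n) * det S)))"

definition rescaled :: "'n::finite point \<Rightarrow> nat \<Rightarrow> 'n point \<Rightarrow> 'n point" where
  "rescaled a N x = (real N * (fst a - fst x), sqrt (real N) *\<^sub>R (snd a - snd x))"

definition mgf :: "'w measure \<Rightarrow> ('w \<Rightarrow> 'a::real_inner) \<Rightarrow> 'a \<Rightarrow> real" where
  "mgf M Z \<xi> = (LINT w|M. exp (\<xi> \<bullet> Z w))"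

end

theory Submission
  imports Defs
begin

text \<open>
  The proof is Laplace's method at a boundary maximum, carried out directly in the rescaled
  coordinate \<open>z = rescaled 0 N x\<close>, that is \<open>x = (-z\<^sub>1/N, -z\<^sub>2/\<surd>N)\<close>. The law of \<open>Z(N)\<close> has a density
  proportional to \<open>weight N z = exp (N (f(x,N) - f(0,N)))\<close> on the rescaled copy of \<open>S\<close> and \<open>0\<close>
  elsewhere. All four claims follow from one weighted estimate (\<open>weight_close\<close>):
  for suitable \<open>b, C > 0\<close> and all large \<open>N\<close>,
    \<open>\<bar>weight N z - limit_weight z\<bar> \<le> C (1/\<surd>N + eps(N) \<surd>N) exp (-b \<parallel>z\<parallel>)\<close>,
  where \<open>limit_weight z = exp (-a z\<^sub>1 + z\<^sub>2 \<bullet> H z\<^sub>2 / 2)\<close> for \<open>z\<^sub>1 \<le> 0\<close> and \<open>0\<close> for \<open>z\<^sub>1 > 0\<close>. Integrating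
  it against any Borel function \<open>G\<close> with \<open>\<bar>G z\<bar> \<le> A exp (h \<parallel>z\<parallel>)\<close>, \<open>h < b\<close>, and dividing by the
  same estimate for \<open>G = 1\<close> gives \<open>E G(Z(N)) = \<integral> G d\<mu> + O(1/\<surd>N + eps(N) \<surd>N)\<close>, where \<open>\<mu>\<close> has the
  density proportional to \<open>limit_weight\<close> (\<open>expectation_close\<close>, \<open>expectation_limit\<close>). Bounded continuous \<open>G\<close> and
  indicators of half lines give the weak limits, \<open>G z = exp (\<xi> \<bullet> z)\<close> the moment generating function.

  The weighted estimate rests on three facts about \<open>f\<close>.
  First, the first and second order conditions at the maximum \<open>(0, y\<^sub>N)\<close> fix the signs there, and the
  nondegeneracy bounds propagate them over the connected ball \<open>\<Omega>'\<close>: \<open>\<partial>f/\<partial>x\<^sub>1 \<le> -c\<close> and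
  \<open>D\<^sub>y\<^sup>2f \<le> -c\<close> for large \<open>N\<close> (\<open>d1_negative\<close>, \<open>D2f_negative\<close>). Hence \<open>f(x,N) - f(0,N)\<close> is at most
  \<open>-c x\<^sub>1 - c \<parallel>y\<parallel>\<^sup>2 / 2 + O(eps(N)) \<parallel>y\<parallel>\<close> on \<open>\<Omega>'\<close>, which yields the exponential factor there.
  Second, the limit function satisfies \<open>D\<^sub>yf(x\<^sup>*) = 0\<close>, so that \<open>D\<^sub>yf(0,N) = O(eps(N))\<close>, and Taylor's formula at \<open>0\<close>
  bounds the error of the exponent by a constant times \<open>(1/\<surd>N + eps(N) \<surd>N) (1 + \<parallel>z\<parallel>)\<^sup>3\<close> (\<open>exponent_error\<close>).
  Expanding at the limit point \<open>0\<close> instead of at the maximiser removes any need to control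
  \<open>\<surd>N y\<^sub>N\<close>. Third, off \<open>\<Omega>'\<close> the gap \<open>\<Delta>\<close> gives a factor \<open>exp (-N \<Delta>/2)\<close>; since \<open>\<Omega>\<close> is bounded,
  \<open>\<parallel>z\<parallel> \<le> N sup \<parallel>x\<parallel>\<close>, so this factor is again exponentially small in \<open>\<parallel>z\<parallel>\<close>, while
  \<open>\<parallel>z\<parallel> \<ge> \<epsilon> \<surd>N\<close> supplies the factor \<open>1/\<surd>N\<close>.
\<close>

section \<open>Lebesgue integrals: linear maps, the Gaussian, exponential tails\<close>

lemma nn_integral_lborel_translate:
  fixes F :: "'a::euclidean_space \<Rightarrow> ennreal"
  assumes [measurable]: "F \<in> borel_measurable borel"
  shows "(\<integral>\<^sup>+x. F (c + x) \<partial>lborel) = (\<integral>\<^sup>+x. F x \<partial>lborel)"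
proof -
  have "(\<integral>\<^sup>+x. F x \<partial>lborel) = (\<integral>\<^sup>+x. F x \<partial>distr lborel borel ((+) c))"
    by (simp add: lborel_distr_plus)
  then show ?thesis by (simp add: nn_integral_distr)
qed

text \<open>Averaging over translations along \<open>e\<close> makes the shift \<open>\<phi> x\<close> disappear in an inner integral over
  the line, so only translation invariance and Tonelli's theorem are needed.\<close>

lemma nn_integral_lborel_shear:
  fixes F :: "'a::euclidean_space \<Rightarrow> ennreal" and \<phi> :: "'a \<Rightarrow> real"
  assumes F[measurable]: "F \<in> borel_measurable borel"
    and \<phi>[measurable]: "\<phi> \<in> borel_measurable borel"
    and inv: "\<And>x t. \<phi> (x + t *\<^sub>R e) = \<phi> x" and e: "e \<in> Basis"
  shows "(\<integral>\<^sup>+x. F (x + \<phi> x *\<^sub>R e) \<partial>lborel) = (\<integral>\<^sup>+x. F x \<partial>lborel)"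
proof -
  \<comment> \<open>any nonnegative function with integral \<open>1\<close> serves as the averaging weight\<close>
  define g :: "real \<Rightarrow> ennreal" where "g = indicator {0..1}"
  have [measurable]: "g \<in> borel_measurable borel" by (simp add: g_def)
  have e1: "e \<bullet> e = 1" using e by simp
  have g1: "(\<integral>\<^sup>+t. g (s + t) \<partial>lborel) = 1" for s :: real
    by (subst nn_integral_lborel_translate) (simp_all add: g_def)
  have *: "(\<integral>\<^sup>+x. F (x + \<psi> x *\<^sub>R e) \<partial>lborel) =
        (\<integral>\<^sup>+x. g (x \<bullet> e) * (\<integral>\<^sup>+t. F (x - t *\<^sub>R e) \<partial>lborel) \<partial>lborel)"
    if [measurable]: "\<psi> \<in> borel_measurable borel" and inv: "\<And>x t. \<psi> (x + t *\<^sub>R e) = \<psi> x"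
    for \<psi> :: "'a \<Rightarrow> real"
  proof -
    have "(\<integral>\<^sup>+x. F (x + \<psi> x *\<^sub>R e) \<partial>lborel) =
        (\<integral>\<^sup>+x. (\<integral>\<^sup>+t. F (x + \<psi> x *\<^sub>R e) * g (x \<bullet> e + t) \<partial>lborel) \<partial>lborel)"
      by (simp add: nn_integral_cmult g1)
    also have "\<dots> = (\<integral>\<^sup>+t. (\<integral>\<^sup>+x. F (x + \<psi> x *\<^sub>R e) * g (x \<bullet> e + t) \<partial>lborel) \<partial>lborel)"
      by (subst lborel_pair.Fubini') simp_all
    also have "\<dots> = (\<integral>\<^sup>+t. (\<integral>\<^sup>+x. F (x + (\<psi> x - t) *\<^sub>R e) * g (x \<bullet> e) \<partial>lborel) \<partial>lborel)"
    proof (rule nn_integral_cong)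
      fix t :: real
      have "(\<integral>\<^sup>+x. F (x + \<psi> x *\<^sub>R e) * g (x \<bullet> e + t) \<partial>lborel) =
        (\<integral>\<^sup>+x. F ((((-t) *\<^sub>R e) + x) + \<psi> ((- t) *\<^sub>R e + x) *\<^sub>R e) * g (((-t) *\<^sub>R e + x) \<bullet> e + t) \<partial>lborel)"
        by (rule nn_integral_lborel_translate[symmetric, of _ "(-t) *\<^sub>R e"]) simp
      also have "\<dots> = (\<integral>\<^sup>+x. F (x + (\<psi> x - t) *\<^sub>R e) * g (x \<bullet> e) \<partial>lborel)"
        using inv[of _ "-t"] by (intro nn_integral_cong) (simp add: algebra_simps e1)
      finally show "(\<integral>\<^sup>+x. F (x + \<psi> x *\<^sub>R e) * g (x \<bullet> e + t) \<partial>lborel) = \<dots>" .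
    qed
    also have "\<dots> = (\<integral>\<^sup>+x. (\<integral>\<^sup>+t. F (x + (\<psi> x - t) *\<^sub>R e) * g (x \<bullet> e) \<partial>lborel) \<partial>lborel)"
      by (subst lborel_pair.Fubini') simp_all
    also have "\<dots> = (\<integral>\<^sup>+x. g (x \<bullet> e) * (\<integral>\<^sup>+t. F (x - t *\<^sub>R e) \<partial>lborel) \<partial>lborel)"
    proof (rule nn_integral_cong)
      fix x
      have "(\<integral>\<^sup>+t. F (x - t *\<^sub>R e) \<partial>lborel) = (\<integral>\<^sup>+t. F (x - ((- \<psi> x) + t) *\<^sub>R e) \<partial>lborel)"
        by (rule nn_integral_lborel_translate[symmetric, of "\<lambda>t. F (x - t *\<^sub>R e)"]) simp
      moreover have "F (x - ((- \<psi> x) + t) *\<^sub>R e) = F (x + (\<psi> x - t) *\<^sub>R e)" for t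
        by (simp add: algebra_simps)
      ultimately show "(\<integral>\<^sup>+t. F (x + (\<psi> x - t) *\<^sub>R e) * g (x \<bullet> e) \<partial>lborel) = g (x \<bullet> e) * (\<integral>\<^sup>+t. F (x - t *\<^sub>R e) \<partial>lborel)"
        by (simp add: mult.commute nn_integral_cmult)
    qed
    finally show ?thesis .
  qed
  show ?thesis
    using *[OF \<phi> inv] *[of "\<lambda>_. 0"] by simp
qed

text \<open>Linear change of variables, by reduction to elementary matrices: diagonal matrices, transpositions
  of coordinates (which map boxes to boxes) and shears.\<close>

lemma nn_integral_lborel_linear:
  fixes A :: "real^'n^'n" and F :: "real^'n \<Rightarrow> ennreal"
  assumes "invertible A" "F \<in> borel_measurable borel"
  shows "ennreal \<bar>det A\<bar> * (\<integral>\<^sup>+x. F (A *v x) \<partial>lborel) = (\<integral>\<^sup>+x. F x \<partial>lborel)"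
proof -
  have meas: "(*v) B \<in> borel_measurable borel" for B :: "real^'n^'n"
    by (simp add: borel_measurable_continuous_onI linear_continuous_on matrix_vector_mul_bounded_linear)
  have "\<forall>F \<in> borel_measurable borel. invertible A \<longrightarrow> ennreal \<bar>det A\<bar> * (\<integral>\<^sup>+x. F (A *v x) \<partial>lborel) = (\<integral>\<^sup>+x. F x \<partial>lborel)"
  proof (induction A rule: induct_matrix_elementary[case_names mult zero_row diagonal swap1 idplus])
    case (mult A B)
    show ?case
    proof (intro ballI impI)
      fix F :: "real^'n \<Rightarrow> ennreal" assume F[measurable]: "F \<in> borel_measurable borel" and inv: "invertible (A ** B)"
      have iA: "invertible A" and iB: "invertible B"
        using inv by (simp_all add: invertible_det_nz det_mul)
      note meas[of A, measurable] meas[of B, measurable]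
      have "(\<integral>\<^sup>+x. F x \<partial>lborel) = ennreal \<bar>det A\<bar> * (\<integral>\<^sup>+x. F (A *v x) \<partial>lborel)"
        using mult(1) iA F by simp
      also have "(\<integral>\<^sup>+x. F (A *v x) \<partial>lborel) = ennreal \<bar>det B\<bar> * (\<integral>\<^sup>+x. F (A *v (B *v x)) \<partial>lborel)"
        using mult(2)[rule_format, of "\<lambda>x. F (A *v x)"] iB by simp
      finally show "ennreal \<bar>det (A ** B)\<bar> * (\<integral>\<^sup>+x. F ((A ** B) *v x) \<partial>lborel) = (\<integral>\<^sup>+x. F x \<partial>lborel)"
        by (simp add: det_mul abs_mult ennreal_mult' matrix_vector_mul_assoc mult.assoc)
    qed
  next
    case (zero_row A i)
    then show ?case by (metis det_zero_row(1) invertible_det_nz)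
  next
    case (diagonal A)
    show ?case
    proof (intro ballI impI)
      fix F :: "real^'n \<Rightarrow> ennreal" assume F[measurable]: "F \<in> borel_measurable borel" and inv: "invertible A"
      have d: "det A = (\<Prod>i\<in>UNIV. A $ i $ i)"
        using diagonal by (intro det_diagonal) auto
      with inv have nz: "A $ i $ i \<noteq> 0" for i by (auto simp: invertible_det_nz)
      define c :: "real^'n \<Rightarrow> real" where "c = (\<lambda>b. b \<bullet> (A *v b))"
      have c: "c (axis i 1) = A $ i $ i" for i
        by (simp add: c_def inner_axis' matrix_vector_mult_basis column_def)
      have nz': "c j \<noteq> 0" if "j \<in> Basis" for j using that nz c by (auto simp: Basis_vec_def)
      have inj: "inj (\<lambda>i::'n. axis i (1::real))" by (auto simp: inj_def axis_eq_axis)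
      have B: "(Basis :: (real^'n) set) = range (\<lambda>i. axis i 1)" by (auto simp: Basis_vec_def)
      have pr: "(\<Prod>j\<in>Basis. \<bar>c j\<bar>) = \<bar>det A\<bar>"
        unfolding B by (subst prod.reindex[OF inj]) (simp add: d c abs_prod)
      have T: "(0 + (\<Sum>j\<in>Basis. (c j * (x \<bullet> j)) *\<^sub>R j)) = A *v x" for x
      proof -
        have "(\<Sum>j\<in>Basis. (c j * (x \<bullet> j)) *\<^sub>R j) = (\<Sum>i\<in>UNIV. (A $ i $ i * x $ i) *\<^sub>R axis i 1)"
          unfolding B by (subst prod.reindex[OF inj] sum.reindex[OF inj])+ (simp add: c inner_axis)
        also have "\<dots> = A *v x"
        proof (subst vec_eq_iff, intro allI)
          fix i
          have "(A *v x) $ i = (\<Sum>j\<in>UNIV. A $ i $ j * x $ j)"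
            by (simp add: matrix_vector_mult_def)
          also have "\<dots> = (\<Sum>j\<in>UNIV. if j = i then A $ i $ i * x $ i else 0)"
            by (rule sum.cong) (auto simp: diagonal)
          finally show "(\<Sum>i\<in>UNIV. (A $ i $ i * x $ i) *\<^sub>R axis i 1) $ i = (A *v x) $ i"
            by (simp add: sum.delta axis_def if_distrib cong: if_cong)
        qed
        finally show ?thesis by simp
      qed
      note meas[of A, measurable]
      have "(\<integral>\<^sup>+x. F x \<partial>lborel) = (\<integral>\<^sup>+x. F x \<partial>density (distr lborel borel ((*v) A)) (\<lambda>_. ennreal \<bar>det A\<bar>))"
        using lborel_affine_euclidean[of c 0, OF nz'] unfolding T pr by simp
      also have "\<dots> = ennreal \<bar>det A\<bar> * (\<integral>\<^sup>+x. F (A *v x) \<partial>lborel)"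
        by (simp add: nn_integral_density nn_integral_distr nn_integral_cmult)
      finally show "ennreal \<bar>det A\<bar> * (\<integral>\<^sup>+x. F (A *v x) \<partial>lborel) = (\<integral>\<^sup>+x. F x \<partial>lborel)" ..
    qed
  next
    case (swap1 m n)
    define A :: "real^'n^'n" where "A = (\<chi> i j. mat 1 $ i $ Transposition.transpose m n j)"
    let ?t = "Transposition.transpose m n"
    have Ax: "(A *v x) $ i = x $ ?t i" for x i
    proof -
      have "(A *v x) $ i = (\<Sum>j\<in>UNIV. if j = ?t i then x $ j else 0)"
        unfolding matrix_vector_mult_def A_def mat_def vec_lambda_beta
        by (intro sum.cong) (auto simp: transpose_apply_commute)
      then show ?thesis by simp
    qed
    have inv: "A *v (A *v x) = x" for x by (simp add: vec_eq_iff Ax)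
    then have "A ** A = mat 1"
      by (metis matrix_eq matrix_vector_mul_assoc matrix_vector_mul_lid)
    then have "det A * det A = 1" by (metis det_I det_mul)
    then have d: "\<bar>det A\<bar> = 1" by (metis abs_1 abs_mult abs_mult_self_eq mult_1 square_eq_1_iff abs_minus_cancel)
    have io: "(A *v x) \<bullet> y = x \<bullet> (A *v y)" for x y
      unfolding inner_vec_def Ax by (rule sum.reindex_bij_witness[of _ ?t ?t]) auto
    have Abas: "A *v b \<in> Basis" if b: "b \<in> Basis" for b
    proof -
      obtain i where "b = axis i 1" using b by (auto simp: Basis_vec_def)
      then have "A *v b = axis (?t i) 1"
        by (auto simp: vec_eq_iff Ax axis_def transpose_apply_commute)
      then show ?thesis by simp
    qed
    note meas[of A, measurable]
    have eq: "lborel = distr lborel borel ((*v) A)"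
    proof (rule lborel_eqI)
      fix l u :: "real^'n" assume le: "\<And>b. b \<in> Basis \<Longrightarrow> l \<bullet> b \<le> u \<bullet> b"
      have "(*v) A -` box l u = box (A *v l) (A *v u)"
        unfolding box_def io using Abas inv by (auto simp: io) (metis io inv)+
      moreover have "(\<Prod>b\<in>Basis. (A *v u - A *v l) \<bullet> b) = (\<Prod>b\<in>Basis. (u - l) \<bullet> b)"
        by (rule prod.reindex_bij_witness[of _ "(*v) A" "(*v) A"])
           (auto simp: Abas inv inner_diff_left io)
      moreover have "(A *v l) \<bullet> b \<le> (A *v u) \<bullet> b" if "b \<in> Basis" for b
        using le[OF Abas[OF that]] by (simp add: io)
      ultimately show "emeasure (distr lborel borel ((*v) A)) (box l u) = (\<Prod>b\<in>Basis. (u - l) \<bullet> b)"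
        by (simp add: emeasure_distr)
    qed simp
    have "(\<integral>\<^sup>+x. F x \<partial>lborel) = (\<integral>\<^sup>+x. F (A *v x) \<partial>lborel)" if [measurable]: "F \<in> borel_measurable borel" for F
      using arg_cong[OF eq, of "\<lambda>M. integral\<^sup>N M F"] by (simp add: nn_integral_distr)
    then have *: "(\<integral>\<^sup>+x. F (A *v x) \<partial>lborel) = (\<integral>\<^sup>+x. F x \<partial>lborel)" if "F \<in> borel_measurable borel" for F
      by (rule sym) (rule that)
    show ?case unfolding A_def[symmetric] d
    proof (intro ballI impI)
      fix F :: "real^'n \<Rightarrow> ennreal" assume "F \<in> borel_measurable borel"
      from *[OF this] show "ennreal 1 * (\<integral>\<^sup>+x. F (A *v x) \<partial>lborel) = (\<integral>\<^sup>+x. F x \<partial>lborel)"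
        by (simp only: ennreal_1 mult_1)
    qed
  next
    case (idplus m n c)
    define A :: "real^'n^'n" where "A = (\<chi> i j. if i = m \<and> j = n then c else of_bool (i = j))"
    have Ax: "A *v x = x + (c * x $ n) *\<^sub>R axis m 1" for x
    proof (subst vec_eq_iff, intro allI)
      fix i
      have "(A *v x) $ i = (\<Sum>j\<in>UNIV. (if j = i then x $ j else 0) + (if j = n then (if i = m then c * x $ n else 0) else 0))"
        unfolding matrix_vector_mult_def A_def vec_lambda_beta
        using idplus by (intro sum.cong) auto
      then show "(A *v x) $ i = (x + (c * x $ n) *\<^sub>R axis m 1) $ i"
        unfolding sum.distrib by (simp add: axis_def)
    qed
    have "det A = det (mat 1 :: real^'n^'n)"
    proof -
      have "A = (\<chi> k. if k = m then row m (mat 1) + c *s row n (mat 1) else row k (mat 1))"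
        using idplus by (auto simp: A_def vec_eq_iff row_def mat_def)
      then show ?thesis using det_row_operation[OF idplus, of "mat 1" c] by simp
    qed
    then have d: "det A = 1" by simp
    have *: "(\<integral>\<^sup>+x. F (A *v x) \<partial>lborel) = (\<integral>\<^sup>+x. F x \<partial>lborel)" if "F \<in> borel_measurable borel" for F
      unfolding Ax using that idplus
      by (intro nn_integral_lborel_shear) (auto simp: axis_def Basis_vec_def axis_eq_axis)
    show ?case unfolding A_def[symmetric] d
    proof (intro ballI impI)
      fix F :: "real^'n \<Rightarrow> ennreal" assume "F \<in> borel_measurable borel"
      from *[OF this] show "ennreal \<bar>1\<bar> * (\<integral>\<^sup>+x. F (A *v x) \<partial>lborel) = (\<integral>\<^sup>+x. F x \<partial>lborel)"
        by (simp only: abs_1 ennreal_1 mult_1)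
    qed
  qed
  with assms show ?thesis by blast
qed

lemma nn_integral_gaussian:
  "(\<integral>\<^sup>+(x::real^'n). ennreal (exp (- (x \<bullet> x) / 2)) \<partial>lborel) = ennreal (sqrt ((2 * pi) ^ CARD('n)))"
proof -
  have 1: "(\<integral>\<^sup>+x. ennreal (exp (- x\<^sup>2 / 2)) \<partial>lborel) = ennreal (sqrt (2 * pi))"
  proof -
    have "(\<integral>\<^sup>+x. ennreal (exp (- x\<^sup>2 / 2)) \<partial>lborel) = (\<integral>\<^sup>+x. ennreal (sqrt (2 * pi)) * ennreal (normal_density 0 1 x) \<partial>lborel)"
      by (intro nn_integral_cong) (simp add: normal_density_def ennreal_mult'[symmetric])
    also have "\<dots> = ennreal (sqrt (2 * pi)) * ennreal (\<integral>x. normal_density 0 1 x \<partial>lborel)"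
      by (subst nn_integral_cmult) (simp_all add: nn_integral_eq_integral)
    finally show ?thesis by simp
  qed
  have "(\<integral>\<^sup>+(x::real^'n). ennreal (exp (- (x \<bullet> x) / 2)) \<partial>lborel) =
        (\<integral>\<^sup>+(x::real^'n). (\<Prod>b\<in>Basis. ennreal (exp (- (x \<bullet> b)\<^sup>2 / 2))) \<partial>lborel)"
  proof (intro nn_integral_cong)
    fix x :: "real^'n"
    have "- (x \<bullet> x) / 2 = (\<Sum>b\<in>Basis. - (x \<bullet> b)\<^sup>2 / 2)"
      by (simp add: euclidean_inner[of x x] power2_eq_square sum_negf sum_divide_distrib)
    then show "ennreal (exp (- (x \<bullet> x) / 2)) = (\<Prod>b\<in>Basis. ennreal (exp (- (x \<bullet> b)\<^sup>2 / 2)))"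
      by (simp only: exp_sum[OF finite_Basis] prod_ennreal[OF exp_ge_zero])
  qed
  also have "\<dots> = (\<Prod>b\<in>(Basis::(real^'n) set). ennreal (sqrt (2 * pi)))"
    by (subst nn_integral_lborel_prod) (simp_all add: 1[simplified])
  also have "\<dots> = ennreal (sqrt (2 * pi) ^ CARD('n))"
    by (simp add: ennreal_power)
  finally show ?thesis unfolding real_sqrt_power .
qed

text \<open>Comparison with the product of the functions \<open>exp (- c \<bar>z \<bullet> k\<bar>)\<close> over the coordinates \<open>k\<close>.\<close>

lemma integrable_exp_neg_norm:
  fixes b :: real
  assumes b: "b > 0"
  shows "integrable lborel (\<lambda>z::'a::euclidean_space. exp (- b * norm z))"
proof -
  define c where "c = b / DIM('a)"
  have c: "c > 0" using b by (simp add: c_def)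
  have 1: "(\<integral>\<^sup>+x. ennreal (exp (- c * \<bar>x\<bar>)) \<partial>lborel) < \<infinity>"
  proof -
    have "(\<integral>\<^sup>+x. ennreal (exp (- c * \<bar>x\<bar>)) \<partial>lborel) \<le> (\<integral>\<^sup>+x. ennreal (1/c) * ennreal (exponential_density c x) + ennreal (1/c) * ennreal (exponential_density c (0 + (-1) * x)) \<partial>lborel)"
      using c by (intro nn_integral_mono) (auto simp: exponential_density_def ennreal_mult'[symmetric] abs_if)
    also have "\<dots> = ennreal (1/c) * (\<integral>\<^sup>+x. ennreal (exponential_density c x) \<partial>lborel) + ennreal (1/c) * (\<integral>\<^sup>+x. ennreal (exponential_density c (0 + (-1) * x)) \<partial>lborel)"
      by (subst nn_integral_add) (auto simp: nn_integral_cmult)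
    also have "(\<integral>\<^sup>+x. ennreal (exponential_density c (0 + (-1) * x)) \<partial>lborel) = (\<integral>\<^sup>+x. ennreal (exponential_density c x) \<partial>lborel)"
      by (subst nn_integral_real_affine[where c="-1" and t=0 and f="\<lambda>x. ennreal (exponential_density c x)"]) simp_all
    also have "(\<integral>\<^sup>+x. ennreal (exponential_density c x) \<partial>lborel) = 1"
      using prob_space.emeasure_space_1[OF prob_space_exponential_density[OF c]]
      by (simp add: emeasure_density)
    finally have "(\<integral>\<^sup>+x. ennreal (exp (- c * \<bar>x\<bar>)) \<partial>lborel) \<le> ennreal (1/c) + ennreal (1/c)"
      by simp
    then show ?thesis by (rule le_less_trans) simp
  qed
  have "(\<integral>\<^sup>+(z::'a). ennreal (norm (exp (- b * norm z))) \<partial>lborel) \<le>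
       (\<integral>\<^sup>+(z::'a). (\<Prod>k\<in>Basis. ennreal (exp (- c * \<bar>z \<bullet> k\<bar>))) \<partial>lborel)"
  proof (intro nn_integral_mono)
    fix z :: 'a
    have "(\<Sum>k\<in>Basis. \<bar>z \<bullet> k\<bar>) \<le> DIM('a) * norm z"
      using sum_bounded_above[of Basis "\<lambda>k. \<bar>z \<bullet> k\<bar>" "norm z"] Basis_le_norm by auto
    then have "c * (\<Sum>k\<in>Basis. \<bar>z \<bullet> k\<bar>) \<le> b * norm z"
      using b by (simp add: c_def field_simps)
    then have "exp (- b * norm z) \<le> exp (\<Sum>k\<in>Basis. - c * \<bar>z \<bullet> k\<bar>)"
      by (simp add: sum_distrib_left sum_negf)
    then show "ennreal (norm (exp (- b * norm z))) \<le> (\<Prod>k\<in>Basis. ennreal (exp (- c * \<bar>z \<bullet> k\<bar>)))"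
      by (simp only: exp_sum[OF finite_Basis] prod_ennreal[OF exp_ge_zero]) (simp add: ennreal_leI)
  qed
  also have "\<dots> = (\<Prod>k\<in>(Basis::'a set). (\<integral>\<^sup>+x. ennreal (exp (- c * \<bar>x\<bar>)) \<partial>lborel))"
    by (subst nn_integral_lborel_prod) simp_all
  also have "\<dots> < \<infinity>"
    using 1 by (simp add: power_less_top_ennreal)
  finally show ?thesis
    by (simp add: integrable_iff_bounded)
qed

section \<open>Symmetric matrices\<close>

lemma Rayleigh_maximum_is_eigenvalue:
  fixes A :: "real^'n^'n"
  assumes sym: "transpose A = A"
  obtains c v where "v \<noteq> 0" "A *v v = c *\<^sub>R v" "\<And>u. u \<bullet> (A *v u) \<le> c * (u \<bullet> u)"
proof -
  have cont: "continuous_on UNIV ((*v) A)"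
    by (simp add: linear_continuous_on matrix_vector_mul_bounded_linear)
  have self: "x \<bullet> (A *v y) = (A *v x) \<bullet> y" for x y
    by (metis dot_lmul_matrix sym transpose_matrix_vector)
  have "compact (sphere (0::real^'n) 1)" by simp
  moreover have "axis undefined 1 \<in> sphere (0::real^'n) 1" by simp
  then have "sphere (0::real^'n) 1 \<noteq> {}" by (metis empty_iff)
  moreover have "continuous_on (sphere 0 1) (\<lambda>u. u \<bullet> (A *v u))"
    by (intro continuous_intros continuous_on_subset[OF cont]) auto
  ultimately have "\<exists>v\<in>sphere 0 1. \<forall>u\<in>sphere 0 1. u \<bullet> (A *v u) \<le> v \<bullet> (A *v v)"
    by (rule continuous_attains_sup)
  then obtain v where v: "v \<in> sphere 0 1" and max: "\<And>u. u \<in> sphere 0 1 \<Longrightarrow> u \<bullet> (A *v u) \<le> v \<bullet> (A *v v)"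
    by auto
  define c where "c = v \<bullet> (A *v v)"
  have vv: "v \<bullet> v = 1" using v by (simp add: norm_eq_1)
  have le: "u \<bullet> (A *v u) \<le> c * (u \<bullet> u)" for u
  proof (cases "u = 0")
    case False
    have "(u /\<^sub>R norm u) \<bullet> (A *v (u /\<^sub>R norm u)) \<le> c"
      using max[of "u /\<^sub>R norm u"] False by (simp add: c_def)
    then have "(u \<bullet> (A *v u)) / (norm u * norm u) \<le> c"
      by (simp add: matrix_vector_mult_scaleR field_simps)
    then show ?thesis using False
      by (simp add: pos_divide_le_eq dot_square_norm power2_eq_square)
  qed auto
  \<comment> \<open>the form \<open>c (u \<bullet> u) - u \<bullet> A u\<close> is nonnegative and vanishes at \<open>v\<close>; its variation at \<open>v\<close> in the direction of the residual \<open>r\<close> forces \<open>r = 0\<close>\<close>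
  have "A *v v - c *\<^sub>R v = 0"
  proof -
    define r where "r = A *v v - c *\<^sub>R v"
    have *: "2 * (r \<bullet> r) * t \<le> t\<^sup>2 * (c * (r \<bullet> r) - r \<bullet> (A *v r))" for t
    proof -
      have e1: "(v + t *\<^sub>R r) \<bullet> (A *v (v + t *\<^sub>R r)) = c + 2 * t * (r \<bullet> (A *v v)) + t\<^sup>2 * (r \<bullet> (A *v r))"
        using self[of v r] inner_commute[of r "A *v v"]
        by (simp add: matrix_vector_right_distrib matrix_vector_mult_scaleR inner_add_left inner_add_right c_def power2_eq_square algebra_simps)
      have e2: "(v + t *\<^sub>R r) \<bullet> (v + t *\<^sub>R r) = 1 + 2 * t * (r \<bullet> v) + t\<^sup>2 * (r \<bullet> r)"
        using inner_commute[of r v] by (simp add: inner_add_left inner_add_right vv power2_eq_square algebra_simps)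
      have e3: "r \<bullet> r = r \<bullet> (A *v v) - c * (r \<bullet> v)"
      proof -
        have "r \<bullet> r = r \<bullet> (A *v v - c *\<^sub>R v)" by (simp only: r_def)
        then show ?thesis by (simp add: inner_diff_right)
      qed
      have "2 * t * (r \<bullet> (A *v v)) - c * (2 * t * (r \<bullet> v)) = 2 * (r \<bullet> r) * t"
        unfolding e3 by (simp add: algebra_simps)
      moreover have "c + 2 * t * (r \<bullet> (A *v v)) + t\<^sup>2 * (r \<bullet> (A *v r)) \<le> c * (1 + 2 * t * (r \<bullet> v) + t\<^sup>2 * (r \<bullet> r))"
        using le[of "v + t *\<^sub>R r"] unfolding e1 e2 .
      ultimately show ?thesis
        by (simp add: algebra_simps)
    qed
    define q where "q = c * (r \<bullet> r) - r \<bullet> (A *v r)"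
    have q: "q \<ge> 0" using le[of r] by (simp add: q_def)
    have "r \<bullet> r \<le> 0"
    proof (rule ccontr)
      assume "\<not> r \<bullet> r \<le> 0"
      then have p: "r \<bullet> r > 0" by linarith
      define t where "t = (r \<bullet> r) / (q + 1)"
      have t: "t > 0" using p q by (simp add: t_def)
      have "2 * (r \<bullet> r) * t \<le> t * (t * q)" using *[of t] by (simp add: q_def power2_eq_square algebra_simps)
      then have "2 * (r \<bullet> r) \<le> t * q" using t by (simp add: mult.commute)
      also have "t * q \<le> r \<bullet> r" using p q by (simp add: t_def field_simps)
      finally show False using p by simp
    qed
    then have "r = 0" by (metis inner_eq_zero_iff inner_ge_zero order_antisym)
    then show ?thesis by (simp only: r_def)
  qed
  moreover have "v \<noteq> 0" using vv by auto
  ultimately show thesis using that[of v c] le by simp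
qed

lemma finite_eigenvalues:
  fixes A :: "real^'n^'n"
  assumes sym: "transpose A = A"
  shows "finite {c. \<exists>v. v \<noteq> 0 \<and> A *v v = c *\<^sub>R v}"
proof -
  define E where "E = {c. \<exists>v. v \<noteq> 0 \<and> A *v v = c *\<^sub>R v}"
  obtain w where w: "\<And>c. c \<in> E \<Longrightarrow> w c \<noteq> 0 \<and> A *v w c = c *\<^sub>R w c"
    using bchoice[of E "\<lambda>c v. v \<noteq> 0 \<and> A *v v = c *\<^sub>R v"] unfolding E_def by blast
  have self: "x \<bullet> (A *v y) = (A *v x) \<bullet> y" for x y
    by (metis dot_lmul_matrix sym transpose_matrix_vector)
  have orth: "w c \<bullet> w d = 0" if "c \<in> E" "d \<in> E" "c \<noteq> d" for c d
  proof -
    have "d * (w c \<bullet> w d) = c * (w c \<bullet> w d)"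
      using self[of "w c" "w d"] w[OF that(1)] w[OF that(2)] by simp
    then show ?thesis using that(3) by simp
  qed
  have inj: "inj_on w E"
  proof (rule inj_onI, rule ccontr)
    fix c d assume cd: "c \<in> E" "d \<in> E" "w c = w d" "c \<noteq> d"
    have "w c \<bullet> w c = 0" using orth[OF cd(1,2,4)] cd(3) by simp
    then show False using w[OF cd(1)] by simp
  qed
  have "independent (w ` E)"
  proof (rule pairwise_orthogonal_independent)
    show "pairwise orthogonal (w ` E)"
      unfolding pairwise_def orthogonal_def
    proof (intro ballI impI)
      fix x y assume "x \<in> w ` E" "y \<in> w ` E" "x \<noteq> y"
      then obtain c d where "x = w c" "c \<in> E" "y = w d" "d \<in> E" "c \<noteq> d" by (elim imageE) metis
      then show "x \<bullet> y = 0" using orth by simp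
    qed
    show "0 \<notin> w ` E"
    proof
      assume "0 \<in> w ` E"
      then obtain c where "c \<in> E" "0 = w c" by (elim imageE)
      then show False using w[of c] by simp
    qed
  qed
  then have "finite (w ` E)" by (rule finiteI_independent)
  then have "finite E" using inj by (rule finite_imageD)
  then show ?thesis by (simp only: E_def)
qed

lemma min_abs_eigenvalue_bounds:
  fixes A :: "real^'n^'n"
  assumes sym: "transpose A = A"
  shows "min_abs_eigenvalue A \<ge> 0"
    and "v \<noteq> 0 \<Longrightarrow> A *v v = c *\<^sub>R v \<Longrightarrow> min_abs_eigenvalue A \<le> \<bar>c\<bar>"
proof -
  have eq: "{\<bar>c\<bar> | c. \<exists>v. v \<noteq> 0 \<and> A *v v = c *\<^sub>R v} = abs ` {c. \<exists>v. v \<noteq> 0 \<and> A *v v = c *\<^sub>R v}"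
    by auto
  have fin: "finite {\<bar>c\<bar> | c. \<exists>v. v \<noteq> 0 \<and> A *v v = c *\<^sub>R v}"
    unfolding eq using finite_eigenvalues[OF sym] by simp
  obtain d w where "w \<noteq> 0" "A *v w = d *\<^sub>R w"
    using Rayleigh_maximum_is_eigenvalue[OF sym] by blast
  then have ne: "{\<bar>c\<bar> | c. \<exists>v. v \<noteq> 0 \<and> A *v v = c *\<^sub>R v} \<noteq> {}" by auto
  show "min_abs_eigenvalue A \<ge> 0"
    unfolding min_abs_eigenvalue_def using Min_in[OF fin ne] by auto
  show "v \<noteq> 0 \<Longrightarrow> A *v v = c *\<^sub>R v \<Longrightarrow> min_abs_eigenvalue A \<le> \<bar>c\<bar>"
    unfolding min_abs_eigenvalue_def by (rule Min_le[OF fin]) auto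
qed

text \<open>If the spectrum avoids \<open>(-c, c)\<close> and the form stays below \<open>c\<close>, then the largest eigenvalue, and with
  it the whole form, is at most \<open>-c\<close>.\<close>

lemma negative_definite_quantitative:
  fixes A :: "real^'n^'n"
  assumes sym: "transpose A = A" and c: "c > 0" "c \<le> min_abs_eigenvalue A"
    and neg: "\<And>u. u \<bullet> (A *v u) < c * (u \<bullet> u) \<or> u = 0"
  shows "u \<bullet> (A *v u) \<le> - c * (u \<bullet> u)"
proof -
  obtain d v where d: "v \<noteq> 0" "A *v v = d *\<^sub>R v" "\<And>u. u \<bullet> (A *v u) \<le> d * (u \<bullet> u)"
    using Rayleigh_maximum_is_eigenvalue[OF sym] by blast
  have "d * (v \<bullet> v) < c * (v \<bullet> v)" using neg[of v] d by auto
  then have "d < c" using d(1) by (simp add: mult_less_cancel_right)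
  moreover have "c \<le> \<bar>d\<bar>" using min_abs_eigenvalue_bounds(2)[OF sym d(1,2)] c by simp
  ultimately have "d \<le> - c" by linarith
  then have "d * (u \<bullet> u) \<le> - c * (u \<bullet> u)" by (intro mult_right_mono) auto
  then show ?thesis using d(3)[of u] by linarith
qed

text \<open>Gram--Schmidt with respect to the inner product \<open>(u, v) \<mapsto> u \<bullet> P v\<close>.\<close>

lemma orthonormal_for_positive_definite:
  fixes P :: "real^'n^'n" and F :: "'n set"
  assumes sym: "transpose P = P" and pos: "\<And>u. u \<noteq> 0 \<Longrightarrow> u \<bullet> (P *v u) > 0"
  shows "\<exists>v. \<forall>i\<in>F. \<forall>j\<in>F. v i \<bullet> (P *v v j) = (if i = j then 1 else 0)"
proof -
  have self: "x \<bullet> (P *v y) = y \<bullet> (P *v x)" for x y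
    by (metis dot_lmul_matrix inner_commute sym transpose_matrix_vector)
  have "finite F" by simp
  then show ?thesis
  proof induction
    case (insert k F)
    then obtain v where v: "\<And>i j. i \<in> F \<Longrightarrow> j \<in> F \<Longrightarrow> v i \<bullet> (P *v v j) = (if i = j then 1 else 0)"
      by blast
    have "card (v ` F) < CARD('n)"
      using insert(2) card_image_le[of F v] psubset_card_mono[of UNIV F]
      by (metis UNIV_I finite finite_subset le_less_trans psubsetI subset_UNIV)
    then have "dim (v ` F) < DIM(real^'n)"
      using dim_le_card'[of "v ` F"] insert(1) by simp
    then have "span (v ` F) \<noteq> UNIV"
      by (metis dim_UNIV dim_span less_irrefl)
    then obtain u where u: "u \<notin> span (v ` F)" by blast
    define r where "r = u - (\<Sum>i\<in>F. (u \<bullet> (P *v v i)) *\<^sub>R v i)"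
    have "(\<Sum>i\<in>F. (u \<bullet> (P *v v i)) *\<^sub>R v i) \<in> span (v ` F)"
      by (intro span_sum span_scale span_base) auto
    then have r0: "r \<noteq> 0" using u by (auto simp: r_def)
    have rj: "r \<bullet> (P *v v j) = 0" if "j \<in> F" for j
    proof -
      have "(\<Sum>i\<in>F. (u \<bullet> (P *v v i)) * (v i \<bullet> (P *v v j))) = (\<Sum>i\<in>F. if i = j then u \<bullet> (P *v v j) else 0)"
        using v that by (intro sum.cong) auto
      then show ?thesis using that insert(1) by (simp add: r_def inner_diff_left inner_sum_left)
    qed
    define w where "w = r /\<^sub>R sqrt (r \<bullet> (P *v r))"
    have ww: "w \<bullet> (P *v w) = 1"
      using pos[OF r0] by (simp add: w_def matrix_vector_mult_scaleR divide_simps)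
    have wj: "w \<bullet> (P *v v j) = 0" "v j \<bullet> (P *v w) = 0" if "j \<in> F" for j
      using rj[OF that] self[of "v j" r] by (simp_all add: w_def matrix_vector_mult_scaleR)
    have "\<forall>i\<in>insert k F. \<forall>j\<in>insert k F. (v(k := w)) i \<bullet> (P *v (v(k := w)) j) = (if i = j then 1 else 0)"
      using v ww wj insert(2) by auto
    then show ?case by blast
  qed simp
qed

lemma congruent_to_identity:
  fixes P :: "real^'n^'n"
  assumes sym: "transpose P = P" and pos: "\<And>u. u \<noteq> 0 \<Longrightarrow> u \<bullet> (P *v u) > 0"
  obtains B :: "real^'n^'n" where "invertible B" "transpose B ** P ** B = mat 1"
proof -
  obtain v :: "'n \<Rightarrow> real^'n" where v: "\<And>i j. v i \<bullet> (P *v v j) = (if i = j then 1 else 0)"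
    using orthonormal_for_positive_definite[OF sym pos, of UNIV] by auto
  define B :: "real^'n^'n" where "B = (\<chi> i j. v j $ i)"
  have "(transpose B ** (P ** B)) $ i $ j = v i \<bullet> (P *v v j)" for i j
    by (simp add: matrix_matrix_mult_def B_def transpose_def inner_vec_def matrix_vector_mult_def)
  then have 1: "transpose B ** P ** B = mat 1"
    by (simp add: vec_eq_iff v mat_def matrix_mul_assoc)
  then have "invertible B"
    by (metis invertible_left_inverse)
  then show thesis using 1 by (rule that)
qed

section \<open>Taylor bounds and symmetry of the second derivative\<close>

text \<open>The value of a bilinear form given in curried form, such as a second derivative.\<close>

abbreviation bilin ::
  "('a::real_normed_vector \<Rightarrow>\<^sub>L 'b::real_normed_vector \<Rightarrow>\<^sub>L real) \<Rightarrow> 'a \<Rightarrow> 'b \<Rightarrow> real" where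
  "bilin L u v \<equiv> blinfun_apply (blinfun_apply L u) v"

lemma second_order_upper_bound_real:
  fixes \<phi> \<phi>' \<phi>'' :: "real \<Rightarrow> real"
  assumes d1: "\<And>t. t \<in> {0..1} \<Longrightarrow> (\<phi> has_derivative (\<lambda>s. s * \<phi>' t)) (at t within {0..1})"
    and d2: "\<And>t. t \<in> {0..1} \<Longrightarrow> (\<phi>' has_derivative (\<lambda>s. s * \<phi>'' t)) (at t within {0..1})"
    and M: "\<And>t. t \<in> {0..1} \<Longrightarrow> \<phi>'' t \<le> M"
  shows "\<phi> 1 \<le> \<phi> 0 + \<phi>' 0 + M / 2"
proof -
  have 1: "\<phi>' t \<le> \<phi>' 0 + M * t" if t: "t \<in> {0..1}" for t
  proof (cases "t = 0")
    case False
    have "\<exists>s\<in>{0<..<t}. \<phi>' t - \<phi>' 0 = (t - 0) * \<phi>'' s"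
      using t False by (intro mvt_simple has_derivative_subset[OF d2]) auto
    then obtain s where s: "s \<in> {0<..<t}" "\<phi>' t - \<phi>' 0 = t * \<phi>'' s" by auto
    have "t * \<phi>'' s \<le> t * M" using M[of s] s t by (intro mult_left_mono) auto
    with s(2) have "\<phi>' t - \<phi>' 0 \<le> M * t" by (metis mult.commute)
    then show ?thesis by simp
  qed simp
  define \<psi> where "\<psi> t = \<phi> t - (M / 2) * t\<^sup>2" for t
  have "\<exists>s\<in>{0<..<1}. \<psi> 1 - \<psi> 0 = (1 - 0) * (\<phi>' s - M * s)"
    unfolding \<psi>_def
    by (rule mvt_simple) (auto intro!: derivative_eq_intros d1 simp: algebra_simps)
  then obtain s where "s \<in> {0<..<1}" "\<psi> 1 - \<psi> 0 = \<phi>' s - M * s" by auto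
  with 1[of s] show ?thesis by (simp add: \<psi>_def)
qed

lemma second_order_upper_bound:
  fixes F :: "'a::real_normed_vector \<Rightarrow> real"
  assumes U: "convex U"
    and d1: "\<And>z. z \<in> U \<Longrightarrow> (F has_derivative blinfun_apply (DF z)) (at z within U)"
    and d2: "\<And>z. z \<in> U \<Longrightarrow> (DF has_derivative blinfun_apply (D2F z)) (at z within U)"
    and xy: "x \<in> U" "y \<in> U"
    and M: "\<And>t. t \<in> {0..1} \<Longrightarrow> bilin (D2F (x + t *\<^sub>R (y - x))) (y - x) (y - x) \<le> M"
  shows "F y \<le> F x + blinfun_apply (DF x) (y - x) + M / 2"
proof -
  define h where "h = y - x"
  have inU: "x + t *\<^sub>R h \<in> U" if "t \<in> {0..1}" for t
    using convexD_alt[OF U xy, of t] that by (simp add: h_def algebra_simps)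
  have line: "((\<lambda>t. x + t *\<^sub>R h) has_derivative (\<lambda>s. s *\<^sub>R h)) (at t within {0..1})" for t
    by (auto intro!: derivative_eq_intros)
  have im: "(\<lambda>t. x + t *\<^sub>R h) ` {0..1} \<subseteq> U" using inU by auto
  have "F (x + 1 *\<^sub>R h) \<le> F (x + 0 *\<^sub>R h) + blinfun_apply (DF (x + 0 *\<^sub>R h)) h + M / 2"
  proof (rule second_order_upper_bound_real)
    fix t :: real assume t: "t \<in> {0..1}"
    show "((\<lambda>t. F (x + t *\<^sub>R h)) has_derivative (\<lambda>s. s * blinfun_apply (DF (x + t *\<^sub>R h)) h)) (at t within {0..1})"
      using has_derivative_in_compose[OF line has_derivative_subset[OF d1[OF inU[OF t]] im]]
      by (simp add: blinfun.scaleR_right)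
    have "((\<lambda>t. DF (x + t *\<^sub>R h)) has_derivative (\<lambda>s. s *\<^sub>R blinfun_apply (D2F (x + t *\<^sub>R h)) h)) (at t within {0..1})"
      using has_derivative_in_compose[OF line has_derivative_subset[OF d2[OF inU[OF t]] im]]
      by (simp add: blinfun.scaleR_right)
    from bounded_linear.has_derivative[OF blinfun.bounded_linear_left this, of h]
    show "((\<lambda>t. blinfun_apply (DF (x + t *\<^sub>R h)) h) has_derivative
       (\<lambda>s. s * bilin (D2F (x + t *\<^sub>R h)) h h)) (at t within {0..1})"
      by (simp add: blinfun.scaleR_left)
    show "bilin (D2F (x + t *\<^sub>R h)) h h \<le> M" using M[OF t] by (simp add: h_def)
  qed
  then show ?thesis by (simp add: h_def)
qed

lemma blinfun2_apply_le:
  fixes L :: "'a::real_normed_vector \<Rightarrow>\<^sub>L 'b::real_normed_vector \<Rightarrow>\<^sub>L real"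
  shows "\<bar>bilin L u v\<bar> \<le> norm L * norm u * norm v"
proof -
  have "\<bar>bilin L u v\<bar> \<le> norm (blinfun_apply L u) * norm v"
    using norm_blinfun[of "blinfun_apply L u" v] by simp
  also have "\<dots> \<le> norm L * norm u * norm v"
    by (intro mult_right_mono norm_blinfun) auto
  finally show ?thesis .
qed

lemma Lipschitz_of_derivative_bound:
  assumes U: "convex U"
    and d: "\<And>z. z \<in> U \<Longrightarrow> (G has_derivative blinfun_apply (DG z)) (at z within U)"
    and K: "\<And>z. z \<in> U \<Longrightarrow> norm (DG z) \<le> K" and xy: "x \<in> U" "y \<in> U"
  shows "norm (G y - G x) \<le> K * norm (y - x)"
  by (rule differentiable_bound[OF U d _ xy(2,1)]) (use K in \<open>auto simp: norm_blinfun.rep_eq\<close>)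

lemma Taylor_second_order:
  fixes F :: "'a::real_normed_vector \<Rightarrow> real"
  assumes U: "convex U"
    and d1: "\<And>z. z \<in> U \<Longrightarrow> (F has_derivative blinfun_apply (DF z)) (at z within U)"
    and d2: "\<And>z. z \<in> U \<Longrightarrow> (DF has_derivative blinfun_apply (D2F z)) (at z within U)"
    and d3: "\<And>z. z \<in> U \<Longrightarrow> (D2F has_derivative blinfun_apply (D3F z)) (at z within U)"
    and K: "\<And>z. z \<in> U \<Longrightarrow> norm (D3F z) \<le> K"
    and xy: "x \<in> U" "y \<in> U"
  shows "\<bar>F y - F x - blinfun_apply (DF x) (y - x)
           - bilin (D2F x) (y - x) (y - x) / 2\<bar> \<le> K * norm (y - x) ^ 3"
proof -
  define h where "h = y - x"
  have K0: "K \<ge> 0" using K[OF xy(1)] norm_ge_zero order_trans by blast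
  have inU: "x + t *\<^sub>R h \<in> U" if "t \<in> {0..1}" for t
    using convexD_alt[OF U xy, of t] that by (simp add: h_def algebra_simps)
  define q where "q t = bilin (D2F (x + t *\<^sub>R h)) h h" for t
  have q: "\<bar>q t - q 0\<bar> \<le> K * norm h ^ 3" if t: "t \<in> {0..1}" for t
  proof -
    have "norm (D2F (x + t *\<^sub>R h) - D2F x) \<le> K * norm (x + t *\<^sub>R h - x)"
      by (rule Lipschitz_of_derivative_bound[OF U d3 K xy(1) inU[OF t]])
    also have "\<dots> \<le> K * norm h" using K0 t by (intro mult_left_mono) (auto simp: mult_left_le_one_le)
    finally have *: "norm (D2F (x + t *\<^sub>R h) - D2F x) \<le> K * norm h" .
    have "\<bar>q t - q 0\<bar> = \<bar>bilin (D2F (x + t *\<^sub>R h) - D2F x) h h\<bar>"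
      by (simp add: q_def blinfun.diff_left)
    also have "\<dots> \<le> norm (D2F (x + t *\<^sub>R h) - D2F x) * norm h * norm h"
      by (rule blinfun2_apply_le)
    also have "\<dots> \<le> K * norm h * norm h * norm h"
      using * by (intro mult_right_mono) auto
    finally show ?thesis by (simp add: power3_eq_cube mult.assoc)
  qed
  have "F y \<le> F x + blinfun_apply (DF x) (y - x) + (q 0 + K * norm h ^ 3) / 2"
    using q by (intro second_order_upper_bound[OF U d1 d2 xy]) (fastforce simp: q_def h_def[symmetric] abs_le_iff)+
  moreover have "- F y \<le> - F x + blinfun_apply (- DF x) (y - x) + (- q 0 + K * norm h ^ 3) / 2"
  proof (rule second_order_upper_bound[OF U _ _ xy, of "\<lambda>z. - F z" "\<lambda>z. - DF z" "\<lambda>z. - D2F z"])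
    show "((\<lambda>z. - F z) has_derivative blinfun_apply (- DF z)) (at z within U)" if "z \<in> U" for z
      using has_derivative_minus[OF d1[OF that]] by (simp add: uminus_blinfun.rep_eq)
    show "((\<lambda>z. - DF z) has_derivative blinfun_apply (- D2F z)) (at z within U)" if "z \<in> U" for z
      using has_derivative_minus[OF d2[OF that]] by (simp add: uminus_blinfun.rep_eq)
    show "bilin (- D2F (x + t *\<^sub>R (y - x))) (y - x) (y - x) \<le> - q 0 + K * norm h ^ 3"
      if "t \<in> {0..1}" for t
      using q[OF that] by (simp add: q_def h_def[symmetric] blinfun.minus_left)
  qed
  ultimately have "\<bar>F y - F x - blinfun_apply (DF x) h - q 0 / 2\<bar> \<le> K * norm h ^ 3 / 2"
    unfolding abs_le_iff by (simp add: h_def blinfun.minus_left field_simps)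
  moreover have "K * norm h ^ 3 \<ge> 0" using K0 by simp
  ultimately show ?thesis by (simp add: q_def h_def)
qed

lemma Taylor_first_order:
  assumes U: "convex U"
    and d2: "\<And>z. z \<in> U \<Longrightarrow> (DF has_derivative blinfun_apply (D2F z)) (at z within U)"
    and d3: "\<And>z. z \<in> U \<Longrightarrow> (D2F has_derivative blinfun_apply (D3F z)) (at z within U)"
    and K: "\<And>z. z \<in> U \<Longrightarrow> norm (D3F z) \<le> K"
    and xy: "x \<in> U" "y \<in> U"
  shows "norm (DF y - DF x - blinfun_apply (D2F x) (y - x)) \<le> K * norm (y - x) ^ 2"
proof -
  have K0: "K \<ge> 0" using K[OF xy(1)] norm_ge_zero order_trans by blast
  let ?V = "U \<inter> cball x (norm (y - x))"
  have "norm (DF y - DF x - blinfun_apply (D2F x) (y - x)) \<le> norm (y - x) * (K * norm (y - x))"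
  proof (rule differentiable_bound_linearization[where S = ?V and f = DF and f' = "\<lambda>z. blinfun_apply (D2F z)"])
    fix t :: real assume t: "t \<in> {0..1}"
    have "x + t *\<^sub>R (y - x) \<in> U"
      using convexD_alt[OF U xy, of t] t by (simp add: algebra_simps)
    moreover have "norm (t *\<^sub>R (y - x)) \<le> norm (y - x)"
      using t by (simp add: mult_left_le_one_le)
    ultimately show "x + t *\<^sub>R (y - x) \<in> ?V" by (simp add: dist_norm)
  next
    fix z assume "z \<in> ?V"
    then show "(DF has_derivative blinfun_apply (D2F z)) (at z within ?V)"
      by (intro has_derivative_subset[OF d2]) auto
    have "norm (D2F z - D2F x) \<le> K * norm (z - x)"
      using \<open>z \<in> ?V\<close> by (intro Lipschitz_of_derivative_bound[OF U d3 K xy(1)]) auto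
    also have "\<dots> \<le> K * norm (y - x)"
      using \<open>z \<in> ?V\<close> K0 by (intro mult_left_mono) (auto simp: dist_norm norm_minus_commute)
    finally show "onorm (blinfun_apply (D2F z) - blinfun_apply (D2F x)) \<le> K * norm (y - x)"
      by (simp add: norm_blinfun.rep_eq minus_blinfun.rep_eq fun_diff_def)
  qed (use xy in auto)
  then show ?thesis by (simp add: power2_eq_square algebra_simps)
qed

text \<open>Expanding \<open>F (x + t u + t v)\<close> at \<open>x + t u\<close> and at \<open>x\<close> gives \<open>t\<^sup>2 D\<^sup>2F(u, v)\<close> and
  \<open>t\<^sup>2 (D\<^sup>2F(u, v) + D\<^sup>2F(v, u)) / 2\<close> for the mixed term, up to \<open>O(t\<^sup>3)\<close>.\<close>

lemma second_derivative_symmetric: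
  fixes F :: "'a::real_normed_vector \<Rightarrow> real"
  assumes U: "convex U" and x: "x \<in> interior U"
    and d1: "\<And>z. z \<in> U \<Longrightarrow> (F has_derivative blinfun_apply (DF z)) (at z within U)"
    and d2: "\<And>z. z \<in> U \<Longrightarrow> (DF has_derivative blinfun_apply (D2F z)) (at z within U)"
    and d3: "\<And>z. z \<in> U \<Longrightarrow> (D2F has_derivative blinfun_apply (D3F z)) (at z within U)"
    and K: "\<And>z. z \<in> U \<Longrightarrow> norm (D3F z) \<le> K"
  shows "bilin (D2F x) u v = bilin (D2F x) v u"
proof -
  define B where "B = (\<lambda>u v. bilin (D2F x) u v)"
  have xU: "x \<in> U" using x interior_subset by blast
  have Badd: "B (u + v) (u + v) = B u u + B u v + B v u + B v v"
    by (simp add: B_def blinfun.add_left blinfun.add_right)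
  obtain r where r: "r > 0" "ball x r \<subseteq> U" using x by (auto simp: mem_interior)
  define m where "m = norm u + norm v"
  define C where "C = K * norm v ^ 3 + K * norm u ^ 3 + K * norm (u + v) ^ 3 + K * norm u ^ 2 * norm v + K * norm u * norm v ^ 2"
  have small: "\<bar>B u v - B v u\<bar> \<le> 2 * C * t" if t: "t > 0" "t * (m + 1) < r" for t
  proof -
    have m: "m \<ge> 0" by (simp add: m_def)
    have "t * norm w < r" if "norm w \<le> m" for w :: 'a
    proof -
      have "t * norm w \<le> t * m" using that t by (intro mult_left_mono) auto
      also have "\<dots> < r" using t by (simp add: algebra_simps)
      finally show ?thesis .
    qed
    then have inU: "x + t *\<^sub>R w \<in> U" if "norm w \<le> m" for w
      using that r(2) t by (force simp: dist_norm)
    have yU: "x + t *\<^sub>R u \<in> U" "x + t *\<^sub>R (u + v) \<in> U"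
      by (intro inU; simp add: m_def norm_triangle_ineq)+
    have zU: "x + t *\<^sub>R u + t *\<^sub>R v \<in> U" using yU by (simp add: scaleR_add_right add.assoc)
    have n3: "K * norm (t *\<^sub>R w) ^ 3 = t ^ 3 * (K * norm w ^ 3)" for w :: 'a
      using t by (simp add: power_mult_distrib)
    have T: "\<bar>F y - F z - blinfun_apply (DF z) (y - z) - bilin (D2F z) (y - z) (y - z) / 2\<bar>
        \<le> K * norm (y - z) ^ 3" if "z \<in> U" "y \<in> U" for y z
      by (rule Taylor_second_order[OF U d1 d2 d3 K that])
    have q: "bilin (D2F z) (t *\<^sub>R w) (t *\<^sub>R w) = t\<^sup>2 * bilin (D2F z) w w" for z w
      by (simp add: blinfun.scaleR_left blinfun.scaleR_right power2_eq_square)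
    have R1: "\<bar>F (x + t *\<^sub>R u + t *\<^sub>R v) - F (x + t *\<^sub>R u) - t * blinfun_apply (DF (x + t *\<^sub>R u)) v
            - t\<^sup>2 * bilin (D2F (x + t *\<^sub>R u)) v v / 2\<bar> \<le> t ^ 3 * (K * norm v ^ 3)"
      using T[OF yU(1) zU] by (simp only: add_diff_cancel_left' n3 q) (simp add: blinfun.scaleR_right)
    have R2: "\<bar>F (x + t *\<^sub>R u) - F x - t * blinfun_apply (DF x) u - t\<^sup>2 * B u u / 2\<bar> \<le> t ^ 3 * (K * norm u ^ 3)"
      using T[OF xU yU(1)] by (simp only: add_diff_cancel_left' n3 q B_def) (simp add: blinfun.scaleR_right)
    have R3: "\<bar>F (x + t *\<^sub>R u + t *\<^sub>R v) - F x - t * blinfun_apply (DF x) (u + v) - t\<^sup>2 * B (u + v) (u + v) / 2\<bar>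
          \<le> t ^ 3 * (K * norm (u + v) ^ 3)"
      using T[OF xU yU(2)] by (simp only: add_diff_cancel_left' n3 q B_def)
        (simp add: blinfun.scaleR_right blinfun.add_right scaleR_add_right add.assoc distrib_left)
    have R4: "\<bar>t * blinfun_apply (DF (x + t *\<^sub>R u)) v - t * blinfun_apply (DF x) v - t\<^sup>2 * B u v\<bar> \<le> t ^ 3 * (K * norm u ^ 2 * norm v)"
    proof -
      have "\<bar>blinfun_apply (DF (x + t *\<^sub>R u) - DF x - blinfun_apply (D2F x) (t *\<^sub>R u)) v\<bar>
          \<le> norm (DF (x + t *\<^sub>R u) - DF x - blinfun_apply (D2F x) (t *\<^sub>R u)) * norm v"
        using norm_blinfun by (metis real_norm_def)
      also have "\<dots> \<le> (K * norm (t *\<^sub>R u) ^ 2) * norm v"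
        using Taylor_first_order[OF U d2 d3 K xU yU(1)] by (intro mult_right_mono) auto
      finally have "t * \<bar>blinfun_apply (DF (x + t *\<^sub>R u) - DF x - blinfun_apply (D2F x) (t *\<^sub>R u)) v\<bar>
         \<le> t * ((K * norm (t *\<^sub>R u) ^ 2) * norm v)"
        using t by (intro mult_left_mono) auto
      moreover have "t * \<bar>blinfun_apply (DF (x + t *\<^sub>R u) - DF x - blinfun_apply (D2F x) (t *\<^sub>R u)) v\<bar> =
         \<bar>t * blinfun_apply (DF (x + t *\<^sub>R u)) v - t * blinfun_apply (DF x) v - t\<^sup>2 * B u v\<bar>"
      proof -
        have "t * blinfun_apply (DF (x + t *\<^sub>R u) - DF x - blinfun_apply (D2F x) (t *\<^sub>R u)) v =
           t * blinfun_apply (DF (x + t *\<^sub>R u)) v - t * blinfun_apply (DF x) v - t\<^sup>2 * B u v"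
          by (simp add: B_def blinfun.diff_left blinfun.scaleR_left blinfun.scaleR_right power2_eq_square right_diff_distrib mult.assoc)
        then show ?thesis using t by (metis abs_mult abs_of_pos)
      qed
      moreover have "t * ((K * norm (t *\<^sub>R u) ^ 2) * norm v) = t ^ 3 * (K * norm u ^ 2 * norm v)"
        using t by (simp add: power_mult_distrib power2_eq_square power3_eq_cube)
      ultimately show ?thesis by metis
    qed
    have R5: "\<bar>t\<^sup>2 * bilin (D2F (x + t *\<^sub>R u)) v v - t\<^sup>2 * B v v\<bar> \<le> t ^ 3 * (K * norm u * norm v ^ 2)"
    proof -
      have "\<bar>bilin (D2F (x + t *\<^sub>R u) - D2F x) v v\<bar> \<le> norm (D2F (x + t *\<^sub>R u) - D2F x) * norm v * norm v"
        by (rule blinfun2_apply_le)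
      also have "\<dots> \<le> (K * norm (x + t *\<^sub>R u - x)) * norm v * norm v"
        by (intro mult_right_mono Lipschitz_of_derivative_bound[OF U d3 K xU yU(1)]) auto
      finally have "t\<^sup>2 * \<bar>bilin (D2F (x + t *\<^sub>R u) - D2F x) v v\<bar> \<le> t\<^sup>2 * ((K * norm (x + t *\<^sub>R u - x)) * norm v * norm v)"
        by (intro mult_left_mono) auto
      moreover have "t\<^sup>2 * \<bar>bilin (D2F (x + t *\<^sub>R u) - D2F x) v v\<bar> =
          \<bar>t\<^sup>2 * bilin (D2F (x + t *\<^sub>R u)) v v - t\<^sup>2 * B v v\<bar>"
        by (simp add: B_def blinfun.diff_left abs_mult right_diff_distrib[symmetric])
      moreover have "t\<^sup>2 * ((K * norm (x + t *\<^sub>R u - x)) * norm v * norm v) = t ^ 3 * (K * norm u * norm v ^ 2)"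
        using t by (simp add: power2_eq_square power3_eq_cube)
      ultimately show ?thesis by metis
    qed
    have "t\<^sup>2 * \<bar>B u v - B v u\<bar> = \<bar>t\<^sup>2 * B u v - t\<^sup>2 * B v u\<bar>"
      by (simp add: abs_mult right_diff_distrib[symmetric])
    also have "\<dots> \<le> 2 * (t ^ 3 * C)"
      using R1 R2 R3 R4 R5 unfolding Badd blinfun.add_right C_def distrib_left add_divide_distrib by linarith
    finally have "t\<^sup>2 * \<bar>B u v - B v u\<bar> \<le> t\<^sup>2 * (2 * C * t)"
      by (simp add: power2_eq_square power3_eq_cube algebra_simps)
    then show ?thesis using t by simp
  qed
  have "\<bar>B u v - B v u\<bar> \<le> 0"
  proof (rule tendsto_lowerbound)
    show "((\<lambda>t. 2 * C * t) \<longlongrightarrow> 0) (at_right 0)"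
      by (auto intro!: tendsto_eq_intros)
    have "\<forall>\<^sub>F t in at_right (0::real). t < r / (m + 1)"
      using r by (intro order_tendstoD(2)[OF tendsto_ident_at]) (simp add: m_def divide_pos_pos add_nonneg_pos)
    then show "\<forall>\<^sub>F t in at_right 0. \<bar>B u v - B v u\<bar> \<le> 2 * C * t"
      using eventually_at_right_less[of 0]
    proof eventually_elim
      case (elim t)
      have "m + 1 > 0" by (simp add: m_def add_nonneg_pos)
      then show ?case using elim by (intro small) (simp_all add: field_simps)
    qed
  qed simp
  then show ?thesis by (simp add: B_def)
qed

section \<open>Signs of the derivatives of the phase function near the maximum\<close>

lemma pair_eq_sum_axis: "((0::real), v::real^'n) = (\<Sum>i\<in>UNIV. v $ i *\<^sub>R (0, axis i 1))"
proof -
  have "linear (\<lambda>u. ((0::real), u::real^'n))" by (auto simp: linear_iff)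
  then have "(0, \<Sum>i\<in>UNIV. v $ i *\<^sub>R axis i 1) = (\<Sum>i\<in>UNIV. v $ i *\<^sub>R ((0::real), axis i (1::real)))"
    by (simp only: linear_sum[of "\<lambda>u. (0, u)"] linear_scale[of "\<lambda>u. (0, u)"])
  then show ?thesis using basis_expansion[of v] by (simp add: scalar_mult_eq_scaleR)
qed

lemma hessian_y_form:
  fixes v u :: "real^'a" and L :: "'a point \<Rightarrow>\<^sub>L 'a point \<Rightarrow>\<^sub>L real"
  shows "v \<bullet> (hessian_y L *v u) = bilin L (0, v) (0, u)"
proof -
  have 1: "blinfun_apply M (0, u) = (\<Sum>j\<in>UNIV. u $ j * blinfun_apply M (0, axis j 1))"
    for M :: "'a point \<Rightarrow>\<^sub>L real"
    by (subst pair_eq_sum_axis) (simp add: blinfun.sum_right blinfun.scaleR_right del: scaleR_Pair)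
  have 2: "blinfun_apply L (0, v) = (\<Sum>i\<in>UNIV. v $ i *\<^sub>R blinfun_apply L (0, axis i 1))"
    by (subst pair_eq_sum_axis) (simp add: blinfun.sum_right blinfun.scaleR_right del: scaleR_Pair)
  have "(hessian_y L *v u) $ i = bilin L (0, axis i 1) (0, u)" for i
    by (simp only: 1) (simp add: hessian_y_def matrix_vector_mult_def mult.commute)
  then show ?thesis
    unfolding 2 by (simp add: blinfun.sum_left blinfun.scaleR_left inner_vec_def)
qed

lemma transpose_hessian_y:
  assumes "\<And>u v. bilin L u v = bilin L v u"
  shows "transpose (hessian_y L) = hessian_y L"
  by (simp add: vec_eq_iff transpose_def hessian_y_def assms[of "(0, axis _ 1)" "(0, axis _ 1)"])

text \<open>Necessary conditions of first and second order, read off from a Taylor expansion.\<close>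

lemma small_cubic_inequality:
  fixes A B C r :: real
  assumes r: "r > 0" and le: "\<And>t. 0 < t \<Longrightarrow> t < r \<Longrightarrow> A * t + B * t\<^sup>2 \<le> C * t ^ 3"
  shows "A \<le> 0" and "A = 0 \<Longrightarrow> B \<le> 0"
proof -
  have ev: "\<forall>\<^sub>F t in at_right (0::real). 0 < t \<and> t < r"
    using r by (auto simp: eventually_at_right_field)
  show "A \<le> 0"
  proof (rule tendsto_lowerbound)
    show "((\<lambda>t. C * t\<^sup>2 - B * t) \<longlongrightarrow> 0) (at_right 0)" by (auto intro!: tendsto_eq_intros)
    show "\<forall>\<^sub>F t in at_right 0. A \<le> C * t\<^sup>2 - B * t"
      using ev
    proof eventually_elim
      case (elim t)
      then have "t * A \<le> t * (C * t\<^sup>2 - B * t)" using le[of t]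
        by (simp add: power2_eq_square power3_eq_cube algebra_simps)
      then show ?case using elim by simp
    qed
  qed simp
  assume A: "A = 0"
  show "B \<le> 0"
  proof (rule tendsto_lowerbound)
    show "((\<lambda>t. C * t) \<longlongrightarrow> 0) (at_right 0)" by (auto intro!: tendsto_eq_intros)
    show "\<forall>\<^sub>F t in at_right 0. B \<le> C * t"
      using ev
    proof eventually_elim
      case (elim t)
      then have "t\<^sup>2 * B \<le> t\<^sup>2 * (C * t)" using le[of t] A
        by (simp add: power2_eq_square power3_eq_cube algebra_simps)
      then show ?case using elim by simp
    qed
  qed simp
qed

lemma second_derivative_symmetric_cball:
  fixes F :: "'a::real_normed_vector \<Rightarrow> real"
  assumes r: "r > 0" and x: "x \<in> cball 0 r"
    and d1: "\<And>z. z \<in> cball 0 r \<Longrightarrow> (F has_derivative blinfun_apply (DF z)) (at z within cball 0 r)"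
    and d2: "\<And>z. z \<in> cball 0 r \<Longrightarrow> (DF has_derivative blinfun_apply (D2F z)) (at z within cball 0 r)"
    and d3: "\<And>z. z \<in> cball 0 r \<Longrightarrow> (D2F has_derivative blinfun_apply (D3F z)) (at z within cball 0 r)"
    and K: "\<And>z. z \<in> cball 0 r \<Longrightarrow> norm (D3F z) \<le> K"
  shows "bilin (D2F x) u v = bilin (D2F x) v u"
proof -
  have cont: "continuous_on (cball 0 r) D2F"
    using d3 by (meson continuous_on_eq_continuous_within has_derivative_continuous)
  have le: "bilin (D2F x) u v - bilin (D2F x) v u \<le> 0" for u v
  proof (rule continuous_le_on_closure[where S = "ball 0 r" and f = "\<lambda>z. bilin (D2F z) u v - bilin (D2F z) v u"])
    show "continuous_on (closure (ball 0 r)) (\<lambda>z. bilin (D2F z) u v - bilin (D2F z) v u)"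
      using r cont by (simp add: closure_ball) (intro continuous_intros)
    show "x \<in> closure (ball 0 r)" using r x by simp
    show "bilin (D2F z) u v - bilin (D2F z) v u \<le> 0" if "z \<in> ball 0 r" for z
    proof -
      have "z \<in> interior (cball 0 r)" using that ball_subset_cball interior_maximal open_ball by blast
      from second_derivative_symmetric[OF convex_cball this d1 d2 d3 K, of u v] show ?thesis by simp
    qed
  qed
  from le[of u v] le[of v u] show ?thesis by simp
qed

text \<open>The analytic part of the setting, with \<open>x\<^sup>* = 0\<close>. The single constant \<open>K\<close> bounds the
  derivatives up to third order, \<open>c\<close> is a common lower bound for \<open>\<bar>\<partial>f/\<partial>x\<^sub>1\<bar>\<close> and for the absolute
  eigenvalues of \<open>D\<^sub>y\<^sup>2f\<close>, and \<open>\<Delta>\<close> is a real number below the infimum of the gaps.\<close>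

locale boundary_maximum =
  fixes \<Omega> :: "('n::finite point) set"
    and \<epsilon> :: real
    and f :: "'n point \<Rightarrow> nat \<Rightarrow> real"
    and Df :: "'n point \<Rightarrow> nat \<Rightarrow> 'n point \<Rightarrow>\<^sub>L real"
    and D2f :: "'n point \<Rightarrow> nat \<Rightarrow> 'n point \<Rightarrow>\<^sub>L 'n point \<Rightarrow>\<^sub>L real"
    and D3f :: "'n point \<Rightarrow> nat \<Rightarrow>
          'n point \<Rightarrow>\<^sub>L 'n point \<Rightarrow>\<^sub>L 'n point \<Rightarrow>\<^sub>L real"
    and N0 :: nat
    and xmax :: "nat \<Rightarrow> 'n point"
    and K c \<Delta> :: real
    and f0 \<sigma> :: "'n point \<Rightarrow> real"
    and Df0 D\<sigma> :: "'n point \<Rightarrow> 'n point \<Rightarrow>\<^sub>L real"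
    and D2f0 D2\<sigma> :: "'n point \<Rightarrow>\<^sub>L 'n point \<Rightarrow>\<^sub>L real"
    and eps :: "nat \<Rightarrow> real"
  assumes open_\<Omega>: "open \<Omega>" and bounded_\<Omega>: "bounded \<Omega>" and \<epsilon>_pos: "\<epsilon> > 0" and ball_subset: "cball 0 \<epsilon> \<subseteq> \<Omega>"
    and Df: "\<And>N x. N > 0 \<Longrightarrow> x \<in> cball 0 \<epsilon> \<Longrightarrow>
      ((\<lambda>z. f z N) has_derivative blinfun_apply (Df x N)) (at x within cball 0 \<epsilon>)"
    and D2f: "\<And>N x. N > 0 \<Longrightarrow> x \<in> cball 0 \<epsilon> \<Longrightarrow>
      ((\<lambda>z. Df z N) has_derivative blinfun_apply (D2f x N)) (at x within cball 0 \<epsilon>)"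
    and D3f: "\<And>N x. N > 0 \<Longrightarrow> x \<in> cball 0 \<epsilon> \<Longrightarrow>
      ((\<lambda>z. D2f z N) has_derivative blinfun_apply (D3f x N)) (at x within cball 0 \<epsilon>)"
    and K2: "\<And>N x. N > 0 \<Longrightarrow> x \<in> cball 0 \<epsilon> \<Longrightarrow> norm (D2f x N) \<le> K"
    and K3: "\<And>N x. N > 0 \<Longrightarrow> x \<in> cball 0 \<epsilon> \<Longrightarrow> norm (D3f x N) \<le> K"
    and K1: "\<And>N x. N > 0 \<Longrightarrow> x \<in> cball 0 \<epsilon> \<Longrightarrow> norm (Df x N) \<le> K"
    and N0_pos: "N0 > 0"
    and xmax: "\<And>N. N \<ge> N0 \<Longrightarrow> xmax N \<in> cball 0 \<epsilon> \<and> fst (xmax N) = 0"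
    and max: "\<And>N x. N \<ge> N0 \<Longrightarrow> x \<in> \<Omega> \<Longrightarrow> fst x \<ge> 0 \<Longrightarrow> f x N \<le> f (xmax N) N"
    and \<Delta>_pos: "\<Delta> > 0"
    and gap: "\<And>N x. N \<ge> N0 \<Longrightarrow> x \<in> \<Omega> - cball 0 \<epsilon> \<Longrightarrow> \<Delta> \<le> f (xmax N) N - f x N"
    and xmax_tendsto: "xmax \<longlonglongrightarrow> 0"
    and c_pos: "c > 0"
    and c1: "\<And>N x. N \<ge> N0 \<Longrightarrow> x \<in> cball 0 \<epsilon> \<Longrightarrow> c \<le> \<bar>d1 (Df x N)\<bar>"
    and c2: "\<And>N x. N \<ge> N0 \<Longrightarrow> x \<in> cball 0 \<epsilon> \<Longrightarrow> c \<le> min_abs_eigenvalue (hessian_y (D2f x N))"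
    and f_eq: "\<And>N x. N > 0 \<Longrightarrow> x \<in> \<Omega> \<Longrightarrow> f x N = f0 x + eps N * \<sigma> x"
    and f0: "has_two_derivatives_at f0 Df0 D2f0 0"
    and \<sigma>: "has_two_derivatives_at \<sigma> D\<sigma> D2\<sigma> 0"
    and eps_pos: "\<And>N. N > 0 \<Longrightarrow> eps N > 0"
    and eps_small: "(\<lambda>N. eps N * sqrt (real N)) \<longlonglongrightarrow> 0"
begin

text \<open>The derivatives \<open>\<partial>f(x\<^sup>*)/\<partial>x\<^sub>1\<close> and \<open>D\<^sub>y\<^sup>2f(x\<^sup>*)\<close> of the limit function.\<close>

abbreviation "slope \<equiv> d1 (Df0 0)"

abbreviation "Hess \<equiv> hessian_y D2f0"

lemma zero_in_ball: "0 \<in> cball (0::'n point) \<epsilon>" using \<epsilon>_pos by simp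

lemma K_nonneg: "K \<ge> 0" using K1[OF N0_pos zero_in_ball] norm_ge_zero order_trans by blast

lemma N0_imp_pos: "N \<ge> N0 \<Longrightarrow> N > 0" using N0_pos by simp

lemma D2f_symmetric:
  assumes "N > 0" "x \<in> cball 0 \<epsilon>"
  shows "bilin (D2f x N) u v = bilin (D2f x N) v u"
  by (rule second_derivative_symmetric_cball[OF \<epsilon>_pos assms(2) Df[OF assms(1)] D2f[OF assms(1)] D3f[OF assms(1)] K3[OF assms(1)]])

lemma f_Taylor:
  assumes "N > 0" "x \<in> cball 0 \<epsilon>" "y \<in> cball 0 \<epsilon>"
  shows "\<bar>f y N - f x N - blinfun_apply (Df x N) (y - x)
           - bilin (D2f x N) (y - x) (y - x) / 2\<bar> \<le> K * norm (y - x) ^ 3"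
  by (rule Taylor_second_order[OF convex_cball Df[OF assms(1)] D2f[OF assms(1)] D3f[OF assms(1)] K3[OF assms(1)] assms(2,3)])

lemma D2f_Lipschitz:
  assumes "N > 0" "x \<in> cball 0 \<epsilon>" "y \<in> cball 0 \<epsilon>"
  shows "norm (D2f y N - D2f x N) \<le> K * norm (y - x)"
  by (rule Lipschitz_of_derivative_bound[OF convex_cball D3f[OF assms(1)] K3[OF assms(1)] assms(2,3)])

lemma Df_Lipschitz:
  assumes "N > 0" "x \<in> cball 0 \<epsilon>" "y \<in> cball 0 \<epsilon>"
  shows "norm (Df y N - Df x N) \<le> K * norm (y - x)"
  by (rule Lipschitz_of_derivative_bound[OF convex_cball D2f[OF assms(1)] K2[OF assms(1)] assms(2,3)])

lemma f_Lipschitz: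
  assumes "N > 0" "x \<in> cball 0 \<epsilon>" "y \<in> cball 0 \<epsilon>"
  shows "norm (f y N - f x N) \<le> K * norm (y - x)"
  by (rule Lipschitz_of_derivative_bound[OF convex_cball Df[OF assms(1)] K1[OF assms(1)] assms(2,3)])

lemma eps_tendsto_0: "eps \<longlonglongrightarrow> 0"
proof (rule Lim_null_comparison[OF _ eps_small])
  show "\<forall>\<^sub>F N in sequentially. norm (eps N) \<le> eps N * sqrt (real N)"
    using eventually_gt_at_top[of 0]
  proof eventually_elim
    case (elim N)
    then show ?case using eps_pos[of N] by simp
  qed
qed

lemma derivatives_at_0:
  assumes N: "N > 0"
  shows "Df 0 N = Df0 0 + eps N *\<^sub>R D\<sigma> 0" and "D2f 0 N = D2f0 + eps N *\<^sub>R D2\<sigma>"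
proof -
  have ev: "\<forall>\<^sub>F x in nhds 0. Df x N = Df0 x + eps N *\<^sub>R D\<sigma> x"
  proof -
    have "\<forall>\<^sub>F x in nhds 0. x \<in> ball (0::'n point) \<epsilon>"
      using \<epsilon>_pos by (intro eventually_nhds_in_open) auto
    moreover have "\<forall>\<^sub>F x in nhds 0. (f0 has_derivative blinfun_apply (Df0 x)) (at x)"
      using f0 by (simp add: has_two_derivatives_at_def)
    moreover have "\<forall>\<^sub>F x in nhds 0. (\<sigma> has_derivative blinfun_apply (D\<sigma> x)) (at x)"
      using \<sigma> by (simp add: has_two_derivatives_at_def)
    ultimately show ?thesis
    proof eventually_elim
      case (elim x)
      have 1: "((\<lambda>z. f z N) has_derivative blinfun_apply (Df x N)) (at x)"
      proof -
        have "x \<in> interior (cball 0 \<epsilon>)" using elim(1) by simp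
        moreover have "x \<in> cball 0 \<epsilon>" using elim(1) by simp
        ultimately show ?thesis using Df[OF N, of x] by (metis at_within_interior)
      qed
      have "((\<lambda>z. f0 z + eps N * \<sigma> z) has_derivative (\<lambda>h. blinfun_apply (Df0 x) h + eps N * blinfun_apply (D\<sigma> x) h)) (at x)"
        by (intro has_derivative_add has_derivative_mult_right elim)
      then have 2: "((\<lambda>z. f z N) has_derivative (\<lambda>h. blinfun_apply (Df0 x) h + eps N * blinfun_apply (D\<sigma> x) h)) (at x)"
        by (rule has_derivative_transform_within_open[OF _ open_ball elim(1)])
           (rule f_eq[OF N, symmetric], use ball_subset ball_subset_cball in blast)
      have "blinfun_apply (Df x N) = (\<lambda>h. blinfun_apply (Df0 x) h + eps N * blinfun_apply (D\<sigma> x) h)"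
        by (rule has_derivative_unique[OF 1 2])
      then show ?case by (intro blinfun_eqI) (simp add: blinfun.add_left blinfun.scaleR_left)
    qed
  qed
  then show "Df 0 N = Df0 0 + eps N *\<^sub>R D\<sigma> 0" by (rule eventually_nhds_x_imp_x)
  obtain U where U: "open U" "0 \<in> U" "\<And>x. x \<in> U \<Longrightarrow> Df x N = Df0 x + eps N *\<^sub>R D\<sigma> x"
    using ev by (auto simp: eventually_nhds)
  have 1: "((\<lambda>z. Df z N) has_derivative blinfun_apply (D2f 0 N)) (at 0)"
  proof -
    have "0 \<in> interior (cball (0::'n point) \<epsilon>)" using \<epsilon>_pos by simp
    then show ?thesis using D2f[OF N zero_in_ball] by (metis at_within_interior)
  qed
  have "((\<lambda>z. Df0 z + eps N *\<^sub>R D\<sigma> z) has_derivative (\<lambda>h. blinfun_apply D2f0 h + eps N *\<^sub>R blinfun_apply D2\<sigma> h)) (at 0)"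
    using f0 \<sigma> by (intro has_derivative_add has_derivative_scaleR_right) (auto simp: has_two_derivatives_at_def)
  then have 2: "((\<lambda>z. Df z N) has_derivative (\<lambda>h. blinfun_apply D2f0 h + eps N *\<^sub>R blinfun_apply D2\<sigma> h)) (at 0)"
    by (rule has_derivative_transform_within_open[OF _ U(1,2)]) (simp add: U(3))
  have "blinfun_apply (D2f 0 N) = (\<lambda>h. blinfun_apply D2f0 h + eps N *\<^sub>R blinfun_apply D2\<sigma> h)"
    by (rule has_derivative_unique[OF 1 2])
  then show "D2f 0 N = D2f0 + eps N *\<^sub>R D2\<sigma>"
    by (intro blinfun_eqI) (simp add: blinfun.add_left blinfun.scaleR_left)
qed

text \<open>The directions \<open>w\<close> include those tangent to the boundary, where both \<open>w\<close> and \<open>-w\<close> qualify.\<close>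

lemma necessary_conditions_at_max:
  assumes N: "N \<ge> N0" and int: "norm (xmax N) < \<epsilon>" and w: "fst w \<ge> 0"
  shows "blinfun_apply (Df (xmax N) N) w \<le> 0"
    and "blinfun_apply (Df (xmax N) N) w = 0 \<Longrightarrow> bilin (D2f (xmax N) N) w w \<le> 0"
proof -
  let ?x = "xmax N"
  define r where "r = (\<epsilon> - norm ?x) / (norm w + 1)"
  have r: "r > 0" using int by (simp add: r_def divide_pos_pos add_nonneg_pos)
  have le: "blinfun_apply (Df ?x N) w * t + (bilin (D2f ?x N) w w / 2) * t\<^sup>2 \<le> (K * norm w ^ 3) * t ^ 3"
    if t: "0 < t" "t < r" for t
  proof -
    have "t * norm w \<le> t * (norm w + 1)" using t by simp
    also have "\<dots> < \<epsilon> - norm ?x" using t by (simp add: r_def pos_less_divide_eq add_nonneg_pos)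
    finally have "norm (?x + t *\<^sub>R w) < \<epsilon>" using norm_triangle_ineq[of ?x "t *\<^sub>R w"] t by simp
    then have yin: "?x + t *\<^sub>R w \<in> cball 0 \<epsilon>" by simp
    moreover have "fst (?x + t *\<^sub>R w) \<ge> 0" using xmax[OF N] w t by simp
    ultimately have "f (?x + t *\<^sub>R w) N \<le> f ?x N" using max[OF N] ball_subset by blast
    with f_Taylor[OF N0_imp_pos[OF N] _ yin, of ?x] xmax[OF N] t
    show ?thesis
      by (simp add: blinfun.scaleR_left blinfun.scaleR_right power_mult_distrib power2_eq_square algebra_simps abs_le_iff)
  qed
  show "blinfun_apply (Df ?x N) w \<le> 0" by (rule small_cubic_inequality(1)[OF r le])
  show "blinfun_apply (Df ?x N) w = 0 \<Longrightarrow> bilin (D2f ?x N) w w \<le> 0"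
    using small_cubic_inequality(2)[OF r le] by simp
qed

lemma first_order_condition:
  assumes N: "N \<ge> N0" and int: "norm (xmax N) < \<epsilon>"
  shows "blinfun_apply (Df (xmax N) N) (0, v) = 0"
proof -
  have "(0, - v) = - (0::real, v)" by simp
  then show ?thesis
    using necessary_conditions_at_max(1)[OF assms, of "(0, v)"] necessary_conditions_at_max(1)[OF assms, of "(0, - v)"]
    by (simp only: blinfun.minus_right) simp
qed

text \<open>The derivative does not vanish on the connected ball, so it keeps the sign it has at the maximum.\<close>

lemma d1_negative:
  assumes N: "N \<ge> N0" and int: "norm (xmax N) < \<epsilon>" and x: "x \<in> cball 0 \<epsilon>"
  shows "d1 (Df x N) \<le> - c"
proof (rule ccontr)
  assume "\<not> d1 (Df x N) \<le> - c"
  then have pos: "d1 (Df x N) \<ge> c" using c1[OF N x] by linarith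
  have neg: "d1 (Df (xmax N) N) \<le> 0" using necessary_conditions_at_max(1)[OF N int, of "(1, 0)"] by (simp add: d1_def)
  have "continuous_on (cball 0 \<epsilon>) (\<lambda>z. Df z N)"
    using D2f[OF N0_imp_pos[OF N]] by (meson continuous_on_eq_continuous_within has_derivative_continuous)
  then have "continuous_on (cball 0 \<epsilon>) (\<lambda>z. d1 (Df z N))"
    unfolding d1_def by (intro continuous_intros)
  then have "connected ((\<lambda>z. d1 (Df z N)) ` cball 0 \<epsilon>)"
    by (rule connected_continuous_image) (simp add: convex_connected)
  then have "0 \<in> (\<lambda>z. d1 (Df z N)) ` cball 0 \<epsilon>"
    by (rule connectedD_interval[of _ "d1 (Df (xmax N) N)" "d1 (Df x N)"]) (use pos neg c_pos x xmax[OF N] in auto)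
  then show False using c1[OF N] c_pos by fastforce
qed

text \<open>Negative definiteness spreads from the maximum along a segment, cut into steps so short that
  \<open>D\<^sub>y\<^sup>2f\<close> changes by less than \<open>c\<close>: the spectrum cannot cross the gap \<open>(-c, c)\<close> in one step.\<close>

lemma D2f_negative:
  assumes N: "N \<ge> N0" and int: "norm (xmax N) < \<epsilon>" and x: "x \<in> cball 0 \<epsilon>"
  shows "bilin (D2f x N) (0, v) (0, v) \<le> - c * (v \<bullet> v)"
proof -
  define Q where "Q z \<longleftrightarrow> (\<forall>v. bilin (D2f z N) (0, v) (0, v) \<le> - c * (v \<bullet> v))" for z
  have strict: "Q z" if z: "z \<in> cball 0 \<epsilon>" and lt: "\<And>u. u \<noteq> 0 \<Longrightarrow> bilin (D2f z N) (0, u) (0, u) < c * (u \<bullet> u)" for z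
  proof -
    have "transpose (hessian_y (D2f z N)) = hessian_y (D2f z N)"
      by (rule transpose_hessian_y) (rule D2f_symmetric[OF N0_imp_pos[OF N] z])
    from negative_definite_quantitative[OF this c_pos c2[OF N z]] lt
    show ?thesis unfolding Q_def hessian_y_form by blast
  qed
  have start: "Q (xmax N)"
  proof (rule strict)
    fix u :: "real^'n" assume "u \<noteq> 0"
    then have "c * (u \<bullet> u) > 0" using c_pos by simp
    moreover have "bilin (D2f (xmax N) N) (0, u) (0, u) \<le> 0"
      by (rule necessary_conditions_at_max(2)[OF N int]) (simp_all add: first_order_condition[OF N int])
    ultimately show "bilin (D2f (xmax N) N) (0, u) (0, u) < c * (u \<bullet> u)" by linarith
  qed (use xmax[OF N] in simp)
  have step: "Q z'" if z: "z \<in> cball 0 \<epsilon>" "z' \<in> cball 0 \<epsilon>" "Q z" and near: "K * norm (z' - z) < c" for z z'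
  proof (rule strict[OF z(2)])
    fix u :: "real^'n" assume u: "u \<noteq> 0"
    have "\<bar>bilin (D2f z' N - D2f z N) (0, u) (0, u)\<bar> \<le> norm (D2f z' N - D2f z N) * norm (0::real, u) * norm (0::real, u)"
      by (rule blinfun2_apply_le)
    also have "\<dots> \<le> (K * norm (z' - z)) * norm (0::real, u) * norm (0::real, u)"
      by (intro mult_right_mono D2f_Lipschitz N0_imp_pos N z) auto
    also have "\<dots> = (K * norm (z' - z)) * (u \<bullet> u)" by (simp add: norm_Pair dot_square_norm power2_eq_square)
    also have "\<dots> < c * (u \<bullet> u)" using near u by (intro mult_strict_right_mono) auto
    finally have "bilin (D2f z' N) (0, u) (0, u) < bilin (D2f z N) (0, u) (0, u) + c * (u \<bullet> u)"
      by (simp add: blinfun.diff_left)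
    also have "\<dots> \<le> c * (u \<bullet> u)"
    proof -
      have "bilin (D2f z N) (0, u) (0, u) \<le> - c * (u \<bullet> u)" using z(3) by (simp add: Q_def)
      also have "\<dots> \<le> 0" using c_pos by simp
      finally show ?thesis by simp
    qed
    finally show "bilin (D2f z' N) (0, u) (0, u) < c * (u \<bullet> u)" .
  qed
  obtain n :: nat where n: "K * norm (x - xmax N) / c < real n" using reals_Archimedean2 by blast
  have "K * norm (x - xmax N) / c \<ge> 0" using K_nonneg c_pos by simp
  with n have n0: "n > 0" by (metis le_less_trans of_nat_0_less_iff)
  define p where "p i = xmax N + (real i / real n) *\<^sub>R (x - xmax N)" for i
  have pin: "p i \<in> cball 0 \<epsilon>" if "i \<le> n" for i
    using convexD_alt[OF convex_cball _ x, of "xmax N" "real i / real n"] xmax[OF N] that n0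
    by (simp add: p_def algebra_simps)
  have "i \<le> n \<Longrightarrow> Q (p i)" for i
  proof (induction i)
    case 0
    then show ?case using start by (simp add: p_def)
  next
    case (Suc i)
    have "p (Suc i) - p i = (1 / real n) *\<^sub>R (x - xmax N)"
      by (simp add: p_def add_divide_distrib scaleR_left.add)
    then have "K * norm (p (Suc i) - p i) = K * norm (x - xmax N) / real n" by simp
    also have "\<dots> < c" using n n0 c_pos by (simp add: field_simps)
    finally have near: "K * norm (p (Suc i) - p i) < c" .
    have i: "i \<le> n" using Suc.prems by simp
    show ?case by (rule step[OF pin[OF i] pin[OF Suc.prems] Suc.IH[OF i] near])
  qed
  from this[of n] show ?thesis using n0 by (simp add: p_def Q_def)
qed

text \<open>A threshold beyond which the maximiser lies in the open ball, its value differs from that at \<open>0\<close> by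
  at most half the gap, and \<open>eps(N) \<surd>N\<close> is at most \<open>1\<close>.\<close>

definition N1 :: nat where "N1 = (SOME N1. N1 \<ge> N0 \<and> (\<forall>N\<ge>N1. norm (xmax N) < \<epsilon> \<and> K * norm (xmax N) \<le> \<Delta> / 2 \<and> eps N * sqrt (real N) \<le> 1))"

lemma N1: "N1 \<ge> N0" "N \<ge> N1 \<Longrightarrow> norm (xmax N) < \<epsilon>" "N \<ge> N1 \<Longrightarrow> K * norm (xmax N) \<le> \<Delta> / 2"
  "N \<ge> N1 \<Longrightarrow> eps N * sqrt (real N) \<le> 1"
proof -
  have n: "(\<lambda>N. norm (xmax N)) \<longlonglongrightarrow> 0" using xmax_tendsto by (simp add: tendsto_norm_zero)
  then have "(\<lambda>N. K * norm (xmax N)) \<longlonglongrightarrow> K * 0" by (intro tendsto_mult_left)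
  then have "\<forall>\<^sub>F N in sequentially. K * norm (xmax N) < \<Delta> / 2" using \<Delta>_pos by (intro order_tendstoD(2)) auto
  moreover have "\<forall>\<^sub>F N in sequentially. norm (xmax N) < \<epsilon>" using order_tendstoD(2)[OF n \<epsilon>_pos] .
  moreover have "\<forall>\<^sub>F N in sequentially. eps N * sqrt (real N) < 1" using order_tendstoD(2)[OF eps_small] by simp
  ultimately have "\<forall>\<^sub>F N in sequentially. norm (xmax N) < \<epsilon> \<and> K * norm (xmax N) \<le> \<Delta> / 2 \<and> eps N * sqrt (real N) \<le> 1"
    by eventually_elim auto
  then obtain M where M: "\<And>N. N \<ge> M \<Longrightarrow> norm (xmax N) < \<epsilon> \<and> K * norm (xmax N) \<le> \<Delta> / 2 \<and> eps N * sqrt (real N) \<le> 1"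
    by (auto simp: eventually_sequentially)
  have "\<exists>N1. N1 \<ge> N0 \<and> (\<forall>N\<ge>N1. norm (xmax N) < \<epsilon> \<and> K * norm (xmax N) \<le> \<Delta> / 2 \<and> eps N * sqrt (real N) \<le> 1)"
    by (rule exI[of _ "max M N0"]) (use M in auto)
  from someI_ex[OF this] show "N1 \<ge> N0" "N \<ge> N1 \<Longrightarrow> norm (xmax N) < \<epsilon>" "N \<ge> N1 \<Longrightarrow> K * norm (xmax N) \<le> \<Delta> / 2"
    "N \<ge> N1 \<Longrightarrow> eps N * sqrt (real N) \<le> 1"
    unfolding N1_def by blast+
qed

lemma Df_0_tendsto: "(\<lambda>N. blinfun_apply (Df 0 N) v) \<longlonglongrightarrow> blinfun_apply (Df0 0) v"
proof (rule Lim_transform_eventually)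
  show "(\<lambda>N. blinfun_apply (Df0 0) v + eps N * blinfun_apply (D\<sigma> 0) v) \<longlonglongrightarrow> blinfun_apply (Df0 0) v"
    by (rule tendsto_eq_intros eps_tendsto_0 refl | simp)+
  show "\<forall>\<^sub>F N in sequentially. blinfun_apply (Df0 0) v + eps N * blinfun_apply (D\<sigma> 0) v = blinfun_apply (Df 0 N) v"
    using eventually_gt_at_top[of 0] by eventually_elim (simp add: derivatives_at_0 blinfun.add_left blinfun.scaleR_left)
qed

lemma D2f_0_tendsto: "(\<lambda>N. bilin (D2f 0 N) u v) \<longlonglongrightarrow> bilin D2f0 u v"
proof (rule Lim_transform_eventually)
  show "(\<lambda>N. bilin D2f0 u v + eps N * bilin D2\<sigma> u v) \<longlonglongrightarrow> bilin D2f0 u v"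
    by (rule tendsto_eq_intros eps_tendsto_0 refl | simp)+
  show "\<forall>\<^sub>F N in sequentially. bilin D2f0 u v + eps N * bilin D2\<sigma> u v = bilin (D2f 0 N) u v"
    using eventually_gt_at_top[of 0] by eventually_elim (simp add: derivatives_at_0 blinfun.add_left blinfun.scaleR_left)
qed

text \<open>\<open>D\<^sub>yf\<close> vanishes at the maximisers, which tend to \<open>0\<close>, and \<open>Df\<close> is Lipschitz uniformly in \<open>N\<close>.\<close>

lemma Df0_y_zero: "blinfun_apply (Df0 0) (0, v) = 0"
proof -
  have "(\<lambda>N. blinfun_apply (Df 0 N) (0, v)) \<longlonglongrightarrow> 0"
  proof (rule Lim_null_comparison)
    have "(\<lambda>N. norm (xmax N)) \<longlonglongrightarrow> 0" using xmax_tendsto by (simp add: tendsto_norm_zero)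
    then show "(\<lambda>N. K * norm (xmax N) * norm (0::real, v)) \<longlonglongrightarrow> 0"
      by (intro tendsto_mult_left_zero tendsto_mult_right_zero)
    show "\<forall>\<^sub>F N in sequentially. norm (blinfun_apply (Df 0 N) (0, v)) \<le> K * norm (xmax N) * norm (0::real, v)"
      using eventually_ge_at_top[of N1]
    proof eventually_elim
      case (elim N)
      then have N: "N \<ge> N0" using N1(1) by simp
      have "norm (blinfun_apply (Df 0 N) (0, v)) = norm (blinfun_apply (Df 0 N - Df (xmax N) N) (0, v))"
        by (simp add: blinfun.diff_left first_order_condition[OF N N1(2)[OF elim]])
      also have "\<dots> \<le> norm (Df 0 N - Df (xmax N) N) * norm (0::real, v)" by (rule norm_blinfun)
      also have "\<dots> \<le> (K * norm (0 - xmax N)) * norm (0::real, v)"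
        using xmax[OF N] by (intro mult_right_mono Df_Lipschitz N0_imp_pos N zero_in_ball) auto
      finally show ?case by simp
    qed
  qed
  with Df_0_tendsto show ?thesis using LIMSEQ_unique by blast
qed

lemma d1_f0_negative: "slope \<le> - c"
  using Df_0_tendsto[of "(1, 0)", folded d1_def]
proof (rule tendsto_upperbound)
  show "\<forall>\<^sub>F N in sequentially. d1 (Df 0 N) \<le> - c"
    using eventually_ge_at_top[of N1]
  proof eventually_elim
    case (elim N)
    show ?case by (rule d1_negative[OF order_trans[OF N1(1) elim] N1(2)[OF elim] zero_in_ball])
  qed
qed simp

lemma hessian_f0_negative: "v \<bullet> (Hess *v v) \<le> - c * (v \<bullet> v)"
  unfolding hessian_y_form using D2f_0_tendsto[of "(0, v)" "(0, v)"]
proof (rule tendsto_upperbound)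
  show "\<forall>\<^sub>F N in sequentially. bilin (D2f 0 N) (0, v) (0, v) \<le> - c * (v \<bullet> v)"
    using eventually_ge_at_top[of N1]
  proof eventually_elim
    case (elim N)
    show ?case by (rule D2f_negative[OF order_trans[OF N1(1) elim] N1(2)[OF elim] zero_in_ball])
  qed
qed simp

lemma hessian_f0_symmetric: "transpose Hess = Hess"
proof (rule transpose_hessian_y)
  fix u v
  have "\<forall>\<^sub>F N in sequentially. bilin (D2f 0 N) u v = bilin (D2f 0 N) v u"
    using eventually_gt_at_top[of 0] by eventually_elim (rule D2f_symmetric[OF _ zero_in_ball])
  then have "(\<lambda>N. bilin (D2f 0 N) v u) \<longlonglongrightarrow> bilin D2f0 u v"
    using D2f_0_tendsto by (rule Lim_transform_eventually[rotated])
  then show "bilin D2f0 u v = bilin D2f0 v u"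
    using D2f_0_tendsto LIMSEQ_unique by blast
qed

text \<open>Monotonicity in \<open>x\<^sub>1\<close> reduces the claim to \<open>x\<^sub>1 = 0\<close>, where concavity in \<open>y\<close> applies; the linear
  term is \<open>D\<^sub>yf(0,N) = eps(N) D\<^sub>y\<sigma>(0)\<close>.\<close>

lemma f_upper_bound:
  assumes N: "N \<ge> N1" and x: "x \<in> cball 0 \<epsilon>" "fst x \<ge> 0"
  shows "f x N - f 0 N \<le> - c * fst x - c / 2 * (norm (snd x))\<^sup>2 + eps N * norm (D\<sigma> 0) * norm (snd x)"
proof -
  have N': "N \<ge> N0" "N > 0" using N N1(1) N0_pos by auto
  define y where "y = (0::real, snd x)"
  define h where "h = (fst x, 0::real^'n)"
  have xy: "x = y + h" by (simp add: y_def h_def prod_eq_iff)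
  have ny: "norm y = norm (snd x)" by (simp add: y_def norm_Pair)
  have yin: "y \<in> cball 0 \<epsilon>" using x(1) ny norm_snd_le[of "snd x" "fst x"] by simp
  have 1: "f x N \<le> f y N - c * fst x"
  proof -
    have inU: "y + t *\<^sub>R h \<in> cball 0 \<epsilon>" if "t \<in> {0..1}" for t
      using convexD_alt[OF convex_cball yin x(1), of t] that by (simp add: xy algebra_simps)
    have im: "(\<lambda>t. y + t *\<^sub>R h) ` {0..1} \<subseteq> cball 0 \<epsilon>" using inU by auto
    have line: "((\<lambda>t. y + t *\<^sub>R h) has_derivative (\<lambda>s. s *\<^sub>R h)) (at t within {0..1})" for t
      by (auto intro!: derivative_eq_intros)
    have "\<exists>t\<in>{0<..<1}. f (y + 1 *\<^sub>R h) N - f (y + 0 *\<^sub>R h) N = blinfun_apply (Df (y + t *\<^sub>R h) N) ((1 - 0) *\<^sub>R h)"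
    proof (rule mvt_simple[where f = "\<lambda>t. f (y + t *\<^sub>R h) N" and f' = "\<lambda>t s. blinfun_apply (Df (y + t *\<^sub>R h) N) (s *\<^sub>R h)"])
      fix t :: real assume "0 \<le> t" "t \<le> 1"
      then have t: "t \<in> {0..1}" by simp
      show "((\<lambda>t. f (y + t *\<^sub>R h) N) has_derivative (\<lambda>s. blinfun_apply (Df (y + t *\<^sub>R h) N) (s *\<^sub>R h))) (at t within {0..1})"
        using has_derivative_in_compose[OF line has_derivative_subset[OF Df[OF N'(2) inU[OF t]] im]] .
    qed simp
    then obtain t where t: "t \<in> {0<..<1}" and eq: "f x N - f y N = blinfun_apply (Df (y + t *\<^sub>R h) N) h" by (auto simp: xy)
    have "h = fst x *\<^sub>R (1, 0)" by (simp add: h_def)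
    then have "f x N - f y N = fst x * d1 (Df (y + t *\<^sub>R h) N)" unfolding eq d1_def by (simp only: blinfun.scaleR_right) simp
    also have "\<dots> \<le> fst x * (- c)"
      by (intro mult_left_mono d1_negative N' N1(2)[OF N] inU x(2)) (use t in auto)
    finally show ?thesis by (simp add: mult.commute)
  qed
  have 2: "f y N \<le> f 0 N + blinfun_apply (Df 0 N) (y - 0) + (- c * (norm (snd x))\<^sup>2) / 2"
  proof (rule second_order_upper_bound[OF convex_cball Df[OF N'(2)] D2f[OF N'(2)] zero_in_ball yin])
    fix t :: real assume t: "t \<in> {0..1}"
    have "0 + t *\<^sub>R (y - 0) \<in> cball 0 \<epsilon>"
      using convexD_alt[OF convex_cball zero_in_ball yin, of t] t by (simp add: algebra_simps)
    from D2f_negative[OF N'(1) N1(2)[OF N] this, of "snd x"]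
    show "bilin (D2f (0 + t *\<^sub>R (y - 0)) N) (y - 0) (y - 0) \<le> - c * (norm (snd x))\<^sup>2"
      by (simp add: y_def dot_square_norm)
  qed
  have 3: "blinfun_apply (Df 0 N) y \<le> eps N * norm (D\<sigma> 0) * norm (snd x)"
  proof -
    have "blinfun_apply (Df 0 N) y = eps N * blinfun_apply (D\<sigma> 0) y"
      by (simp add: derivatives_at_0[OF N'(2)] blinfun.add_left blinfun.scaleR_left Df0_y_zero y_def)
    also have "\<dots> \<le> eps N * (norm (D\<sigma> 0) * norm y)"
      using eps_pos[OF N'(2)] norm_blinfun[of "D\<sigma> 0" y] by (intro mult_left_mono) auto
    finally show ?thesis by (simp add: ny mult.assoc)
  qed
  show ?thesis using 1 2 3 by simp
qed

lemma f_gap: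
  assumes N: "N \<ge> N1" and x: "x \<in> \<Omega> - cball 0 \<epsilon>"
  shows "f x N - f 0 N \<le> - \<Delta> / 2"
proof -
  have N': "N \<ge> N0" "N > 0" using N N1(1) N0_pos by auto
  have "f (xmax N) N - f 0 N \<le> K * norm (xmax N)"
    using f_Lipschitz[OF N'(2) zero_in_ball, of "xmax N"] xmax[OF N'(1)] by simp
  then show ?thesis using N1(3)[OF N] gap[OF N'(1) x] by simp
qed

end

section \<open>Convergence of the rescaled weight\<close>

lemma abs_exp_diff_le:
  fixes A B M :: real
  assumes "A \<le> M" "B \<le> M"
  shows "\<bar>exp A - exp B\<bar> \<le> \<bar>A - B\<bar> * exp M"
proof -
  have *: "exp x - exp y \<le> (x - y) * exp M" if "y \<le> x" "x \<le> M" for x y :: real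
  proof -
    have "1 - exp (y - x) \<le> x - y" using exp_ge_add_one_self[of "y - x"] by linarith
    then have "exp x * (1 - exp (y - x)) \<le> exp x * (x - y)" by (intro mult_left_mono) auto
    also have "\<dots> \<le> exp M * (x - y)" using that by (intro mult_right_mono) auto
    finally show ?thesis by (simp add: right_diff_distrib exp_add[symmetric] mult.commute)
  qed
  show ?thesis
    using *[of A B] *[of B A] assms by (cases "A \<le> B") auto
qed

lemma cube_le_exp:
  fixes b q :: real
  assumes b: "b > 0" and q: "q \<ge> 0"
  shows "(1 + q) ^ 3 \<le> (max 1 (3 / b)) ^ 3 * exp (b * q)"
proof -
  define m where "m = max 1 (3 / b)"
  have m: "m \<ge> 1" "m \<ge> 3 / b" by (auto simp: m_def)
  have "q \<le> m * (b * q / 3)" using m(2) b q mult_right_mono[OF m(2), of "b * q / 3"] by (simp add: field_simps)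
  then have "1 + q \<le> m * (1 + b * q / 3)" using m(1) by (simp add: distrib_left)
  also have "\<dots> \<le> m * exp (b * q / 3)" using m by (intro mult_left_mono exp_ge_add_one_self) auto
  finally have "(1 + q) ^ 3 \<le> (m * exp (b * q / 3)) ^ 3" using q by (intro power_mono) auto
  also have "\<dots> = m ^ 3 * exp (b * q)" by (simp add: power_mult_distrib exp_of_nat_mult[symmetric])
  finally show ?thesis by (simp add: m_def)
qed

lemma abs_diff_chain:
  fixes p u r v t w :: real
  assumes "\<bar>p - u - r / 2\<bar> \<le> e1" "\<bar>u - v\<bar> \<le> e2" "\<bar>r - t\<bar> \<le> e3" "\<bar>t - w\<bar> \<le> e4"
  shows "\<bar>p - (v + w / 2)\<bar> \<le> e1 + e2 + e3 / 2 + e4 / 2"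
  using assms by linarith

context boundary_maximum
begin

text \<open>The inverse of \<open>rescaled 0 N\<close> for \<open>N > 0\<close>.\<close>

definition unrescale :: "nat \<Rightarrow> 'n point \<Rightarrow> 'n point" where
  "unrescale N z = (- fst z / real N, - ((1 / sqrt (real N)) *\<^sub>R snd z))"

text \<open>Up to a constant factor, the density of \<open>Z(N)\<close>: the condition \<open>fst z \<le> 0\<close> says that the first
  coordinate of \<open>unrescale N z\<close> is nonnegative.\<close>

definition weight :: "nat \<Rightarrow> 'n point \<Rightarrow> real" where
  "weight N z = (if unrescale N z \<in> \<Omega> \<and> fst z \<le> 0 then exp (real N * (f (unrescale N z) N - f 0 N)) else 0)"

text \<open>The pointwise limit of the weights.\<close>

definition limit_weight :: "'n point \<Rightarrow> real" where
  "limit_weight z = (if fst z \<le> 0 then exp (- slope * fst z + (snd z \<bullet> (Hess *v snd z)) / 2) else 0)"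

text \<open>The common order of all errors. Since \<open>eps(N) > 0\<close>, a quantity is \<open>O(1)/\<surd>N + eps(N) \<surd>N O(1)\<close>
  exactly when it is \<open>O(rate N)\<close>.\<close>

definition rate :: "nat \<Rightarrow> real" where
  "rate N = 1 / sqrt (real N) + eps N * sqrt (real N)"

lemma rate_pos: "N > 0 \<Longrightarrow> rate N > 0"
  by (simp add: rate_def add_pos_pos eps_pos)

lemma rate_tendsto_0: "rate \<longlonglongrightarrow> 0"
proof -
  have "(\<lambda>N. 1 / sqrt (real N)) \<longlonglongrightarrow> 0"
    by (intro tendsto_divide_0[OF tendsto_const] filterlim_at_top_imp_at_infinity
        filterlim_compose[OF sqrt_at_top filterlim_real_sequentially])
  from tendsto_add[OF this eps_small] show ?thesis by (simp add: rate_def[abs_def])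
qed

lemma norm_unrescale:
  assumes "N > 0"
  shows "norm (unrescale N z) \<le> norm z / sqrt (real N)" and "norm z \<le> real N * norm (unrescale N z)"
proof -
  define s where "s = sqrt (real N)"
  have s1: "s \<ge> 1" using assms by (simp add: s_def)
  have sN: "real N = s * s" by (simp add: s_def)
  have n2: "(norm (unrescale N z))\<^sup>2 = (fst z)\<^sup>2 / (s\<^sup>2 * s\<^sup>2) + (norm (snd z))\<^sup>2 / s\<^sup>2"
    by (simp add: unrescale_def norm_Pair s_def[symmetric] sN power_divide power_mult_distrib power2_eq_square[of s])
  have z2: "(norm z)\<^sup>2 = (fst z)\<^sup>2 + (norm (snd z))\<^sup>2" by (simp add: norm_prod_def)
  have s2: "1 \<le> s\<^sup>2" using s1 by simp
  have "(fst z)\<^sup>2 / (s\<^sup>2 * s\<^sup>2) \<le> (fst z)\<^sup>2 / s\<^sup>2"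
    using mult_left_mono[OF s2, of "s\<^sup>2"] s1 by (intro divide_left_mono) auto
  then have "(norm (unrescale N z))\<^sup>2 \<le> (norm z / s)\<^sup>2" by (simp add: n2 z2 power_divide add_divide_distrib)
  moreover have "0 \<le> norm z / s" using s1 by simp
  ultimately have "norm (unrescale N z) \<le> norm z / s" by (rule power2_le_imp_le)
  then show "norm (unrescale N z) \<le> norm z / sqrt (real N)" by (simp only: s_def)
  have "1 * (norm (snd z))\<^sup>2 \<le> s\<^sup>2 * (norm (snd z))\<^sup>2" by (rule mult_right_mono[OF s2]) simp
  moreover have "(real N * norm (unrescale N z))\<^sup>2 = (fst z)\<^sup>2 + s\<^sup>2 * (norm (snd z))\<^sup>2"
    using s1 unfolding power_mult_distrib n2 sN by (simp add: distrib_left power2_eq_square)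
  ultimately have "(norm z)\<^sup>2 \<le> (real N * norm (unrescale N z))\<^sup>2" by (simp add: z2)
  moreover have "0 \<le> real N * norm (unrescale N z)" by simp
  ultimately show "norm z \<le> real N * norm (unrescale N z)" by (rule power2_le_imp_le)
qed

text \<open>The term \<open>- a z\<^sub>1\<close> comes from the derivative at \<open>0\<close> and \<open>z\<^sub>2 \<bullet> H z\<^sub>2 / 2\<close> from its second derivative
  in \<open>y\<close>. The mixed and pure \<open>x\<^sub>1\<close> parts of the Hessian and the cubic remainder cost \<open>1/\<surd>N\<close>, the
  perturbation \<open>eps(N) \<sigma>\<close> costs \<open>eps(N) \<surd>N\<close>.\<close>

lemma exponent_error:
  assumes N: "N \<ge> N1" and x: "unrescale N z \<in> cball 0 \<epsilon>"
  shows "\<bar>real N * (f (unrescale N z) N - f 0 N) - (- slope * fst z + (snd z \<bullet> (Hess *v snd z)) / 2)\<bar>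
    \<le> (2 * K + norm (D\<sigma> 0) + norm D2\<sigma>) * rate N * (1 + norm z) ^ 3"
proof -
  have N': "N \<ge> N0" "N > 0" using N N1(1) N0_pos by auto
  define s where "s = sqrt (real N)"
  have s1: "s \<ge> 1" and s0: "s > 0" using N' by (simp_all add: s_def)
  have sN: "real N = s * s" by (simp add: s_def)
  define q where "q = norm z"
  have q0: "q \<ge> 0" by (simp add: q_def)
  define x where "x = unrescale N z"
  have nx: "norm x \<le> q / s" using norm_unrescale(1)[OF N'(2)] by (simp add: x_def q_def s_def)
  define e where "e = eps N * s"
  have e0: "e > 0" using eps_pos[OF N'(2)] s0 by (simp add: e_def)
  have eps_le: "eps N \<le> e" using s1 eps_pos[OF N'(2)] by (simp add: e_def)
  define L where "L = D2f 0 N"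
  have x1: "fst x = - fst z / (s * s)" and x2: "snd x = - ((1 / s) *\<^sub>R snd z)"
    by (simp_all add: x_def unrescale_def s_def)
  have q1: "\<bar>fst z\<bar> \<le> q" and q2: "norm (snd z) \<le> q"
    using norm_fst_le[of "fst z" "snd z"] norm_snd_le[of "snd z" "fst z"] by (simp_all add: q_def)
  have E1: "\<bar>s * s * (f x N - f 0 N) - s * s * blinfun_apply (Df 0 N) x - s * s * bilin L x x / 2\<bar> \<le> K * q ^ 3 / s"
  proof -
    define r where "r = f x N - f 0 N - blinfun_apply (Df 0 N) x - bilin L x x / 2"
    have "\<bar>r\<bar> \<le> K * norm x ^ 3"
      using f_Taylor[OF N'(2) zero_in_ball, of x] assms(2) by (simp add: x_def L_def r_def)
    also have "\<dots> \<le> K * (q / s) ^ 3" using K_nonneg nx by (intro mult_left_mono power_mono) auto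
    finally have "(s * s) * \<bar>r\<bar> \<le> (s * s) * (K * (q / s) ^ 3)"
      using s0 by (intro mult_left_mono) auto
    moreover have "(s * s) * (K * (q / s) ^ 3) = K * q ^ 3 / s" using s0 by (simp add: power_divide power3_eq_cube)
    moreover have "(s * s) * \<bar>r\<bar> = \<bar>(s * s) * r\<bar>" by (simp add: abs_mult)
    ultimately show ?thesis by (simp add: r_def right_diff_distrib)
  qed
  have E2: "\<bar>s * s * blinfun_apply (Df 0 N) x - (- slope * fst z)\<bar> \<le> norm (D\<sigma> 0) * q * e"
  proof -
    have "x = fst x *\<^sub>R (1, 0) + (0, snd x)" by (simp add: prod_eq_iff)
    then have "blinfun_apply (Df0 0) x = fst x * slope"
      by (metis Df0_y_zero add.right_neutral blinfun.add_right blinfun.scaleR_right d1_def real_scaleR_def)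
    then have "s * s * blinfun_apply (Df0 0) x = - slope * fst z" using s0 by (simp add: x1)
    then have "s * s * blinfun_apply (Df 0 N) x - (- slope * fst z) = s * s * eps N * blinfun_apply (D\<sigma> 0) x"
      by (simp add: derivatives_at_0[OF N'(2)] blinfun.add_left blinfun.scaleR_left distrib_left)
    also have "\<bar>\<dots>\<bar> = s * e * \<bar>blinfun_apply (D\<sigma> 0) x\<bar>"
      using s0 eps_pos[OF N'(2)] by (simp add: abs_mult e_def)
    also have "\<dots> \<le> s * e * (norm (D\<sigma> 0) * (q / s))"
    proof (intro mult_left_mono)
      have "\<bar>blinfun_apply (D\<sigma> 0) x\<bar> \<le> norm (D\<sigma> 0) * norm x" using norm_blinfun[of "D\<sigma> 0" x] by simp
      also have "\<dots> \<le> norm (D\<sigma> 0) * (q / s)" by (intro mult_left_mono nx) auto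
      finally show "\<bar>blinfun_apply (D\<sigma> 0) x\<bar> \<le> norm (D\<sigma> 0) * (q / s)" .
    qed (use s0 e0 in auto)
    also have "\<dots> = norm (D\<sigma> 0) * q * e" using s0 by simp
    finally show ?thesis .
  qed
  have E3: "\<bar>s * s * bilin L x x - bilin L (0, snd z) (0, snd z)\<bar> \<le> 2 * K * q\<^sup>2 / s"
  proof -
    define u where "u = (fst x, 0::real^'n)"
    define y where "y = (0::real, snd x)"
    have xy: "x = u + y" by (simp add: u_def y_def prod_eq_iff)
    have nu: "norm u = \<bar>fst z\<bar> / (s * s)" using s0 by (simp add: u_def x1 norm_Pair)
    have ny: "norm y \<le> q / s" using q2 s0 by (simp add: y_def x2 norm_Pair divide_right_mono)
    have Lyy: "s * s * bilin L y y = bilin L (0, snd z) (0, snd z)"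
    proof -
      have "y = (- (1 / s)) *\<^sub>R (0, snd z)" by (simp add: y_def x2)
      then show ?thesis using s0 by (simp only: blinfun.scaleR_left blinfun.scaleR_right) simp
    qed
    have nL: "norm L \<le> K" using K2[OF N'(2) zero_in_ball] by (simp add: L_def)
    have L: "\<bar>bilin L v w\<bar> \<le> K * norm v * norm w" for v w
      using blinfun2_apply_le[of L v w] mult_right_mono[OF nL, of "norm v * norm w"] by (simp add: mult.assoc)
    have "\<bar>bilin L u x\<bar> \<le> K * norm u * (q / s)"
      using L[of u x] mult_left_mono[OF nx, of "K * norm u"] K_nonneg by simp
    moreover have "\<bar>bilin L y u\<bar> \<le> K * norm u * (q / s)"
      using L[of y u] mult_left_mono[OF ny, of "K * norm u"] K_nonneg by (simp add: mult_ac)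
    moreover have "bilin L x x = bilin L u x + bilin L y u + bilin L y y"
      by (simp add: xy blinfun.add_left blinfun.add_right)
    ultimately have "\<bar>bilin L x x - bilin L y y\<bar> \<le> 2 * (K * norm u * (q / s))"
      by linarith
    then have "(s * s) * \<bar>bilin L x x - bilin L y y\<bar> \<le> (s * s) * (2 * (K * norm u * (q / s)))"
      using s0 by (intro mult_left_mono) auto
    also have "\<dots> = 2 * K * (\<bar>fst z\<bar> * q) / s" using s0 by (simp add: nu)
    also have "\<dots> \<le> 2 * K * (q * q) / s"
      using s0 q0 q1 K_nonneg by (intro divide_right_mono mult_left_mono mult_right_mono) auto
    also have "(s * s) * \<bar>bilin L x x - bilin L y y\<bar> =
       \<bar>s * s * bilin L x x - s * s * bilin L y y\<bar>"
      by (simp add: abs_mult right_diff_distrib[symmetric])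
    finally show ?thesis unfolding Lyy by (simp add: power2_eq_square)
  qed
  have E4: "\<bar>bilin L (0, snd z) (0, snd z) - snd z \<bullet> (Hess *v snd z)\<bar> \<le> norm D2\<sigma> * q\<^sup>2 * e"
  proof -
    have "bilin L (0, snd z) (0, snd z) - snd z \<bullet> (Hess *v snd z) =
       eps N * bilin D2\<sigma> (0, snd z) (0, snd z)"
      by (simp add: L_def hessian_y_form derivatives_at_0[OF N'(2)] blinfun.add_left blinfun.scaleR_left)
    also have "\<bar>\<dots>\<bar> \<le> e * (norm D2\<sigma> * norm (snd z) * norm (snd z))"
      unfolding abs_mult using blinfun2_apply_le[of D2\<sigma> "(0, snd z)" "(0, snd z)"] eps_le eps_pos[OF N'(2)] e0
      by (intro mult_mono) (auto simp: norm_Pair)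
    also have "\<dots> \<le> e * (norm D2\<sigma> * q * q)"
      using e0 q0 q2 by (intro mult_left_mono mult_mono) auto
    finally show ?thesis by (simp add: power2_eq_square mult_ac)
  qed
  have p: "q \<le> (1 + q) ^ 3" "q\<^sup>2 \<le> (1 + q) ^ 3" "q ^ 3 \<le> (1 + q) ^ 3"
  proof -
    have "(1 + q) ^ 3 = 1 + 3 * q + 3 * q\<^sup>2 + q ^ 3" by (simp add: power2_eq_square power3_eq_cube algebra_simps)
    moreover have "q\<^sup>2 \<ge> 0" "q ^ 3 \<ge> 0" using q0 by auto
    ultimately show "q \<le> (1 + q) ^ 3" "q\<^sup>2 \<le> (1 + q) ^ 3" "q ^ 3 \<le> (1 + q) ^ 3" using q0 by linarith+
  qed
  define p where "p = (1 + q) ^ 3"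
  have "\<bar>s * s * (f x N - f 0 N) - (- slope * fst z + (snd z \<bullet> (Hess *v snd z)) / 2)\<bar>
     \<le> K * q ^ 3 / s + norm (D\<sigma> 0) * q * e + 2 * K * q\<^sup>2 / s / 2 + norm D2\<sigma> * q\<^sup>2 * e / 2"
    by (rule abs_diff_chain[OF E1 E2 E3 E4])
  also have "\<dots> \<le> K * p / s + norm (D\<sigma> 0) * p * e + 2 * K * p / s / 2 + norm D2\<sigma> * p * e / 1"
    using p(1,2,3)[folded p_def] K_nonneg s0 e0 q0
    by (intro add_mono divide_right_mono mult_right_mono mult_left_mono frac_le) auto
  also have "\<dots> = 2 * K * p * (1 / s) + (norm (D\<sigma> 0) + norm D2\<sigma>) * p * e"
    by (simp add: field_simps)
  also have "\<dots> \<le> (2 * K + norm (D\<sigma> 0) + norm D2\<sigma>) * p * (1 / s) + (2 * K + norm (D\<sigma> 0) + norm D2\<sigma>) * p * e"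
    using K_nonneg s0 e0 q0 by (intro add_mono mult_right_mono) (auto simp: p_def)
  also have "\<dots> = (2 * K + norm (D\<sigma> 0) + norm D2\<sigma>) * rate N * p"
  proof -
    have "rate N = 1 / s + e" by (simp add: rate_def s_def e_def)
    then show ?thesis by (simp only:) (simp add: algebra_simps)
  qed
  finally show ?thesis by (simp add: x_def p_def q_def sN)
qed

text \<open>Completing the square; this turns Gaussian decay into exponential decay.\<close>

lemma quadratic_le_linear:
  fixes \<kappa> u :: real
  shows "- c / 2 * u\<^sup>2 + \<kappa> * u \<le> (\<kappa> + c)\<^sup>2 / (2 * c) - c * u"
proof -
  have "(c * u - (\<kappa> + c))\<^sup>2 / (2 * c) \<ge> 0" using c_pos by simp
  then show ?thesis using c_pos by (simp add: power2_eq_square field_simps)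
qed

lemma limit_weight_bounds:
  shows "0 \<le> limit_weight z" and "limit_weight z \<le> exp ((norm (D\<sigma> 0) + c)\<^sup>2 / (2 * c) - c * norm z)"
proof -
  show "0 \<le> limit_weight z" by (simp add: limit_weight_def)
  have n: "norm z \<le> \<bar>fst z\<bar> + norm (snd z)" using norm_Pair_le[of "fst z" "snd z"] by simp
  show "limit_weight z \<le> exp ((norm (D\<sigma> 0) + c)\<^sup>2 / (2 * c) - c * norm z)"
  proof (cases "fst z \<le> 0")
    case True
    have "- slope * fst z \<le> c * fst z" using d1_f0_negative True by (intro mult_right_mono_neg) auto
    moreover have "(snd z \<bullet> (Hess *v snd z)) / 2 \<le> - c / 2 * (norm (snd z))\<^sup>2"
      using hessian_f0_negative[of "snd z"] by (simp add: dot_square_norm)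
    moreover have "- c / 2 * (norm (snd z))\<^sup>2 + norm (D\<sigma> 0) * norm (snd z) \<le> (norm (D\<sigma> 0) + c)\<^sup>2 / (2 * c) - c * norm (snd z)"
      by (rule quadratic_le_linear)
    moreover have "norm (D\<sigma> 0) * norm (snd z) \<ge> 0" by simp
    moreover have "c * norm z \<le> c * \<bar>fst z\<bar> + c * norm (snd z)" using mult_left_mono[OF n, of c] c_pos by (simp add: distrib_left)
    ultimately have "- slope * fst z + (snd z \<bullet> (Hess *v snd z)) / 2 \<le> (norm (D\<sigma> 0) + c)\<^sup>2 / (2 * c) - c * norm z"
      using True by (simp only: abs_of_nonpos)
    then show ?thesis using True by (simp add: limit_weight_def)
  qed (simp add: limit_weight_def)
qed

text \<open>On \<open>\<Omega>'\<close> both exponents are at most \<open>K0 - b \<parallel>z\<parallel>\<close> and differ as in \<open>exponent_error\<close>; off \<open>\<Omega>'\<close> both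
  weights are at most a constant times \<open>exp (-b \<parallel>z\<parallel>)\<close>, and \<open>\<parallel>z\<parallel> \<ge> \<epsilon> \<surd>N\<close>. Half of the exponential decay is spent
  on absorbing the factor \<open>(1 + \<parallel>z\<parallel>)\<^sup>3\<close>.\<close>

lemma weight_close:
  obtains b C where "b > 0" "C > 0"
    "\<And>z. limit_weight z \<le> C * exp (- b * norm z)"
    "\<And>N z. N \<ge> N1 \<Longrightarrow> \<bar>weight N z - limit_weight z\<bar> \<le> C * rate N * exp (- b * norm z)"
proof -
  define \<kappa> where "\<kappa> = norm (D\<sigma> 0)"
  define K0 where "K0 = (\<kappa> + c)\<^sup>2 / (2 * c)"
  have K0: "K0 \<ge> 0" using c_pos by (simp add: K0_def)
  obtain R where R: "R > 0" "\<And>x. x \<in> \<Omega> \<Longrightarrow> norm x \<le> R" using bounded_\<Omega> unfolding bounded_pos by blast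
  \<comment> \<open>\<open>c\<close> is the decay available on the ball, \<open>\<Delta> / (2 R)\<close> the decay available outside\<close>
  define b where "b = min c (\<Delta> / (2 * R))"
  have b: "b > 0" "b \<le> c" "b * R \<le> \<Delta> / 2" using c_pos \<Delta>_pos R by (auto simp: b_def min_def field_simps)
  define C1 where "C1 = 2 * K + norm (D\<sigma> 0) + norm D2\<sigma>"
  have C1: "C1 \<ge> 0" using K_nonneg by (simp add: C1_def)
  define P where "P = (max 1 (3 / (b / 2))) ^ 3"
  have P: "P > 0" by (simp add: P_def)
  have poly: "(1 + q) ^ 3 * exp (- b * q) \<le> P * exp (- (b / 2) * q)" if "q \<ge> 0" for q
  proof -
    have "(1 + q) ^ 3 * exp (- b * q) \<le> (P * exp (b / 2 * q)) * exp (- b * q)"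
      using cube_le_exp[of "b / 2" q] b(1) that by (intro mult_right_mono) (auto simp: P_def)
    also have "\<dots> = P * (exp (b / 2 * q) * exp (- b * q))" by simp
    also have "exp (b / 2 * q) * exp (- b * q) = exp (- (b / 2) * q)" by (simp add: exp_add[symmetric])
    finally show ?thesis .
  qed
  define C where "C = exp K0 + (C1 * exp K0 + (1 + exp K0) / \<epsilon>) * P"
  have Cpos: "C > 0" using C1 P \<epsilon>_pos by (auto simp: C_def intro!: add_pos_nonneg mult_nonneg_nonneg add_nonneg_nonneg)
  have C1': "C1 * exp K0 * P \<le> C" and C2: "(1 + exp K0) / \<epsilon> * P \<le> C" and C3: "exp K0 \<le> C"
    using C1 P \<epsilon>_pos by (auto simp: C_def distrib_right add_increasing add_increasing2)
  have lw: "limit_weight z \<le> exp K0 * exp (- b * norm z)" for z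
  proof -
    have "limit_weight z \<le> exp (K0 - c * norm z)" using limit_weight_bounds(2) by (simp add: K0_def \<kappa>_def)
    also have "\<dots> \<le> exp (K0 - b * norm z)" using b by (simp add: mult_right_mono)
    finally show ?thesis by (simp add: exp_diff exp_minus field_simps)
  qed
  show thesis
  proof (rule that[of "b / 2" C])
    show "b / 2 > 0" "C > 0" using b Cpos by auto
    show "limit_weight z \<le> C * exp (- (b / 2) * norm z)" for z
    proof -
      have "limit_weight z \<le> exp K0 * exp (- b * norm z)" by (rule lw)
      also have "\<dots> \<le> C * exp (- (b / 2) * norm z)" using C3 Cpos b by (intro mult_mono) auto
      finally show ?thesis .
    qed
    fix N :: nat and z :: "'n point" assume N: "N \<ge> N1"
    then have N': "N \<ge> N0" "N > 0" using N1(1) N0_pos by auto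
    define q where "q = norm z"
    have q0: "q \<ge> 0" by (simp add: q_def)
    define x where "x = unrescale N z"
    have rp: "rate N > 0" by (rule rate_pos[OF N'(2)])
    show "\<bar>weight N z - limit_weight z\<bar> \<le> C * rate N * exp (- (b / 2) * norm z)"
    proof (cases "fst z \<le> 0")
      case False
      then show ?thesis using Cpos rp by (simp add: weight_def limit_weight_def)
    next
      case z1: True
      show ?thesis
      proof (cases "x \<in> cball 0 \<epsilon>")
        case True
        define A where "A = real N * (f x N - f 0 N)"
        define B where "B = - slope * fst z + (snd z \<bullet> (Hess *v snd z)) / 2"
        have eqA: "weight N z = exp A" and eqB: "limit_weight z = exp B"
          using z1 True ball_subset by (auto simp: weight_def limit_weight_def A_def B_def x_def)
        have B: "B \<le> K0 - b * q"
        proof -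
          have "exp B \<le> exp (K0 - b * q)" using lw[of z] unfolding eqB q_def exp_diff by (simp add: exp_minus field_simps)
          then show ?thesis by simp
        qed
        have A: "A \<le> K0 - b * q"
        proof -
          have s: "sqrt (real N) * sqrt (real N) = real N" "sqrt (real N) > 0" using N' by auto
          have "fst x \<ge> 0" using z1 by (simp add: x_def unrescale_def divide_nonpos_nonneg)
          from f_upper_bound[OF N True this]
          have "A \<le> real N * (- c * fst x - c / 2 * (norm (snd x))\<^sup>2 + eps N * \<kappa> * norm (snd x))"
            unfolding A_def \<kappa>_def by (intro mult_left_mono) auto
          also have "\<dots> = c * fst z - c / 2 * (norm (snd z))\<^sup>2 + (eps N * sqrt (real N)) * (\<kappa> * norm (snd z))"
          proof -
            have 1: "real N * fst x = - fst z" using N' by (simp add: x_def unrescale_def)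
            have 2: "real N * (norm (snd x))\<^sup>2 = (norm (snd z))\<^sup>2" using N' by (simp add: x_def unrescale_def power_divide)
            have "norm (snd x) = norm (snd z) / sqrt (real N)" by (simp add: x_def unrescale_def)
            then have 3: "real N * norm (snd x) = sqrt (real N) * norm (snd z)" using s by (metis (no_types) mult.assoc nonzero_mult_div_cancel_left less_irrefl times_divide_eq_right)
            have "real N * (- c * fst x - c / 2 * (norm (snd x))\<^sup>2 + eps N * \<kappa> * norm (snd x)) =
               - c * (real N * fst x) - c / 2 * (real N * (norm (snd x))\<^sup>2) + eps N * \<kappa> * (real N * norm (snd x))"
              by (simp add: algebra_simps)
            then show ?thesis unfolding 1 2 3 by (simp add: algebra_simps)
          qed
          also have "\<dots> \<le> c * fst z - c / 2 * (norm (snd z))\<^sup>2 + 1 * (\<kappa> * norm (snd z))"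
            using N1(4)[OF N] by (intro add_left_mono mult_right_mono) (auto simp: \<kappa>_def)
          also have "\<dots> \<le> - c * \<bar>fst z\<bar> + (K0 - c * norm (snd z))"
            using quadratic_le_linear[of "norm (snd z)" \<kappa>] z1 by (simp add: K0_def)
          also have "\<dots> \<le> K0 - c * q"
          proof -
            have "q \<le> \<bar>fst z\<bar> + norm (snd z)" using norm_Pair_le[of "fst z" "snd z"] by (simp add: q_def)
            from mult_left_mono[OF this, of c] show ?thesis using c_pos by (simp add: distrib_left)
          qed
          also have "\<dots> \<le> K0 - b * q" using b q0 by (simp add: mult_right_mono)
          finally show ?thesis .
        qed
        have "\<bar>weight N z - limit_weight z\<bar> \<le> \<bar>A - B\<bar> * exp (K0 - b * q)"
          unfolding eqA eqB by (rule abs_exp_diff_le[OF A B])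
        also have "\<dots> \<le> (C1 * rate N * (1 + q) ^ 3) * exp (K0 - b * q)"
          using exponent_error[OF N, of z] True by (intro mult_right_mono) (auto simp: A_def B_def C1_def q_def x_def)
        also have "\<dots> = (C1 * exp K0) * rate N * ((1 + q) ^ 3 * exp (- b * q))"
          by (simp add: exp_diff exp_minus field_simps)
        also have "\<dots> \<le> (C1 * exp K0) * rate N * (P * exp (- (b / 2) * q))"
          using poly[OF q0] C1 rp by (intro mult_left_mono) auto
        also have "\<dots> = (C1 * exp K0 * P) * rate N * exp (- (b / 2) * q)" by simp
        also have "\<dots> \<le> C * rate N * exp (- (b / 2) * q)"
          using C1' rp by (intro mult_right_mono) auto
        finally show ?thesis by (simp add: q_def)
      next
        case False
        have w0: "0 \<le> weight N z" by (simp add: weight_def)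
        have w1: "weight N z \<le> exp (- b * q)"
        proof (cases "x \<in> \<Omega>")
          case True
          have "real N * (f x N - f 0 N) \<le> real N * (- \<Delta> / 2)"
            using f_gap[OF N, of x] True False by (intro mult_left_mono) auto
          also have "\<dots> \<le> - b * q"
          proof -
            have "q \<le> real N * norm x" using norm_unrescale(2)[OF N'(2)] by (simp add: q_def x_def)
            also have "\<dots> \<le> real N * R" using R(2)[OF True] by (intro mult_left_mono) auto
            finally have "b * q \<le> b * (real N * R)" using b by (intro mult_left_mono) auto
            also have "\<dots> = real N * (b * R)" by simp
            also have "\<dots> \<le> real N * (\<Delta> / 2)" using b by (intro mult_left_mono) auto
            finally show ?thesis by simp
          qed
          finally show ?thesis by (simp add: weight_def x_def)
        qed (simp add: weight_def x_def)
        have qs: "1 \<le> q * (1 / sqrt (real N)) / \<epsilon>"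
        proof -
          have "\<epsilon> \<le> norm x" using False by simp
          also have "\<dots> \<le> q / sqrt (real N)" using norm_unrescale(1)[OF N'(2)] by (simp add: q_def x_def)
          finally have "1 \<le> q / sqrt (real N) / \<epsilon>" by (subst le_divide_eq_1_pos[OF \<epsilon>_pos])
          then show ?thesis by simp
        qed
        have "\<bar>weight N z - limit_weight z\<bar> \<le> exp (- b * q) + exp K0 * exp (- b * q)"
          using w0 w1 lw[of z] limit_weight_bounds(1)[of z] unfolding q_def[symmetric] by linarith
        also have "\<dots> = (1 + exp K0) * exp (- b * q) * 1" by (simp add: algebra_simps)
        also have "\<dots> \<le> (1 + exp K0) * exp (- b * q) * (q * (1 / sqrt (real N)) / \<epsilon>)"
          using qs by (intro mult_left_mono) (auto intro: mult_nonneg_nonneg add_nonneg_nonneg)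
        also have "\<dots> = ((1 + exp K0) / \<epsilon>) * ((1 / sqrt (real N)) * (q * exp (- b * q)))" by (simp add: mult_ac)
        also have "\<dots> \<le> ((1 + exp K0) / \<epsilon>) * (rate N * (P * exp (- (b / 2) * q)))"
        proof (rule mult_left_mono)
          have r: "1 / sqrt (real N) \<le> rate N" using eps_pos[OF N'(2)] by (simp add: rate_def)
          have "1 + q \<le> (1 + q) ^ 3" using q0 by (intro self_le_power) auto
          then have "q \<le> (1 + q) ^ 3" by simp
          then have "q * exp (- b * q) \<le> (1 + q) ^ 3 * exp (- b * q)" by (intro mult_right_mono) auto
          also have "\<dots> \<le> P * exp (- (b / 2) * q)" by (rule poly[OF q0])
          finally have "q * exp (- b * q) \<le> P * exp (- (b / 2) * q)" .
          from r this show "(1 / sqrt (real N)) * (q * exp (- b * q)) \<le> rate N * (P * exp (- (b / 2) * q))"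
            by (rule mult_mono) (use rp q0 in simp_all)
          show "0 \<le> (1 + exp K0) / \<epsilon>" using \<epsilon>_pos by (simp add: add_nonneg_nonneg)
        qed
        also have "\<dots> = ((1 + exp K0) / \<epsilon> * P) * rate N * exp (- (b / 2) * q)" by simp
        also have "\<dots> \<le> C * rate N * exp (- (b / 2) * q)"
          using C2 rp by (intro mult_right_mono) auto
        finally show ?thesis by (simp add: q_def)
      qed
    qed
  qed
qed

end

section \<open>The limit law\<close>

lemma matrix_invertible_inverse:
  fixes A :: "real^'n^'n"
  assumes "invertible A"
  shows "A ** matrix_inv A = mat 1" and "matrix_inv A ** A = mat 1"
proof -
  have "\<exists>B. A ** B = mat 1 \<and> B ** A = mat 1" using assms by (simp add: invertible_def)
  from someI_ex[OF this] show "A ** matrix_inv A = mat 1" and "matrix_inv A ** A = mat 1"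
    by (simp_all add: matrix_inv_def)
qed

lemma matrix_inv_eqI:
  fixes A B :: "real^'n^'n"
  assumes "A ** B = mat 1"
  shows "matrix_inv A = B"
proof -
  have "B ** A = mat 1" using assms by (simp add: matrix_left_right_inverse)
  moreover have "invertible A" using assms by (metis invertible_right_inverse)
  then have "A ** matrix_inv A = mat 1" by (simp add: matrix_invertible_inverse)
  ultimately show ?thesis by (metis matrix_mul_assoc matrix_mul_lid matrix_mul_rid)
qed

lemma matrix_inv_uminus:
  fixes A :: "real^'n^'n"
  assumes "invertible A"
  shows "matrix_inv (- A) = - matrix_inv A"
proof (rule matrix_inv_eqI)
  have "(- A) ** (- matrix_inv A) = A ** matrix_inv A"
    by (simp add: matrix_matrix_mult_def vec_eq_iff)
  then show "(- A) ** (- matrix_inv A) = mat 1" using assms by (simp add: matrix_invertible_inverse)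
qed

text \<open>The density of the centred normal law with precision matrix (inverse covariance) \<open>P\<close>.\<close>

definition gaussian_density :: "real^'n^'n \<Rightarrow> real^'n \<Rightarrow> real" where
  "gaussian_density P y = exp (- (y \<bullet> (P *v y)) / 2) * sqrt (det P / (2 * pi) ^ CARD('n))"

lemma gaussian_density_nonneg: "det P > 0 \<Longrightarrow> 0 \<le> gaussian_density P y"
  by (simp add: gaussian_density_def)

lemma gaussian_density_measurable[measurable]: "gaussian_density P \<in> borel_measurable borel"
  unfolding gaussian_density_def[abs_def]
  by (intro borel_measurable_continuous_onI continuous_intros linear_continuous_on_compose[OF continuous_on_id])
     (simp_all add: matrix_vector_mul_linear)

lemma integral_lborel_translate:
  fixes F :: "'a::euclidean_space \<Rightarrow> real"
  assumes [measurable]: "F \<in> borel_measurable borel"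
  shows "(\<integral>x. F (c + x) \<partial>lborel) = (\<integral>x. F x \<partial>lborel)"
proof -
  have "(\<integral>x. F x \<partial>lborel) = (\<integral>x. F x \<partial>distr lborel borel ((+) c))"
    by (simp add: lborel_distr_plus)
  then show ?thesis by (simp add: integral_distr)
qed

context
  fixes P :: "real^'n^'n"
  assumes sym: "transpose P = P" and pos: "\<And>u. u \<noteq> 0 \<Longrightarrow> u \<bullet> (P *v u) > 0"
begin

lemma det_positive_definite: "det P > 0"
  and nn_integral_gaussian_density: "(\<integral>\<^sup>+y. ennreal (gaussian_density P y) \<partial>lborel) = 1"
proof -
  obtain B :: "real^'n^'n" where B: "invertible B" "transpose B ** P ** B = mat 1"
    using congruent_to_identity[OF sym pos] by blast
  have d: "det B * det B * det P = 1"
    using arg_cong[OF B(2), of det] by (simp add: det_mul mult_ac)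
  then have dB': "(det B)\<^sup>2 * det P = 1" by (simp add: power2_eq_square)
  have "det B \<noteq> 0" using d by auto
  then have dB: "(det B)\<^sup>2 > 0" by simp
  show dP: "det P > 0" using dB dB' by (metis zero_less_mult_pos zero_less_one)
  have form: "(B *v x) \<bullet> (P *v (B *v x)) = x \<bullet> x" for x
  proof -
    have "(B *v x) \<bullet> (P *v (B *v x)) = x \<bullet> (transpose B *v (P *v (B *v x)))"
      by (metis dot_lmul_matrix inner_commute matrix_transpose_mul transpose_matrix_vector transpose_transpose vector_transpose_matrix)
    also have "\<dots> = x \<bullet> ((transpose B ** P ** B) *v x)" by (simp add: matrix_vector_mul_assoc matrix_mul_assoc)
    finally show ?thesis by (simp add: B(2))
  qed
  have c: "sqrt (det P / (2 * pi) ^ CARD('n)) \<ge> 0" using dP by simp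
  have "(\<integral>\<^sup>+y. ennreal (gaussian_density P y) \<partial>lborel) = ennreal \<bar>det B\<bar> * (\<integral>\<^sup>+x. ennreal (gaussian_density P (B *v x)) \<partial>lborel)"
    by (rule nn_integral_lborel_linear[OF B(1), symmetric]) simp
  also have "(\<integral>\<^sup>+x. ennreal (gaussian_density P (B *v x)) \<partial>lborel) =
      (\<integral>\<^sup>+(x::real^'n). ennreal (exp (- (x \<bullet> x) / 2)) * ennreal (sqrt (det P / (2 * pi) ^ CARD('n))) \<partial>lborel)"
    using c by (simp only: gaussian_density_def form ennreal_mult'')
  also have "\<dots> = (\<integral>\<^sup>+(x::real^'n). ennreal (exp (- (x \<bullet> x) / 2)) \<partial>lborel) * ennreal (sqrt (det P / (2 * pi) ^ CARD('n)))"
    by (rule nn_integral_multc) simp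
  also have "\<dots> = ennreal (sqrt ((2 * pi) ^ CARD('n)) * sqrt (det P / (2 * pi) ^ CARD('n)))"
    by (simp only: nn_integral_gaussian ennreal_mult''[OF c])
  also have "sqrt ((2 * pi) ^ CARD('n)) * sqrt (det P / (2 * pi) ^ CARD('n)) = sqrt (det P)"
    by (simp only: real_sqrt_mult[symmetric]) simp
  also have "ennreal \<bar>det B\<bar> * ennreal (sqrt (det P)) = ennreal (\<bar>det B\<bar> * sqrt (det P))"
    by (rule ennreal_mult'[symmetric]) simp
  also have "\<bar>det B\<bar> * sqrt (det P) = 1"
  proof -
    have "\<bar>det B\<bar> * sqrt (det P) = sqrt ((det B)\<^sup>2 * det P)" by (simp add: real_sqrt_mult)
    then show ?thesis by (simp add: dB')
  qed
  finally show "(\<integral>\<^sup>+y. ennreal (gaussian_density P y) \<partial>lborel) = 1" by simp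
qed

lemma integrable_gaussian_density: "integrable lborel (gaussian_density P)"
  and integral_gaussian_density: "(\<integral>y. gaussian_density P y \<partial>lborel) = 1"
proof -
  have "has_bochner_integral lborel (gaussian_density P) 1"
    using gaussian_density_nonneg[OF det_positive_definite] nn_integral_gaussian_density
    by (intro has_bochner_integral_nn_integral) auto
  then show "integrable lborel (gaussian_density P)" "(\<integral>y. gaussian_density P y \<partial>lborel) = 1"
    by (auto simp: has_bochner_integral_iff)
qed

lemma normal_law_precision: "normal_law 0 (matrix_inv P) = density lborel (\<lambda>y. ennreal (gaussian_density P y))"
proof -
  have inv: "invertible P" using det_positive_definite by (simp add: invertible_det_nz)
  then have PQ: "P ** matrix_inv P = mat 1" "matrix_inv P ** P = mat 1" by (simp_all add: matrix_invertible_inverse)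
  have "det P * det (matrix_inv P) = 1" using arg_cong[OF PQ(1), of det] by (simp add: det_mul)
  then have "det (matrix_inv P) = 1 / det P" using det_positive_definite by (simp add: field_simps)
  moreover have "matrix_inv (matrix_inv P) = P" by (rule matrix_inv_eqI[OF PQ(2)])
  ultimately show ?thesis
    unfolding normal_law_def gaussian_density_def by (simp add: real_sqrt_divide real_sqrt_mult)
qed

text \<open>Completing the square: the mean is shifted to \<open>m = P\<^sup>-\<^sup>1 \<xi>\<close>.\<close>

lemma gaussian_mgf:
  "(\<integral>y. exp (\<xi> \<bullet> y) * gaussian_density P y \<partial>lborel) = exp (\<xi> \<bullet> (matrix_inv P *v \<xi>) / 2)"
proof -
  have inv: "invertible P" using det_positive_definite by (simp add: invertible_det_nz)
  define m where "m = matrix_inv P *v \<xi>"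
  have Pm: "P *v m = \<xi>" using inv by (simp add: m_def matrix_vector_mul_assoc matrix_invertible_inverse)
  have self: "x \<bullet> (P *v y) = y \<bullet> (P *v x)" for x y
    by (metis dot_lmul_matrix inner_commute sym transpose_matrix_vector)
  have eq: "exp (\<xi> \<bullet> y) * gaussian_density P y = exp (\<xi> \<bullet> m / 2) * gaussian_density P (- m + y)" for y
  proof -
    have "(- m + y) \<bullet> (P *v (- m + y)) = m \<bullet> \<xi> - 2 * (\<xi> \<bullet> y) + y \<bullet> (P *v y)"
      using self[of m y]
      by (simp add: matrix_vector_mult_diff_distrib[of P y m, symmetric] Pm inner_diff_left inner_diff_right
          matrix_vector_mult_diff_distrib inner_commute)
    then show ?thesis
      by (simp add: gaussian_density_def exp_add[symmetric] inner_commute field_simps)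
  qed
  have "(\<integral>y. gaussian_density P (- m + y) \<partial>lborel) = 1"
    by (simp only: integral_lborel_translate[OF gaussian_density_measurable] integral_gaussian_density)
  then show ?thesis
    unfolding eq by (simp only: integral_mult_right_zero m_def mult_1_right)
qed

end

lemma prob_space_density_lborel:
  fixes p :: "'a::euclidean_space \<Rightarrow> real"
  assumes "\<And>x. 0 \<le> p x" "integrable lborel p" "(\<integral>x. p x \<partial>lborel) = 1"
  shows "prob_space (density lborel (\<lambda>x. ennreal (p x)))"
proof (rule prob_spaceI)
  have [measurable]: "p \<in> borel_measurable borel" using assms(2) by (simp add: borel_measurable_integrable)
  show "emeasure (density lborel (\<lambda>x. ennreal (p x))) (space (density lborel (\<lambda>x. ennreal (p x)))) = 1"
    using assms by (simp add: emeasure_density nn_integral_eq_integral)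
qed

lemma exponential_density_integral:
  assumes "l > 0"
  shows "integrable lborel (exponential_density l)" and "(\<integral>x. exponential_density l x \<partial>lborel) = 1"
proof -
  have 1: "(\<integral>\<^sup>+x. ennreal (exponential_density l x) \<partial>lborel) = 1"
    using prob_space.emeasure_space_1[OF prob_space_exponential_density[OF assms]]
    by (simp add: emeasure_density)
  have "has_bochner_integral lborel (exponential_density l) 1"
    using exponential_density_nonneg[OF assms] 1
    by (intro has_bochner_integral_nn_integral) auto
  then show "integrable lborel (exponential_density l)" "(\<integral>x. exponential_density l x \<partial>lborel) = 1"
    by (auto simp: has_bochner_integral_iff)
qed

lemma exponential_mgf:
  assumes "l > 0" "l + s > 0"
  shows "(\<integral>x. exp (- (s * x)) * exponential_density l x \<partial>lborel) = l / (l + s)"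
proof -
  have "exp (- (s * x)) * exponential_density l x = l / (l + s) * exponential_density (l + s) x" for x
  proof -
    have "exp (- (s * x)) * exp (- x * l) = exp (- x * (l + s))" by (simp add: exp_add[symmetric] algebra_simps)
    then have "exp (- (s * x)) * (l * exp (- x * l)) = l * exp (- x * (l + s))" by (metis mult.left_commute)
    moreover have "l / (l + s) * ((l + s) * exp (- x * (l + s))) = l * exp (- x * (l + s))" using assms by simp
    ultimately show ?thesis
      by (cases "x < 0") (simp add: exponential_density_def, simp only: exponential_density_def if_False)
  qed
  then show ?thesis using exponential_density_integral(2)[OF assms(2)] by simp
qed

lemma integral_lborel_product:
  fixes u :: "'a::euclidean_space \<Rightarrow> real" and v :: "'b::euclidean_space \<Rightarrow> real"
  assumes u: "integrable lborel u" and v: "integrable lborel v"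
  shows "integrable lborel (\<lambda>z. u (fst z) * v (snd z))"
    and "(\<integral>z. u (fst z) * v (snd z) \<partial>lborel) = (\<integral>x. u x \<partial>lborel) * (\<integral>y. v y \<partial>lborel)"
proof -
  have [measurable]: "u \<in> borel_measurable borel" "v \<in> borel_measurable borel"
    using u v by (simp_all add: borel_measurable_integrable)
  have i: "integrable (lborel \<Otimes>\<^sub>M lborel) (\<lambda>z. u (fst z) * v (snd z))"
  proof (rule lborel_pair.Fubini_integrable)
    show "integrable lborel (\<lambda>x. \<integral>y. norm (u (fst (x, y)) * v (snd (x, y))) \<partial>lborel)"
      using u v by (simp add: abs_mult)
  qed (use u v in simp_all)
  then show "integrable lborel (\<lambda>z. u (fst z) * v (snd z))" by (simp add: lborel_prod)
  show "(\<integral>z. u (fst z) * v (snd z) \<partial>lborel) = (\<integral>x. u x \<partial>lborel) * (\<integral>y. v y \<partial>lborel)"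
    using lborel_pair.integral_fst'[OF i] by (simp add: lborel_prod)
qed

lemma integral_lborel_reflect:
  fixes g :: "real \<Rightarrow> real"
  shows "(\<integral>x. g (- x) \<partial>lborel) = (\<integral>x. g x \<partial>lborel)"
  using lborel_integral_real_affine[of "-1" g 0] by simp

lemma integrable_lborel_reflect:
  fixes g :: "real \<Rightarrow> real"
  shows "integrable lborel g \<Longrightarrow> integrable lborel (\<lambda>x. g (- x))"
  using lborel_integrable_real_affine[of g "-1" 0] by simp

text \<open>The density of \<open>(-T, Y)\<close> for independent \<open>T\<close>, exponential with rate \<open>l\<close>, and \<open>Y\<close>, normal with
  precision \<open>P\<close>.\<close>

definition limit_density :: "real \<Rightarrow> real^'n^'n \<Rightarrow> 'n point \<Rightarrow> real" where
  "limit_density l P z = exponential_density l (- fst z) * gaussian_density P (snd z)"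

context
  fixes l :: real and P :: "real^'n^'n"
  assumes l: "l > 0" and sym: "transpose P = P" and pos: "\<And>u. u \<noteq> 0 \<Longrightarrow> u \<bullet> (P *v u) > 0"
begin

lemma limit_density_product:
  assumes "integrable lborel (\<lambda>x. g x * exponential_density l x)" "integrable lborel (\<lambda>y. h y * gaussian_density P y)"
  shows "(\<integral>z. limit_density l P z * (g (- fst z) * h (snd z)) \<partial>lborel) =
    (\<integral>x. g x * exponential_density l x \<partial>lborel) * (\<integral>y. h y * gaussian_density P y \<partial>lborel)"
proof -
  have "(\<integral>z. limit_density l P z * (g (- fst z) * h (snd z)) \<partial>lborel) =
     (\<integral>z. (g (- fst z) * exponential_density l (- fst z)) * (h (snd z) * gaussian_density P (snd z)) \<partial>lborel)"
    by (simp add: limit_density_def mult_ac)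
  also have "\<dots> = (\<integral>x. g (- x) * exponential_density l (- x) \<partial>lborel) * (\<integral>y. h y * gaussian_density P y \<partial>lborel)"
    by (rule integral_lborel_product(2)[OF integrable_lborel_reflect[OF assms(1)] assms(2)])
  finally show ?thesis by (simp add: integral_lborel_reflect[of "\<lambda>x. g x * exponential_density l x"])
qed

lemma limit_density_nonneg: "0 \<le> limit_density l P z"
  unfolding limit_density_def
  by (intro mult_nonneg_nonneg exponential_density_nonneg[OF l] gaussian_density_nonneg det_positive_definite[OF sym pos])

lemma integrable_limit_density: "integrable lborel (limit_density l P)"
  unfolding limit_density_def[abs_def]
  by (rule integral_lborel_product(1)[OF integrable_lborel_reflect[OF exponential_density_integral(1)[OF l]] integrable_gaussian_density[OF sym pos]])

lemma integral_limit_density: "(\<integral>z. limit_density l P z \<partial>lborel) = 1"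
  using limit_density_product[of "\<lambda>_. 1" "\<lambda>_. 1"] exponential_density_integral[OF l]
    integrable_gaussian_density[OF sym pos] integral_gaussian_density[OF sym pos]
  by simp

end

section \<open>Expectations under the rescaled law\<close>

lemma ratio_close:
  fixes x y \<alpha> \<beta> d X Y :: real
  assumes y: "y > 0" and X: "\<bar>X - x\<bar> \<le> \<alpha> * d" and Y: "\<bar>Y - y\<bar> \<le> \<beta> * d" and d: "d \<ge> 0" "\<beta> * d \<le> y / 2"
  shows "\<bar>X / Y - x / y\<bar> \<le> 2 * (\<alpha> * y + \<bar>x\<bar> * \<beta>) / y\<^sup>2 * d"
proof -
  have Y2: "Y \<ge> y / 2" using Y d(2) by (simp add: abs_le_iff)
  then have Yp: "Y > 0" using y by simp
  have "\<bar>X * y - x * Y\<bar> = \<bar>(X - x) * y - x * (Y - y)\<bar>" by (simp add: algebra_simps)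
  also have "\<dots> \<le> \<bar>X - x\<bar> * y + \<bar>x\<bar> * \<bar>Y - y\<bar>"
    using abs_triangle_ineq4[of "(X - x) * y" "x * (Y - y)"] y by (simp add: abs_mult)
  also have "\<dots> \<le> (\<alpha> * d) * y + \<bar>x\<bar> * (\<beta> * d)"
    using X Y y by (intro add_mono mult_right_mono mult_left_mono) auto
  finally have num: "\<bar>X * y - x * Y\<bar> \<le> (\<alpha> * y + \<bar>x\<bar> * \<beta>) * d" by (simp add: algebra_simps)
  have "X / Y - x / y = (X * y - x * Y) / (Y * y)" using y Yp by (simp add: field_simps)
  then have "\<bar>X / Y - x / y\<bar> = \<bar>X * y - x * Y\<bar> / (Y * y)" using y Yp by (simp add: abs_mult)
  also have "\<dots> \<le> ((\<alpha> * y + \<bar>x\<bar> * \<beta>) * d) / (y / 2 * y)"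
  proof (rule frac_le)
    show "y / 2 * y \<le> Y * y" using Y2 y by (intro mult_right_mono) auto
    show "0 \<le> (\<alpha> * y + \<bar>x\<bar> * \<beta>) * d" using num by (meson abs_ge_zero order_trans)
  qed (use num y in auto)
  also have "\<dots> = 2 * (\<alpha> * y + \<bar>x\<bar> * \<beta>) / y\<^sup>2 * d" by (simp add: power2_eq_square)
  finally show ?thesis .
qed

context boundary_maximum
begin

lemma rescaled_unrescale: "N > 0 \<Longrightarrow> rescaled 0 N (unrescale N z) = z"
  by (simp add: rescaled_def unrescale_def prod_eq_iff)

lemma unrescale_affine:
  assumes N: "N > 0"
  obtains k where "\<And>j. j \<in> Basis \<Longrightarrow> k j \<noteq> 0" "unrescale N = (\<lambda>z. 0 + (\<Sum>j\<in>Basis. (k j * (z \<bullet> j)) *\<^sub>R j))"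
proof -
  define k where "k j = (if snd j = 0 then - 1 / real N else - 1 / sqrt (real N))" for j :: "'n point"
  have "unrescale N z \<bullet> j = k j * (z \<bullet> j)" if "j \<in> Basis" for j z
    using that by (auto simp: Basis_prod_def unrescale_def k_def inner_prod_def nonzero_Basis)
  then have "unrescale N z = 0 + (\<Sum>j\<in>Basis. (k j * (z \<bullet> j)) *\<^sub>R j)" for z
    using euclidean_representation[of "unrescale N z"] by (simp cong: sum.cong)
  moreover have "k j \<noteq> 0" for j using N by (simp add: k_def)
  ultimately show thesis using that by blast
qed

lemma lebesgue_unrescale:
  assumes N: "N > 0"
  obtains J where "J > 0" "unrescale N \<in> lebesgue \<rightarrow>\<^sub>M lebesgue"
    "\<And>F :: 'n point \<Rightarrow> real. F \<in> borel_measurable lebesgue \<Longrightarrow> (\<integral>x. F x \<partial>lebesgue) = J * (\<integral>z. F (unrescale N z) \<partial>lebesgue)"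
proof -
  obtain k where k: "\<And>j. j \<in> Basis \<Longrightarrow> k j \<noteq> 0" and T: "unrescale N = (\<lambda>z. 0 + (\<Sum>j\<in>Basis. (k j * (z \<bullet> j)) *\<^sub>R j))"
    using unrescale_affine[OF N] by blast
  define J where "J = (\<Prod>j\<in>(Basis::'n point set). \<bar>k j\<bar>)"
  have J: "J > 0" using k by (simp add: J_def prod_pos)
  have leb: "lebesgue = density (distr lebesgue lebesgue (unrescale N)) (\<lambda>_. ennreal J)"
    using lebesgue_affine_euclidean[of k 0, OF k] by (simp only: T J_def prod_ennreal)
  have meas: "unrescale N \<in> lebesgue \<rightarrow>\<^sub>M lebesgue"
    using lebesgue_affine_measurable[of k 0, OF k] by (simp only: T)
  have "(\<integral>x. F x \<partial>lebesgue) = J * (\<integral>z. F (unrescale N z) \<partial>lebesgue)" if F: "F \<in> borel_measurable lebesgue" for F :: "'n point \<Rightarrow> real"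
  proof -
    have "(\<integral>x. F x \<partial>lebesgue) = (\<integral>x. F x \<partial>density (distr lebesgue lebesgue (unrescale N)) (\<lambda>_. ennreal J))"
      using arg_cong[OF leb, of "\<lambda>M. integral\<^sup>L M F"] .
    also have "\<dots> = (\<integral>x. J *\<^sub>R F x \<partial>distr lebesgue lebesgue (unrescale N))"
      using F J by (intro integral_density) auto
    also have "\<dots> = (\<integral>z. J *\<^sub>R F (unrescale N z) \<partial>lebesgue)"
      using F meas by (intro integral_distr) auto
    finally show ?thesis by simp
  qed
  then show thesis using that J meas by blast
qed

text \<open>The law of \<open>X\<close> is the Lebesgue measure with density \<open>exp (N f)\<close> on \<open>S\<close>, normalised; substituting
  \<open>x = unrescale N z\<close> and cancelling the constants gives a quotient of integrals of \<open>weight N\<close>. All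
  integrals are over the completed measure because \<open>exp (N f)\<close> is only assumed Lebesgue measurable on \<open>S\<close>.\<close>

lemma expectation_rescaled:
  fixes M :: "'w measure" and X :: "'w \<Rightarrow> 'n point"
  defines "S \<equiv> \<Omega> \<inter> {x. fst x \<ge> 0}"
  assumes N: "N > 0" and M: "prob_space M" and X[measurable]: "X \<in> borel_measurable M"
    and XS: "\<And>w. w \<in> space M \<Longrightarrow> X w \<in> S"
    and int: "set_integrable lebesgue S (\<lambda>x. exp (real N * f x N))"
    and law: "\<And>B. B \<in> sets borel \<Longrightarrow> B \<subseteq> S \<Longrightarrow>
      measure M {w \<in> space M. X w \<in> B} =
        (LINT x:B|lebesgue. exp (real N * f x N)) / (LINT x:S|lebesgue. exp (real N * f x N))"
  shows "weight N \<in> borel_measurable lebesgue"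
    and "G \<in> borel_measurable borel \<Longrightarrow>
       (LINT w|M. G (rescaled 0 N (X w))) = (\<integral>z. weight N z * G z \<partial>lebesgue) / (\<integral>z. weight N z \<partial>lebesgue)"
proof -
  interpret M: prob_space M by (rule M)
  obtain J where J: "J > 0" and meas[measurable]: "unrescale N \<in> lebesgue \<rightarrow>\<^sub>M lebesgue"
    and cov: "\<And>F :: 'n point \<Rightarrow> real. F \<in> borel_measurable lebesgue \<Longrightarrow> (\<integral>x. F x \<partial>lebesgue) = J * (\<integral>z. F (unrescale N z) \<partial>lebesgue)"
    using lebesgue_unrescale[OF N] by blast
  define I where "I = (LINT x:S|lebesgue. exp (real N * f x N))"
  define e where "e x = indicator S x * exp (real N * f x N)" for x
  have S: "S \<in> sets borel"
  proof -
    have "closed {x::'n point. fst x \<ge> 0}" by (intro closed_Collect_le continuous_intros)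
    then show ?thesis unfolding S_def using open_\<Omega> by (intro sets.Int borel_open borel_closed)
  qed
  have e_int: "integrable lebesgue e" using int by (simp add: set_integrable_def e_def[abs_def])
  then have [measurable]: "e \<in> borel_measurable lebesgue" by (rule borel_measurable_integrable)
  have e0: "e x \<ge> 0" for x by (simp add: e_def)
  have I_eq: "I = (\<integral>x. e x \<partial>lebesgue)" by (simp add: I_def set_lebesgue_integral_def e_def)
  have I0: "I \<ge> 0" unfolding I_eq using e0 by simp
  have "measure M {w \<in> space M. X w \<in> S} = 1"
    using XS M.prob_space by (metis (mono_tags, lifting) Collect_cong Collect_mem_eq)
  \<comment> \<open>for \<open>I = 0\<close> the quotient would be \<open>0\<close> by convention, but the total mass is \<open>1\<close>\<close>
  then have "I \<noteq> 0" using law[OF S order_refl] by (auto simp: I_def)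
  with I0 have I: "I > 0" by simp
  define D where "D = density lebesgue (\<lambda>x. ennreal (e x / I))"
  have idm[measurable]: "(\<lambda>x::'n point. x) \<in> lebesgue \<rightarrow>\<^sub>M borel" by (rule measurable_completion) simp
  have idD: "(\<lambda>x::'n point. x) \<in> D \<rightarrow>\<^sub>M borel" unfolding D_def using idm by simp
  have eq: "distr M borel X = distr D borel (\<lambda>x. x)"
  proof (rule measure_eqI)
    fix B assume "B \<in> sets (distr M borel X)"
    then have B[measurable]: "B \<in> sets borel" by simp
    have BS: "B \<inter> S \<in> sets borel" using B S by (rule sets.Int)
    have Bl[measurable]: "B \<in> sets lebesgue" using B by (simp add: sets_completionI_sets)
    have intB: "integrable lebesgue (\<lambda>x. indicator B x * (e x / I))"
      using e_int integrable_mult_indicator[OF Bl, of "\<lambda>x. e x / I"] by simp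
    have "emeasure (distr M borel X) B = emeasure M {w \<in> space M. X w \<in> B \<inter> S}"
      using B XS by (simp add: emeasure_distr) (rule arg_cong[where f = "emeasure M"], auto)
    also have "\<dots> = ennreal ((LINT x:B \<inter> S|lebesgue. exp (real N * f x N)) / I)"
      using law[OF BS] by (simp add: M.emeasure_eq_measure I_def)
    also have "(LINT x:B \<inter> S|lebesgue. exp (real N * f x N)) / I = (\<integral>x. indicator B x * (e x / I) \<partial>lebesgue)"
      by (simp add: set_lebesgue_integral_def e_def indicator_inter_arith mult.assoc)
    also have "ennreal \<dots> = (\<integral>\<^sup>+x. ennreal (indicator B x * (e x / I)) \<partial>lebesgue)"
      using intB e0 I by (intro nn_integral_eq_integral[symmetric]) auto
    also have "\<dots> = (\<integral>\<^sup>+x. ennreal (e x / I) * indicator B x \<partial>lebesgue)"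
      by (intro nn_integral_cong) (simp split: split_indicator)
    also have "\<dots> = emeasure D B" unfolding D_def by (rule emeasure_density[symmetric]) auto
    also have "\<dots> = emeasure (distr D borel (\<lambda>x. x)) B"
      using idD B by (simp add: emeasure_distr D_def)
    finally show "emeasure (distr M borel X) B = emeasure (distr D borel (\<lambda>x. x)) B" .
  qed simp
  have we: "weight N z = e (unrescale N z) * exp (- real N * f 0 N)" for z
  proof -
    have "fst (unrescale N z) \<ge> 0 \<longleftrightarrow> fst z \<le> 0" using N by (simp add: unrescale_def zero_le_divide_iff divide_le_0_iff)
    then show ?thesis
      by (auto simp: weight_def e_def S_def indicator_def exp_add[symmetric] right_diff_distrib)
  qed
  show "weight N \<in> borel_measurable lebesgue"
    unfolding we[abs_def] by measurable
  have key: "(LINT w|M. G (rescaled 0 N (X w))) = J * exp (real N * f 0 N) / I * (\<integral>z. weight N z * G z \<partial>lebesgue)"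
    if G[measurable]: "G \<in> borel_measurable borel" for G :: "'n point \<Rightarrow> real"
  proof -
    have r[measurable]: "rescaled 0 N \<in> borel_measurable (borel :: 'n point measure)"
      unfolding rescaled_def by (intro borel_measurable_continuous_onI continuous_intros)
    define G' where "G' x = G (rescaled 0 N x)" for x
    have G'[measurable]: "G' \<in> borel_measurable borel" unfolding G'_def by measurable
    have G'l[measurable]: "G' \<in> borel_measurable lebesgue" by (rule measurable_completion) simp
    have "(LINT w|M. G (rescaled 0 N (X w))) = (\<integral>x. G' x \<partial>distr M borel X)"
      by (simp add: integral_distr G'_def)
    also have "\<dots> = (\<integral>x. G' x \<partial>D)" unfolding eq by (rule integral_distr[OF idD G'])
    also have "\<dots> = (\<integral>x. (e x / I) *\<^sub>R G' x \<partial>lebesgue)"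
      unfolding D_def using e0 I by (intro integral_density) auto
    also have "\<dots> = J * (\<integral>z. (e (unrescale N z) / I) *\<^sub>R G' (unrescale N z) \<partial>lebesgue)"
      by (rule cov) simp
    also have "(\<integral>z. (e (unrescale N z) / I) *\<^sub>R G' (unrescale N z) \<partial>lebesgue) = (\<integral>z. exp (real N * f 0 N) / I * (weight N z * G z) \<partial>lebesgue)"
      by (intro Bochner_Integration.integral_cong refl)
         (simp add: we G'_def rescaled_unrescale[OF N] exp_minus field_simps)
    finally show ?thesis by simp
  qed
  define k where "k = J * exp (real N * f 0 N) / I"
  note key = key[folded k_def]
  have "k * (\<integral>z. weight N z \<partial>lebesgue) = 1"
    using key[of "\<lambda>_. 1"] M.prob_space by simp
  then have "k = 1 / (\<integral>z. weight N z \<partial>lebesgue)"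
    by (metis mult_zero_right nonzero_eq_divide_eq zero_neq_one)
  then show "G \<in> borel_measurable borel \<Longrightarrow>
       (LINT w|M. G (rescaled 0 N (X w))) = (\<integral>z. weight N z * G z \<partial>lebesgue) / (\<integral>z. weight N z \<partial>lebesgue)"
    using key[of G] by simp
qed

abbreviation "limit_dens \<equiv> limit_density \<bar>slope\<bar> (- Hess)"

lemma slope_pos: "\<bar>slope\<bar> > 0"
  using d1_f0_negative c_pos by simp

lemma precision_symmetric: "transpose (- Hess) = - Hess"
  using hessian_f0_symmetric by (simp add: transpose_def vec_eq_iff)

lemma uminus_matrix_vector: "(- A) *v (u::real^'n) = - (A *v u)" for A :: "real^'n^'n"
  by (simp add: matrix_vector_mult_def vec_eq_iff sum_negf)

lemma precision_positive: "u \<noteq> 0 \<Longrightarrow> u \<bullet> ((- Hess) *v u) > 0"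
proof -
  assume "u \<noteq> 0"
  then have "c * (u \<bullet> u) > 0" using c_pos by simp
  then show ?thesis using hessian_f0_negative[of u] by (simp add: uminus_matrix_vector)
qed

lemmas limit_density_parameters = slope_pos precision_symmetric precision_positive

text \<open>The limit weight is the limit density up to normalisation.\<close>

lemma limit_weight_eq:
  obtains W where "W > 0" "\<And>z. limit_weight z = W * limit_dens z"
proof -
  define l where "l = \<bar>slope\<bar>"
  define P where "P = - Hess"
  define s where "s = sqrt (det P / (2 * pi) ^ CARD('n))"
  have l: "l > 0" using slope_pos by (simp add: l_def)
  have a: "slope = - l" using d1_f0_negative c_pos by (simp add: l_def)
  have dP: "det P > 0" using det_positive_definite[OF precision_symmetric precision_positive] by (simp add: P_def)
  then have s: "s > 0" by (simp add: s_def)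
  have "limit_weight z = 1 / (l * s) * limit_density l P z" for z
  proof -
    have H: "snd z \<bullet> (Hess *v snd z) = - (snd z \<bullet> (P *v snd z))" by (simp add: P_def uminus_matrix_vector)
    show ?thesis
      using l s unfolding limit_weight_def limit_density_def gaussian_density_def exponential_density_def H a s_def[symmetric]
      by (simp add: exp_add[symmetric] mult.commute)
  qed
  then show thesis using that[of "1 / (l * s)"] l s by (simp add: l_def P_def)
qed

text \<open>The weighted estimate, integrated against \<open>G\<close>.\<close>

lemma integral_close:
  obtains b where "b > 0"
    "\<And>G h A. G \<in> borel_measurable borel \<Longrightarrow> h < b \<Longrightarrow> (\<And>z. \<bar>G z\<bar> \<le> A * exp (h * norm z)) \<Longrightarrow>
       integrable lborel (\<lambda>z. limit_dens z * G z) \<and>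
       (\<exists>C. \<forall>N\<ge>N1. weight N \<in> borel_measurable lebesgue \<longrightarrow>
          \<bar>(\<integral>z. weight N z * G z \<partial>lebesgue) - (\<integral>z. limit_weight z * G z \<partial>lborel)\<bar> \<le> C * rate N)"
proof -
  obtain b C where b: "b > 0" and C: "C > 0" and lw: "\<And>z. limit_weight z \<le> C * exp (- b * norm z)"
    and close: "\<And>N z. N \<ge> N1 \<Longrightarrow> \<bar>weight N z - limit_weight z\<bar> \<le> C * rate N * exp (- b * norm z)"
    using weight_close by blast
  obtain W where W: "W > 0" and eqW: "\<And>z. limit_weight z = W * limit_dens z" using limit_weight_eq by blast
  have limit_meas[measurable]: "limit_dens \<in> borel_measurable borel"
    using integrable_limit_density[OF limit_density_parameters] by (simp add: borel_measurable_integrable)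
  then have lw_meas[measurable]: "limit_weight \<in> borel_measurable borel"
    unfolding eqW[abs_def] by simp
  show thesis
  proof (rule that[OF b], intro conjI)
    fix G :: "'n point \<Rightarrow> real" and h A :: real
    assume G[measurable]: "G \<in> borel_measurable borel" and h: "h < b" and A: "\<And>z. \<bar>G z\<bar> \<le> A * exp (h * norm z)"
    have A0: "A \<ge> 0" using A[of 0] by simp
    define E where "E z = exp (- (b - h) * norm z)" for z :: "'n point"
    have E_int: "integrable lborel E" unfolding E_def using h by (intro integrable_exp_neg_norm) simp
    have E_meas[measurable]: "E \<in> borel_measurable borel" using E_int by (simp add: borel_measurable_integrable)
    have bnd: "B * exp (- b * norm z) * \<bar>G z\<bar> \<le> (B * A) * E z" if "B \<ge> 0" for B z
    proof -
      have "B * exp (- b * norm z) * \<bar>G z\<bar> \<le> B * exp (- b * norm z) * (A * exp (h * norm z))"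
        using A that by (intro mult_left_mono) auto
      also have "\<dots> = (B * A) * (exp (- b * norm z) * exp (h * norm z))" by simp
      also have "exp (- b * norm z) * exp (h * norm z) = E z" by (simp add: E_def exp_add[symmetric] algebra_simps)
      finally show ?thesis .
    qed
    have int_lw: "integrable lborel (\<lambda>z. limit_weight z * G z)"
    proof (rule Bochner_Integration.integrable_bound)
      show "integrable lborel (\<lambda>z. (C * A) * E z)" using E_int by simp
      show "AE z in lborel. norm (limit_weight z * G z) \<le> norm ((C * A) * E z)"
      proof (rule AE_I2)
        fix z
        have "norm (limit_weight z * G z) \<le> C * exp (- b * norm z) * \<bar>G z\<bar>"
          using lw[of z] limit_weight_bounds(1)[of z] by (simp add: abs_mult mult_right_mono)
        also have "\<dots> \<le> (C * A) * E z" using C by (intro bnd) simp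
        also have "\<dots> \<le> norm ((C * A) * E z)" by simp
        finally show "norm (limit_weight z * G z) \<le> norm ((C * A) * E z)" .
      qed
    qed simp
    have "(\<lambda>z. limit_dens z * G z) = (\<lambda>z. (1 / W) * (limit_weight z * G z))" using W by (simp add: eqW fun_eq_iff)
    then show "integrable lborel (\<lambda>z. limit_dens z * G z)" using int_lw by simp
    have Gl[measurable]: "G \<in> borel_measurable lebesgue" by (rule measurable_completion) simp
    have lwl[measurable]: "limit_weight \<in> borel_measurable lebesgue" by (rule measurable_completion) simp
    have int_lwl: "integrable lebesgue (\<lambda>z. limit_weight z * G z)"
      using int_lw by (subst integrable_completion) simp_all
    have El: "integrable lebesgue E" using E_int by (subst integrable_completion) simp_all
    show "\<exists>C. \<forall>N\<ge>N1. weight N \<in> borel_measurable lebesgue \<longrightarrow>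
          \<bar>(\<integral>z. weight N z * G z \<partial>lebesgue) - (\<integral>z. limit_weight z * G z \<partial>lborel)\<bar> \<le> C * rate N"
    proof (intro exI[of _ "C * A * (\<integral>z. E z \<partial>lebesgue)"] allI impI)
      fix N assume N: "N \<ge> N1" and [measurable]: "weight N \<in> borel_measurable lebesgue"
      have r: "rate N > 0" using N N1(1) N0_pos by (intro rate_pos) simp
      define d where "d z = (weight N z - limit_weight z) * G z" for z
      have dle: "norm (d z) \<le> (C * rate N * A) * E z" for z
      proof -
        have "norm (d z) \<le> C * rate N * exp (- b * norm z) * \<bar>G z\<bar>"
          using close[OF N, of z] by (simp add: d_def abs_mult mult_right_mono)
        also have "\<dots> \<le> (C * rate N * A) * E z" using C r by (intro bnd) simp
        finally show ?thesis .
      qed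
      have dint: "integrable lebesgue d"
      proof (rule Bochner_Integration.integrable_bound)
        show "integrable lebesgue (\<lambda>z. (C * rate N * A) * E z)" using El by simp
        show "d \<in> borel_measurable lebesgue" unfolding d_def by measurable
        show "AE z in lebesgue. norm (d z) \<le> norm ((C * rate N * A) * E z)"
        proof (rule AE_I2)
          fix z
          have "norm (d z) \<le> (C * rate N * A) * E z" by (rule dle)
          also have "\<dots> \<le> norm ((C * rate N * A) * E z)" by (metis abs_ge_self real_norm_def)
          finally show "norm (d z) \<le> norm ((C * rate N * A) * E z)" .
        qed
      qed
      have "(\<integral>z. weight N z * G z \<partial>lebesgue) = (\<integral>z. d z + limit_weight z * G z \<partial>lebesgue)"
        by (simp add: d_def algebra_simps)
      also have "\<dots> = (\<integral>z. d z \<partial>lebesgue) + (\<integral>z. limit_weight z * G z \<partial>lebesgue)"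
        by (rule Bochner_Integration.integral_add[OF dint int_lwl])
      also have "(\<integral>z. limit_weight z * G z \<partial>lebesgue) = (\<integral>z. limit_weight z * G z \<partial>lborel)"
        by (rule integral_completion) simp
      finally have "(\<integral>z. weight N z * G z \<partial>lebesgue) - (\<integral>z. limit_weight z * G z \<partial>lborel) = (\<integral>z. d z \<partial>lebesgue)" by simp
      also have "\<bar>\<dots>\<bar> \<le> (\<integral>z. (C * rate N * A) * E z \<partial>lebesgue)"
        using Bochner_Integration.integral_norm_bound_integral[OF dint _ dle] El by simp
      also have "\<dots> = C * A * (\<integral>z. E z \<partial>lebesgue) * rate N" by simp
      finally show "\<bar>(\<integral>z. weight N z * G z \<partial>lebesgue) - (\<integral>z. limit_weight z * G z \<partial>lborel)\<bar> \<le> C * A * (\<integral>z. E z \<partial>lebesgue) * rate N" .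
    qed
  qed
qed

lemma expectation_close:
  obtains b where "b > 0"
    "\<And>G h A. G \<in> borel_measurable borel \<Longrightarrow> h < b \<Longrightarrow> (\<And>z. \<bar>G z\<bar> \<le> A * exp (h * norm z)) \<Longrightarrow>
       integrable lborel (\<lambda>z. limit_dens z * G z) \<and>
       (\<exists>C. \<forall>\<^sub>F N in sequentially. weight N \<in> borel_measurable lebesgue \<longrightarrow>
          \<bar>(\<integral>z. weight N z * G z \<partial>lebesgue) / (\<integral>z. weight N z \<partial>lebesgue) - (\<integral>z. limit_dens z * G z \<partial>lborel)\<bar> \<le> C * rate N)"
proof -
  obtain b where b: "b > 0" and close: "\<And>G h A. G \<in> borel_measurable borel \<Longrightarrow> h < b \<Longrightarrow> (\<And>z. \<bar>G z\<bar> \<le> A * exp (h * norm z)) \<Longrightarrow>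
       integrable lborel (\<lambda>z. limit_dens z * G z) \<and>
       (\<exists>C. \<forall>N\<ge>N1. weight N \<in> borel_measurable lebesgue \<longrightarrow>
          \<bar>(\<integral>z. weight N z * G z \<partial>lebesgue) - (\<integral>z. limit_weight z * G z \<partial>lborel)\<bar> \<le> C * rate N)"
    using integral_close by blast
  obtain W where W: "W > 0" and eqW: "\<And>z. limit_weight z = W * limit_dens z" using limit_weight_eq by blast
  have "\<exists>C. \<forall>N\<ge>N1. weight N \<in> borel_measurable lebesgue \<longrightarrow>
          \<bar>(\<integral>z. weight N z * 1 \<partial>lebesgue) - (\<integral>z. limit_weight z * 1 \<partial>lborel)\<bar> \<le> C * rate N"
    using close[of "\<lambda>_. 1" 0 1] b by simp
  then obtain C1 where C1: "\<And>N. N \<ge> N1 \<Longrightarrow> weight N \<in> borel_measurable lebesgue \<Longrightarrow>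
       \<bar>(\<integral>z. weight N z \<partial>lebesgue) - (\<integral>z. limit_weight z \<partial>lborel)\<bar> \<le> C1 * rate N" by auto
  have lW: "(\<integral>z. limit_weight z \<partial>lborel) = W" unfolding eqW by (simp add: integral_limit_density[OF limit_density_parameters])
  show thesis
  proof (rule that[OF b])
    fix G :: "'n point \<Rightarrow> real" and h A :: real
    assume G: "G \<in> borel_measurable borel" and h: "h < b" and A: "\<And>z. \<bar>G z\<bar> \<le> A * exp (h * norm z)"
    from close[OF G h A] obtain C where int: "integrable lborel (\<lambda>z. limit_dens z * G z)"
      and C: "\<And>N. N \<ge> N1 \<Longrightarrow> weight N \<in> borel_measurable lebesgue \<Longrightarrow>
          \<bar>(\<integral>z. weight N z * G z \<partial>lebesgue) - (\<integral>z. limit_weight z * G z \<partial>lborel)\<bar> \<le> C * rate N" by blast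
    define x where "x = (\<integral>z. limit_weight z * G z \<partial>lborel)"
    have xW: "x / W = (\<integral>z. limit_dens z * G z \<partial>lborel)" using W by (simp add: x_def eqW mult.assoc)
    have "(\<lambda>N. C1 * rate N) \<longlonglongrightarrow> C1 * 0" by (intro tendsto_mult_left rate_tendsto_0)
    then have "\<forall>\<^sub>F N in sequentially. C1 * rate N < W / 2" using W by (intro order_tendstoD(2)) auto
    then have "\<forall>\<^sub>F N in sequentially. weight N \<in> borel_measurable lebesgue \<longrightarrow>
          \<bar>(\<integral>z. weight N z * G z \<partial>lebesgue) / (\<integral>z. weight N z \<partial>lebesgue) - (\<integral>z. limit_dens z * G z \<partial>lborel)\<bar> \<le> (2 * (C * W + \<bar>x\<bar> * C1) / W\<^sup>2) * rate N"
      using eventually_ge_at_top[of N1]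
    proof eventually_elim
      case (elim N)
      have r: "rate N \<ge> 0" using elim N1(1) N0_pos by (intro less_imp_le rate_pos) simp
      show ?case
        unfolding xW[symmetric]
        by (intro impI ratio_close W C[OF elim(2), folded x_def] C1[OF elim(2), unfolded lW] r less_imp_le[OF elim(1)])
    qed
    with int show "integrable lborel (\<lambda>z. limit_dens z * G z) \<and>
       (\<exists>C. \<forall>\<^sub>F N in sequentially. weight N \<in> borel_measurable lebesgue \<longrightarrow>
          \<bar>(\<integral>z. weight N z * G z \<partial>lebesgue) / (\<integral>z. weight N z \<partial>lebesgue) - (\<integral>z. limit_dens z * G z \<partial>lborel)\<bar> \<le> C * rate N)"
      by blast
  qed
qed

end

section \<open>Limit theorems\<close>

text \<open>The setting together with the random vectors.\<close>

locale boundary_maximum_law =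
  boundary_maximum \<Omega> \<epsilon> f Df D2f D3f N0 xmax K c \<Delta> f0 \<sigma> Df0 D\<sigma> D2f0 D2\<sigma> eps
  for \<Omega> :: "('n::finite point) set" and \<epsilon> f Df D2f D3f N0 xmax K c \<Delta> f0 \<sigma> Df0 D\<sigma> D2f0 D2\<sigma> eps +
  fixes M :: "nat \<Rightarrow> 'w measure" and X :: "nat \<Rightarrow> 'w \<Rightarrow> 'n point"
  assumes prob: "\<And>N. N \<ge> N0 \<Longrightarrow> prob_space (M N)"
    and X: "\<And>N. N \<ge> N0 \<Longrightarrow> X N \<in> borel_measurable (M N)"
    and X_in: "\<And>N w. N \<ge> N0 \<Longrightarrow> w \<in> space (M N) \<Longrightarrow> X N w \<in> \<Omega> \<inter> {x. fst x \<ge> 0}"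
    and exp_integrable: "\<And>N. N \<ge> N0 \<Longrightarrow> set_integrable lebesgue (\<Omega> \<inter> {x. fst x \<ge> 0}) (\<lambda>x. exp (real N * f x N))"
    and law: "\<And>N B. N \<ge> N0 \<Longrightarrow> B \<in> sets borel \<Longrightarrow> B \<subseteq> \<Omega> \<inter> {x. fst x \<ge> 0} \<Longrightarrow>
      measure (M N) {w \<in> space (M N). X N w \<in> B} =
        (LINT x:B|lebesgue. exp (real N * f x N)) / (LINT x:\<Omega> \<inter> {x. fst x \<ge> 0}|lebesgue. exp (real N * f x N))"
begin

text \<open>The random vector \<open>Z(N)\<close>.\<close>

definition scaled :: "nat \<Rightarrow> 'w \<Rightarrow> 'n point" where "scaled N w = rescaled 0 N (X N w)"

lemma scaled_measurable: "N \<ge> N0 \<Longrightarrow> scaled N \<in> borel_measurable (M N)"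
proof -
  assume "N \<ge> N0"
  note X[OF this, measurable]
  have [measurable]: "rescaled 0 N \<in> borel_measurable (borel :: 'n point measure)"
    unfolding rescaled_def by (intro borel_measurable_continuous_onI continuous_intros)
  show ?thesis unfolding scaled_def[abs_def] by measurable
qed

lemma expectation_limit:
  obtains b where "b > 0"
    "\<And>G h A. G \<in> borel_measurable borel \<Longrightarrow> h < b \<Longrightarrow> (\<And>z. \<bar>G z\<bar> \<le> A * exp (h * norm z)) \<Longrightarrow>
       \<exists>C. \<forall>\<^sub>F N in sequentially. \<bar>(LINT w|M N. G (scaled N w)) - (\<integral>z. limit_dens z * G z \<partial>lborel)\<bar> \<le> C * rate N"
proof -
  obtain b where b: "b > 0" and close: "\<And>G h A. G \<in> borel_measurable borel \<Longrightarrow> h < b \<Longrightarrow> (\<And>z. \<bar>G z\<bar> \<le> A * exp (h * norm z)) \<Longrightarrow>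
       integrable lborel (\<lambda>z. limit_dens z * G z) \<and>
       (\<exists>C. \<forall>\<^sub>F N in sequentially. weight N \<in> borel_measurable lebesgue \<longrightarrow>
          \<bar>(\<integral>z. weight N z * G z \<partial>lebesgue) / (\<integral>z. weight N z \<partial>lebesgue) - (\<integral>z. limit_dens z * G z \<partial>lborel)\<bar> \<le> C * rate N)"
    using expectation_close by blast
  show thesis
  proof (rule that[OF b])
    fix G :: "'n point \<Rightarrow> real" and h A :: real
    assume G: "G \<in> borel_measurable borel" "h < b" "\<And>z. \<bar>G z\<bar> \<le> A * exp (h * norm z)"
    from close[OF G] obtain C where C: "\<forall>\<^sub>F N in sequentially. weight N \<in> borel_measurable lebesgue \<longrightarrow>
          \<bar>(\<integral>z. weight N z * G z \<partial>lebesgue) / (\<integral>z. weight N z \<partial>lebesgue) - (\<integral>z. limit_dens z * G z \<partial>lborel)\<bar> \<le> C * rate N"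
      by blast
    have "\<forall>\<^sub>F N in sequentially. \<bar>(LINT w|M N. G (scaled N w)) - (\<integral>z. limit_dens z * G z \<partial>lborel)\<bar> \<le> C * rate N"
      using C eventually_ge_at_top[of N0]
    proof eventually_elim
      case (elim N)
      note * = N0_imp_pos[OF elim(2)] prob[OF elim(2)] X[OF elim(2)] X_in[OF elim(2)] exp_integrable[OF elim(2)] law[OF elim(2)]
      have "weight N \<in> borel_measurable lebesgue" by (rule expectation_rescaled(1)[OF *])
      moreover have "(LINT w|M N. G (scaled N w)) = (\<integral>z. weight N z * G z \<partial>lebesgue) / (\<integral>z. weight N z \<partial>lebesgue)"
        unfolding scaled_def by (rule expectation_rescaled(2)[OF * G(1)])
      ultimately show ?case using elim(1) by simp
    qed
    then show "\<exists>C. \<forall>\<^sub>F N in sequentially. \<bar>(LINT w|M N. G (scaled N w)) - (\<integral>z. limit_dens z * G z \<partial>lborel)\<bar> \<le> C * rate N" ..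
  qed
qed

lemma bounded_expectation_tendsto:
  assumes "G \<in> borel_measurable borel" "\<And>z. \<bar>G z\<bar> \<le> A"
  shows "(\<lambda>N. LINT w|M N. G (scaled N w)) \<longlonglongrightarrow> (\<integral>z. limit_dens z * G z \<partial>lborel)"
proof -
  obtain b where b: "b > 0" and close: "\<And>G h A. G \<in> borel_measurable borel \<Longrightarrow> h < b \<Longrightarrow> (\<And>z. \<bar>G z\<bar> \<le> A * exp (h * norm z)) \<Longrightarrow>
       \<exists>C. \<forall>\<^sub>F N in sequentially. \<bar>(LINT w|M N. G (scaled N w)) - (\<integral>z. limit_dens z * G z \<partial>lborel)\<bar> \<le> C * rate N"
    using expectation_limit by blast
  obtain C where C: "\<forall>\<^sub>F N in sequentially. \<bar>(LINT w|M N. G (scaled N w)) - (\<integral>z. limit_dens z * G z \<partial>lborel)\<bar> \<le> C * rate N"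
    using close[OF assms(1) b, of A] assms(2) by auto
  have lim: "(\<lambda>N. C * rate N) \<longlonglongrightarrow> 0" using tendsto_mult_left[OF rate_tendsto_0, of C] by simp
  have "(\<lambda>N. (LINT w|M N. G (scaled N w)) - (\<integral>z. limit_dens z * G z \<partial>lborel)) \<longlonglongrightarrow> 0"
    by (rule Lim_null_comparison[OF _ lim]) (simp only: real_norm_def C)
  then show ?thesis by (simp add: LIM_zero_iff)
qed

text \<open>Convergence of the law of \<open>\<pi>(Z(N))\<close>, tested on bounded Borel functions.\<close>

lemma distr_integral_tendsto:
  fixes \<pi> :: "'n point \<Rightarrow> 'b::topological_space" and g :: "'b \<Rightarrow> real"
  assumes \<pi>: "\<pi> \<in> borel_measurable borel" and g: "g \<in> borel_measurable borel" "\<And>x. \<bar>g x\<bar> \<le> A"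
  shows "(\<lambda>N. \<integral>x. g x \<partial>distr (M N) borel (\<lambda>w. \<pi> (scaled N w))) \<longlonglongrightarrow> (\<integral>z. limit_dens z * g (\<pi> z) \<partial>lborel)"
proof (rule Lim_transform_eventually)
  show "(\<lambda>N. LINT w|M N. g (\<pi> (scaled N w))) \<longlonglongrightarrow> (\<integral>z. limit_dens z * g (\<pi> z) \<partial>lborel)"
    by (rule bounded_expectation_tendsto[where A = A]) (use assms in simp_all)
  show "\<forall>\<^sub>F N in sequentially. (LINT w|M N. g (\<pi> (scaled N w))) = (\<integral>x. g x \<partial>distr (M N) borel (\<lambda>w. \<pi> (scaled N w)))"
    using eventually_ge_at_top[of N0]
  proof eventually_elim
    case (elim N)
    note scaled_measurable[OF elim, measurable] \<pi>[measurable] g(1)[measurable]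
    show ?case by (rule integral_distr[symmetric]) simp_all
  qed
qed

lemma marginal_density:
  assumes "g \<in> borel_measurable borel" "\<And>x. \<bar>g x\<bar> \<le> A" "h \<in> borel_measurable borel" "\<And>y. \<bar>h y\<bar> \<le> B"
  shows "(\<integral>z. limit_dens z * (g (- fst z) * h (snd z)) \<partial>lborel) =
    (\<integral>x. g x * exponential_density \<bar>slope\<bar> x \<partial>lborel) * (\<integral>y. h y * gaussian_density (- Hess) y \<partial>lborel)"
proof (rule limit_density_product[OF limit_density_parameters])
  have *: "integrable lborel (\<lambda>x. k x * p x)" if [measurable]: "k \<in> borel_measurable borel" and "\<And>x. \<bar>k x\<bar> \<le> B" and p: "integrable lborel p"
    for k p :: "'c::euclidean_space \<Rightarrow> real" and B
  proof (rule Bochner_Integration.integrable_bound)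
    have [measurable]: "p \<in> borel_measurable borel" using p by (simp add: borel_measurable_integrable)
    show "integrable lborel (\<lambda>x. B * p x)" using p by simp
    show "(\<lambda>x. k x * p x) \<in> borel_measurable lborel" by simp
    show "AE x in lborel. norm (k x * p x) \<le> norm (B * p x)"
    proof (rule AE_I2)
      fix x
      have "\<bar>k x\<bar> \<le> \<bar>B\<bar>" using that(2)[of x] by linarith
      then show "norm (k x * p x) \<le> norm (B * p x)" by (simp add: abs_mult mult_right_mono)
    qed
  qed
  show "integrable lborel (\<lambda>x. g x * exponential_density \<bar>slope\<bar> x)"
    by (rule *[OF assms(1,2) exponential_density_integral(1)[OF slope_pos]])
  show "integrable lborel (\<lambda>y. h y * gaussian_density (- Hess) y)"
    by (rule *[OF assms(3,4) integrable_gaussian_density[OF precision_symmetric precision_positive]])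
qed

lemma det_precision_positive: "det (- Hess) > 0"
  by (rule det_positive_definite[OF precision_symmetric precision_positive])

lemma hessian_invertible: "invertible Hess"
proof -
  have "invertible (- Hess)"
    using det_precision_positive by (simp add: invertible_det_nz)
  then obtain B where "(- Hess) ** B = mat 1" by (auto simp: invertible_def)
  then have "Hess ** (- B) = mat 1"
    by (simp add: matrix_matrix_mult_def vec_eq_iff)
  then show ?thesis by (metis invertible_right_inverse)
qed

lemma minus_inverse_hessian: "- matrix_inv Hess = matrix_inv (- Hess)"
  by (simp add: matrix_inv_uminus[OF hessian_invertible])

lemma normal_law_hessian:
  "normal_law 0 (matrix_inv (- Hess)) = density lborel (\<lambda>y. ennreal (gaussian_density (- Hess) y))"
  by (rule normal_law_precision[OF precision_symmetric precision_positive])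

lemma scaled_weakly_converges:
  "\<exists>\<mu>. prob_space \<mu> \<and> sets \<mu> = sets borel \<and> weakly_converges (\<lambda>N. distr (M N) borel (scaled N)) \<mu>"
proof (intro exI conjI)
  let ?\<mu> = "density lborel (\<lambda>z. ennreal (limit_dens z))"
  note nonneg = limit_density_nonneg[OF limit_density_parameters]
  have [measurable]: "limit_dens \<in> borel_measurable borel"
    using integrable_limit_density[OF limit_density_parameters] by (simp add: borel_measurable_integrable)
  show "prob_space ?\<mu>"
    by (rule prob_space_density_lborel[OF nonneg integrable_limit_density[OF limit_density_parameters] integral_limit_density[OF limit_density_parameters]])
  show "sets ?\<mu> = sets borel" by simp
  show "weakly_converges (\<lambda>N. distr (M N) borel (scaled N)) ?\<mu>"
    unfolding weakly_converges_def
  proof (intro allI impI)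
    fix g :: "'n point \<Rightarrow> real" assume "continuous_on UNIV g \<and> bounded (range g)"
    then have g[measurable]: "g \<in> borel_measurable borel" and "bounded (range g)"
      by (simp_all add: borel_measurable_continuous_onI)
    then obtain A where A: "\<And>x. \<bar>g x\<bar> \<le> A" by (auto simp: bounded_iff)
    have "(\<lambda>N. \<integral>x. g x \<partial>distr (M N) borel (\<lambda>w. scaled N w)) \<longlonglongrightarrow> (\<integral>z. limit_dens z * g z \<partial>lborel)"
      by (rule distr_integral_tendsto[of "\<lambda>z. z", OF _ g A]) simp
    moreover have "integral\<^sup>L ?\<mu> g = (\<integral>z. limit_dens z * g z \<partial>lborel)"
      using nonneg by (subst integral_density) simp_all
    ultimately show "(\<lambda>N. integral\<^sup>L (distr (M N) borel (scaled N)) g) \<longlonglongrightarrow> integral\<^sup>L ?\<mu> g" by simp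
  qed
qed

text \<open>The test functions need not be continuous, so distribution functions converge at every point.\<close>

lemma fst_scaled_weak_conv:
  "weak_conv_m (\<lambda>N. distr (M N) borel (\<lambda>w. - fst (scaled N w))) (exponential_law \<bar>slope\<bar>)"
  unfolding weak_conv_m_def weak_conv_def
proof (intro allI impI)
  fix x :: real
  have c: "cdf \<nu> x = (\<integral>y. indicator {..x} y \<partial>\<nu>)" if "space \<nu> = UNIV" for \<nu>
    using that by (simp add: cdf_def)
  have meas: "(\<lambda>z. - fst z) \<in> borel_measurable (borel :: 'n point measure)"
    by (intro borel_measurable_continuous_onI continuous_intros)
  have "(\<lambda>N. \<integral>y. indicator {..x} y \<partial>distr (M N) borel (\<lambda>w. - fst (scaled N w))) \<longlonglongrightarrow>
      (\<integral>z. limit_dens z * indicator {..x} (- fst z) \<partial>lborel)"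
    by (rule distr_integral_tendsto[OF meas, where A = 1]) (simp_all add: indicator_def)
  also have "(\<integral>z. limit_dens z * indicator {..x} (- fst z) \<partial>lborel) =
     (\<integral>y. indicator {..x} y * exponential_density \<bar>slope\<bar> y \<partial>lborel)"
    using marginal_density[of "indicator {..x}" 1 "\<lambda>_. 1" 1]
    by (simp add: integral_gaussian_density[OF precision_symmetric precision_positive] indicator_def)
  also have "\<dots> = (\<integral>y. indicator {..x} y \<partial>exponential_law \<bar>slope\<bar>)"
    unfolding exponential_law_def using exponential_density_nonneg[OF slope_pos]
    by (subst integral_density) (simp_all add: mult.commute)
  finally show "(\<lambda>N. cdf (distr (M N) borel (\<lambda>w. - fst (scaled N w))) x) \<longlonglongrightarrow> cdf (exponential_law \<bar>slope\<bar>) x"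
    by (subst (1 2) c) (simp_all add: exponential_law_def)
qed

lemma snd_scaled_weakly_converges:
  "weakly_converges (\<lambda>N. distr (M N) borel (\<lambda>w. snd (scaled N w))) (normal_law 0 (- matrix_inv Hess))"
  unfolding weakly_converges_def
proof (intro allI impI)
  fix g :: "real^'n \<Rightarrow> real" assume "continuous_on UNIV g \<and> bounded (range g)"
  then have g[measurable]: "g \<in> borel_measurable borel" and "bounded (range g)"
    by (simp_all add: borel_measurable_continuous_onI)
  then obtain A where A: "\<And>x. \<bar>g x\<bar> \<le> A" by (auto simp: bounded_iff)
  have meas: "snd \<in> borel_measurable (borel :: 'n point measure)"
    by (intro borel_measurable_continuous_onI continuous_intros)
  have "(\<lambda>N. \<integral>x. g x \<partial>distr (M N) borel (\<lambda>w. snd (scaled N w))) \<longlonglongrightarrow> (\<integral>z. limit_dens z * g (snd z) \<partial>lborel)"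
    by (rule distr_integral_tendsto[OF meas g A])
  also have "(\<integral>z. limit_dens z * g (snd z) \<partial>lborel) = (\<integral>y. g y * gaussian_density (- Hess) y \<partial>lborel)"
    using marginal_density[of "\<lambda>_. 1" 1 g A] g A exponential_density_integral(2)[OF slope_pos] by simp
  also have "\<dots> = integral\<^sup>L (normal_law 0 (- matrix_inv Hess)) g"
    unfolding minus_inverse_hessian normal_law_hessian
    using gaussian_density_nonneg[OF det_precision_positive]
    by (subst integral_density) (simp_all add: mult.commute)
  finally show "(\<lambda>N. integral\<^sup>L (distr (M N) borel (\<lambda>w. snd (scaled N w))) g)
      \<longlonglongrightarrow> integral\<^sup>L (normal_law 0 (- matrix_inv Hess)) g" .
qed

lemma limit_mgf:
  assumes "norm \<xi> < \<bar>slope\<bar>"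
  shows "(\<integral>z. limit_dens z * exp (\<xi> \<bullet> z) \<partial>lborel) =
    \<bar>slope\<bar> / \<bar>slope - fst \<xi>\<bar> * exp (- (snd \<xi> \<bullet> (matrix_inv Hess *v snd \<xi>)) / 2)"
proof -
  define l where "l = \<bar>slope\<bar>"
  define P where "P = - Hess"
  have l: "l > 0" using slope_pos by (simp add: l_def)
  have a: "slope = - l" using d1_f0_negative c_pos by (simp add: l_def)
  have ls: "l + fst \<xi> > 0" using assms norm_fst_le[of "fst \<xi>" "snd \<xi>"] by (simp add: l_def)
  have E: "(\<integral>x. exp (- (fst \<xi> * x)) * exponential_density l x \<partial>lborel) = l / (l + fst \<xi>)"
    by (rule exponential_mgf[OF l ls])
  have Gm: "(\<integral>y. exp (snd \<xi> \<bullet> y) * gaussian_density P y \<partial>lborel) = exp (snd \<xi> \<bullet> (matrix_inv P *v snd \<xi>) / 2)"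
    unfolding P_def by (rule gaussian_mgf[OF precision_symmetric precision_positive])
  have "(\<integral>z. limit_density l P z * exp (\<xi> \<bullet> z) \<partial>lborel) =
     (\<integral>z. limit_density l P z * (exp (- (fst \<xi> * (- fst z))) * exp (snd \<xi> \<bullet> snd z)) \<partial>lborel)"
    by (simp add: exp_add[symmetric] inner_prod_def)
  also have "\<dots> = l / (l + fst \<xi>) * exp (snd \<xi> \<bullet> (matrix_inv P *v snd \<xi>) / 2)"
    unfolding E[symmetric] Gm[symmetric]
  proof (rule limit_density_product)
    show "integrable lborel (\<lambda>x. exp (- (fst \<xi> * x)) * exponential_density l x)"
      using E l ls not_integrable_integral_eq[of lborel "\<lambda>x. exp (- (fst \<xi> * x)) * exponential_density l x"] by auto
    show "integrable lborel (\<lambda>y. exp (snd \<xi> \<bullet> y) * gaussian_density P y)"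
      using Gm not_integrable_integral_eq[of lborel "\<lambda>y. exp (snd \<xi> \<bullet> y) * gaussian_density P y"] by auto
  qed (use l precision_symmetric precision_positive in \<open>auto simp: P_def\<close>)
  also have "snd \<xi> \<bullet> (matrix_inv P *v snd \<xi>) = - (snd \<xi> \<bullet> (matrix_inv Hess *v snd \<xi>))"
    unfolding P_def minus_inverse_hessian[symmetric] by (simp add: uminus_matrix_vector)
  also have "l / (l + fst \<xi>) = \<bar>slope\<bar> / \<bar>slope - fst \<xi>\<bar>"
    using l ls by (simp add: a abs_if)
  finally show ?thesis by (simp add: l_def P_def)
qed

lemma mgf_asymptotics:
  "\<exists>h>0. \<forall>\<xi>. norm \<xi> < h \<longrightarrow>
            (\<exists>u v :: nat \<Rightarrow> real. u \<in> O(\<lambda>_. 1) \<and> v \<in> O(\<lambda>_. 1) \<and>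
              (\<forall>\<^sub>F N in sequentially.
                 mgf (M N) (scaled N) \<xi> =
                   \<bar>slope\<bar> / \<bar>slope - fst \<xi>\<bar> * exp (- (snd \<xi> \<bullet> (matrix_inv Hess *v snd \<xi>)) / 2) *
                   (1 + u N / sqrt (real N) + eps N * sqrt (real N) * v N)))"
  (is "\<exists>h>0. \<forall>\<xi>. norm \<xi> < h \<longrightarrow> ?P \<xi>")
proof -
  obtain b where b: "b > 0" and close: "\<And>G h A. G \<in> borel_measurable borel \<Longrightarrow> h < b \<Longrightarrow> (\<And>z. \<bar>G z\<bar> \<le> A * exp (h * norm z)) \<Longrightarrow>
       \<exists>C. \<forall>\<^sub>F N in sequentially. \<bar>(LINT w|M N. G (scaled N w)) - (\<integral>z. limit_dens z * G z \<partial>lborel)\<bar> \<le> C * rate N"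
    using expectation_limit by blast
  show ?thesis
  proof (intro exI[of _ "min b \<bar>slope\<bar>"] conjI allI impI)
    show "min b \<bar>slope\<bar> > 0" using b slope_pos by simp
    fix \<xi> :: "'n point" assume \<xi>: "norm \<xi> < min b \<bar>slope\<bar>"
    define L where "L = \<bar>slope\<bar> / \<bar>slope - fst \<xi>\<bar> * exp (- (snd \<xi> \<bullet> (matrix_inv Hess *v snd \<xi>)) / 2)"
    have L: "L > 0"
    proof -
      have "\<bar>fst \<xi>\<bar> < \<bar>slope\<bar>" using \<xi> norm_fst_le[of "fst \<xi>" "snd \<xi>"] by simp
      then show ?thesis using slope_pos by (auto simp: L_def)
    qed
    have "(\<lambda>z. exp (\<xi> \<bullet> z)) \<in> borel_measurable (borel :: 'n point measure)"
      by (intro borel_measurable_continuous_onI continuous_intros)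
    moreover have "\<bar>exp (\<xi> \<bullet> z)\<bar> \<le> 1 * exp (norm \<xi> * norm z)" for z
      using norm_cauchy_schwarz[of \<xi> z] by simp
    ultimately have "\<exists>C. \<forall>\<^sub>F N in sequentially. \<bar>(LINT w|M N. exp (\<xi> \<bullet> scaled N w)) - (\<integral>z. limit_dens z * exp (\<xi> \<bullet> z) \<partial>lborel)\<bar> \<le> C * rate N"
      using \<xi> by (intro close[where h = "norm \<xi>" and A = 1]) auto
    then obtain C where C: "\<forall>\<^sub>F N in sequentially. \<bar>mgf (M N) (scaled N) \<xi> - L\<bar> \<le> C * rate N"
      using limit_mgf[of \<xi>] \<xi> by (auto simp: mgf_def L_def)
    \<comment> \<open>one sequence serves as both \<open>u\<close> and \<open>v\<close>, because \<open>u / \<surd>N + eps \<surd>N u = u rate\<close>\<close>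
    define u where "u N = (mgf (M N) (scaled N) \<xi> / L - 1) / rate N" for N
    have "u \<in> O(\<lambda>_. 1)"
    proof (rule bigoI)
      show "\<forall>\<^sub>F N in sequentially. norm (u N) \<le> (C / L) * norm (1::real)"
        using C eventually_gt_at_top[of 0]
      proof eventually_elim
        case (elim N)
        have r: "rate N > 0" by (rule rate_pos[OF elim(2)])
        have "u N = (mgf (M N) (scaled N) \<xi> - L) / (L * rate N)" using L r by (simp add: u_def field_simps)
        then have "norm (u N) = \<bar>mgf (M N) (scaled N) \<xi> - L\<bar> / (L * rate N)" using L r by (simp add: abs_mult)
        also have "\<dots> \<le> (C * rate N) / (L * rate N)" using elim(1) L r by (intro divide_right_mono) auto
        also have "\<dots> = C / L" using r by simp
        finally show ?case by simp
      qed
    qed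
    moreover have "\<forall>\<^sub>F N in sequentially. mgf (M N) (scaled N) \<xi> = L * (1 + u N / sqrt (real N) + eps N * sqrt (real N) * u N)"
      using eventually_gt_at_top[of 0]
    proof eventually_elim
      case (elim N)
      have r: "rate N > 0" by (rule rate_pos[OF elim])
      have "1 + u N / sqrt (real N) + eps N * sqrt (real N) * u N = 1 + u N * rate N"
        by (simp add: rate_def distrib_left mult_ac)
      also have "\<dots> = mgf (M N) (scaled N) \<xi> / L" using r by (simp add: u_def)
      finally show ?case using L by simp
    qed
    ultimately show "?P \<xi>"
      unfolding L_def by blast
  qed
qed

end

section \<open>The boundary maximum theorem\<close>

theorem theorem6:
  fixes \<Omega> :: "('n::finite point) set"
    and \<epsilon> :: real
    and f :: "'n point \<Rightarrow> nat \<Rightarrow> real"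
    and Df :: "'n point \<Rightarrow> nat \<Rightarrow> 'n point \<Rightarrow>\<^sub>L real"
    and D2f :: "'n point \<Rightarrow> nat \<Rightarrow> 'n point \<Rightarrow>\<^sub>L 'n point \<Rightarrow>\<^sub>L real"
    and D3f :: "'n point \<Rightarrow> nat \<Rightarrow>
          'n point \<Rightarrow>\<^sub>L 'n point \<Rightarrow>\<^sub>L 'n point \<Rightarrow>\<^sub>L real"
    and N0 :: nat
    and xmax :: "nat \<Rightarrow> 'n point"
    and xstar :: "'n point"
    and C :: real
    and f0 \<sigma> :: "'n point \<Rightarrow> real"
    and Df0 D\<sigma> :: "'n point \<Rightarrow> 'n point \<Rightarrow>\<^sub>L real"
    and D2f0 D2\<sigma> :: "'n point \<Rightarrow>\<^sub>L 'n point \<Rightarrow>\<^sub>L real"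
    and eps :: "nat \<Rightarrow> real"
    and M :: "nat \<Rightarrow> 'w measure"
    and X :: "nat \<Rightarrow> 'w \<Rightarrow> 'n point"
  defines "\<Omega>' \<equiv> cball 0 \<epsilon>"
    and "S \<equiv> \<Omega> \<inter> {x. fst x \<ge> 0}"
  assumes "open \<Omega>" and "bounded \<Omega>" and "\<epsilon> > 0" and "\<Omega>' \<subseteq> \<Omega>"
    \<comment> \<open>derivatives are taken relative to the closed ball, hence one-sided on its boundary\<close>
    and "\<And>N x. N > 0 \<Longrightarrow> x \<in> \<Omega>' \<Longrightarrow>
      ((\<lambda>z. f z N) has_derivative blinfun_apply (Df x N)) (at x within \<Omega>')"
    and "\<And>N x. N > 0 \<Longrightarrow> x \<in> \<Omega>' \<Longrightarrow>
      ((\<lambda>z. Df z N) has_derivative blinfun_apply (D2f x N)) (at x within \<Omega>')"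
    and "\<And>N x. N > 0 \<Longrightarrow> x \<in> \<Omega>' \<Longrightarrow>
      ((\<lambda>z. D2f z N) has_derivative blinfun_apply (D3f x N)) (at x within \<Omega>')"
    and "\<exists>K. \<forall>N>0. \<forall>x\<in>\<Omega>'. \<bar>f x N\<bar> \<le> K \<and> norm (Df x N) \<le> K \<and>
      norm (D2f x N) \<le> K \<and> norm (D3f x N) \<le> K"
    and "\<And>N x. N > 0 \<Longrightarrow> x \<in> \<Omega>' \<Longrightarrow> invertible (hessian (D2f x N))"
    and "N0 > 0"
    and "\<And>N. N \<ge> N0 \<Longrightarrow> xmax N \<in> \<Omega>' \<and> fst (xmax N) = 0"
    and "\<And>N x. N \<ge> N0 \<Longrightarrow> x \<in> S \<Longrightarrow> x \<noteq> xmax N \<Longrightarrow> f x N < f (xmax N) N"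
    \<comment> \<open>infimum in the extended reals, as the set is not known to be bounded below\<close>
    and "(INF (x, N) \<in> (\<Omega> - \<Omega>') \<times> {N0..}. ereal (f (xmax N) N - f x N)) > 0"
    and "xmax \<longlonglongrightarrow> xstar" and "xstar = 0"
    and "(INF (x, N) \<in> \<Omega>' \<times> {N0..}. \<bar>d1 (Df x N)\<bar>) > 0"
    and "(INF (x, N) \<in> \<Omega>' \<times> {N0..}. min_abs_eigenvalue (hessian_y (D2f x N))) > 0"
    and "(INF (x, N) \<in> \<Omega>' \<times> {N0..}. sqrt \<bar>det (hessian_y (D2f x N))\<bar>) > 0"
    and "bdd_above ((\<lambda>(x, N). norm (D2f x N)) ` (\<Omega>' \<times> {N0..}))"
    and "bdd_above ((\<lambda>(x, N). norm (D3f x N)) ` (\<Omega>' \<times> {N0..}))"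
    and "\<And>N x1. N \<ge> N0 \<Longrightarrow> x1 \<in> {0<..<\<epsilon>} \<Longrightarrow>
      \<exists>!y. is_arg_max (\<lambda>y. f (x1, y) N) (\<lambda>y. (x1, y) \<in> \<Omega>') y"
    and "\<And>N. N \<ge> N0 \<Longrightarrow> set_integrable lebesgue S (\<lambda>x. exp (real N * f x N))"
    and "C > 0"
    and "\<And>N. N \<ge> N0 \<Longrightarrow> set_integrable lebesgue \<Omega> (\<lambda>x. exp (real N0 * f x N))"
    and "\<And>N. N \<ge> N0 \<Longrightarrow> (LINT x:\<Omega>|lebesgue. exp (real N0 * f x N)) \<le> C"
    and "\<And>N x. N > 0 \<Longrightarrow> x \<in> \<Omega> \<Longrightarrow> f x N = f0 x + eps N * \<sigma> x"
    and "has_two_derivatives_at f0 Df0 D2f0 xstar"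
    and "has_two_derivatives_at \<sigma> D\<sigma> D2\<sigma> xstar"
    and "invertible (hessian D2f0)"
    and "\<And>N. N > 0 \<Longrightarrow> eps N > 0"
    and "eps \<in> o(\<lambda>N. 1 / sqrt (real N))"
    and "\<And>N. N \<ge> N0 \<Longrightarrow> prob_space (M N)"
    and "\<And>N. N \<ge> N0 \<Longrightarrow> X N \<in> borel_measurable (M N)"
    and "\<And>N w. N \<ge> N0 \<Longrightarrow> w \<in> space (M N) \<Longrightarrow> X N w \<in> S"
    and "\<And>N B. N \<ge> N0 \<Longrightarrow> B \<in> sets borel \<Longrightarrow> B \<subseteq> S \<Longrightarrow>
      measure (M N) {w \<in> space (M N). X N w \<in> B} =
        (LINT x:B|lebesgue. exp (real N * f x N)) / (LINT x:S|lebesgue. exp (real N * f x N))"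
  defines "Z \<equiv> \<lambda>N w. rescaled xstar N (X N w)"
    and "a \<equiv> d1 (Df0 xstar)"
    and "H \<equiv> hessian_y D2f0"
  shows "(\<exists>\<mu>. prob_space \<mu> \<and> sets \<mu> = sets borel \<and>
            weakly_converges (\<lambda>N. distr (M N) borel (Z N)) \<mu>) \<and>
         weak_conv_m (\<lambda>N. distr (M N) borel (\<lambda>w. - fst (Z N w))) (exponential_law \<bar>a\<bar>) \<and>
         weakly_converges (\<lambda>N. distr (M N) borel (\<lambda>w. snd (Z N w)))
           (normal_law 0 (- matrix_inv H)) \<and>
         (\<exists>h>0. \<forall>\<xi>. norm \<xi> < h \<longrightarrow>
            (\<exists>u v :: nat \<Rightarrow> real. u \<in> O(\<lambda>_. 1) \<and> v \<in> O(\<lambda>_. 1) \<and>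
              (\<forall>\<^sub>F N in sequentially.
                 mgf (M N) (Z N) \<xi> =
                   \<bar>a\<bar> / \<bar>a - fst \<xi>\<bar> * exp (- (snd \<xi> \<bullet> (matrix_inv H *v snd \<xi>)) / 2) *
                   (1 + u N / sqrt (real N) + eps N * sqrt (real N) * v N))))"
proof -
  note asm = assms(3-)
  obtain K where K: "\<And>N x. N > 0 \<Longrightarrow> x \<in> \<Omega>' \<Longrightarrow> \<bar>f x N\<bar> \<le> K \<and> norm (Df x N) \<le> K \<and>
      norm (D2f x N) \<le> K \<and> norm (D3f x N) \<le> K"
    using asm(8) by blast
  define c where "c = min (INF (x, N) \<in> \<Omega>' \<times> {N0..}. \<bar>d1 (Df x N)\<bar>)
     (INF (x, N) \<in> \<Omega>' \<times> {N0..}. min_abs_eigenvalue (hessian_y (D2f x N)))"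
  have c_pos: "c > 0"
    using asm(16,17) by (simp add: c_def)
  have N_pos: "N > 0" if "N \<ge> N0" for N using that \<open>N0 > 0\<close> by simp
  have c1: "c \<le> \<bar>d1 (Df x N)\<bar>" if "N \<ge> N0" "x \<in> \<Omega>'" for N x
  proof -
    have "(INF (x, N) \<in> \<Omega>' \<times> {N0..}. \<bar>d1 (Df x N)\<bar>) \<le> (case (x, N) of (x, N) \<Rightarrow> \<bar>d1 (Df x N)\<bar>)"
      by (rule cINF_lower) (use that in \<open>auto intro!: bdd_belowI[of _ 0]\<close>)
    then show ?thesis by (simp add: c_def)
  qed
  \<comment> \<open>symmetry makes the eigenvalue sets nonempty and finite, so that the infimum of \<open>min_abs_eigenvalue\<close> is over a set bounded below\<close>
  have symmetric: "transpose (hessian_y (D2f x N)) = hessian_y (D2f x N)" if "N \<ge> N0" "x \<in> \<Omega>'" for N x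
  proof (rule transpose_hessian_y)
    fix u v :: "'n point"
    show "bilin (D2f x N) u v = bilin (D2f x N) v u"
    proof (rule second_derivative_symmetric_cball[OF \<open>\<epsilon> > 0\<close>])
      fix z :: "'n point" assume z: "z \<in> cball 0 \<epsilon>"
      note zN = N_pos[OF that(1)] z[folded \<Omega>'_def]
      show "((\<lambda>z. f z N) has_derivative blinfun_apply (Df z N)) (at z within cball 0 \<epsilon>)"
        "((\<lambda>z. Df z N) has_derivative blinfun_apply (D2f z N)) (at z within cball 0 \<epsilon>)"
        "((\<lambda>z. D2f z N) has_derivative blinfun_apply (D3f z N)) (at z within cball 0 \<epsilon>)"
        using asm(5-7)[OF zN] by (simp_all add: \<Omega>'_def)
      show "norm (D3f z N) \<le> K" using K[OF zN] by simp
    qed (use that in \<open>simp add: \<Omega>'_def\<close>)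
  qed
  have c2: "c \<le> min_abs_eigenvalue (hessian_y (D2f x N))" if "N \<ge> N0" "x \<in> \<Omega>'" for N x
  proof -
    have "(INF (x, N) \<in> \<Omega>' \<times> {N0..}. min_abs_eigenvalue (hessian_y (D2f x N)))
        \<le> (case (x, N) of (x, N) \<Rightarrow> min_abs_eigenvalue (hessian_y (D2f x N)))"
    proof (rule cINF_lower)
      show "bdd_below ((\<lambda>(x, N). min_abs_eigenvalue (hessian_y (D2f x N))) ` (\<Omega>' \<times> {N0..}))"
        by (rule bdd_belowI[of _ 0]) (auto intro!: min_abs_eigenvalue_bounds(1)[OF symmetric])
    qed (use that in simp)
    then show ?thesis by (simp add: c_def)
  qed
  obtain \<Delta> where \<Delta>: "0 < ereal \<Delta>" "ereal \<Delta> < (INF (x, N) \<in> (\<Omega> - \<Omega>') \<times> {N0..}. ereal (f (xmax N) N - f x N))"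
    using ereal_dense2[OF asm(13)]
    by (elim exE conjE)
  have gap: "\<Delta> \<le> f (xmax N) N - f x N" if "N \<ge> N0" "x \<in> \<Omega> - \<Omega>'" for N x
  proof -
    have "(INF (x, N) \<in> (\<Omega> - \<Omega>') \<times> {N0..}. ereal (f (xmax N) N - f x N)) \<le> (case (x, N) of (x, N) \<Rightarrow> ereal (f (xmax N) N - f x N))"
      by (rule INF_lower) (use that in simp)
    with \<Delta>(2) have "ereal \<Delta> < (case (x, N) of (x, N) \<Rightarrow> ereal (f (xmax N) N - f x N))"
      by (rule less_le_trans)
    then show ?thesis by simp
  qed
  have eps_small: "(\<lambda>N. eps N * sqrt (real N)) \<longlonglongrightarrow> 0"
    using smalloD_tendsto[OF asm(31)] by simp
  have max: "f x N \<le> f (xmax N) N" if "N \<ge> N0" "x \<in> \<Omega>" "fst x \<ge> 0" for N x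
    using asm(12)[OF that(1), of x] that by (cases "x = xmax N") (auto simp: S_def)
  note facts = asm(1-7,10,11,14,22,26-28,30,32-35)[unfolded \<Omega>'_def S_def \<open>xstar = 0\<close>]
    gap[unfolded \<Omega>'_def] c1[unfolded \<Omega>'_def] c2[unfolded \<Omega>'_def]
  have K': "norm (D2f x N) \<le> K" "norm (D3f x N) \<le> K" "norm (Df x N) \<le> K" if "N > 0" "x \<in> cball 0 \<epsilon>" for N x
    using K[OF that(1) that(2)[folded \<Omega>'_def]] by simp_all
  have \<Delta>_pos: "\<Delta> > 0" using \<Delta>(1) by simp
  interpret boundary_maximum_law \<Omega> \<epsilon> f Df D2f D3f N0 xmax K c \<Delta> f0 \<sigma> Df0 D\<sigma> D2f0 D2\<sigma> eps M X
    by (intro boundary_maximum_law.intro boundary_maximum.intro boundary_maximum_law_axioms.intro)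
      (fact facts max K' \<Delta>_pos c_pos eps_small)+
  have Z_eq: "Z = scaled"
    using \<open>xstar = 0\<close> by (simp add: Z_def scaled_def fun_eq_iff)
  show ?thesis
    unfolding Z_eq a_def H_def \<open>xstar = 0\<close>
    by (intro conjI scaled_weakly_converges fst_scaled_weak_conv snd_scaled_weakly_converges mgf_asymptotics)
qed

end
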